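(* Let $d\ge2$, $1<p<\infty$, and let $\omega_{\varepsilon,\eta}=\mathbb{R}^d\setminus\bigcup_{k\in\mathbb{Z}^d}\varepsilon(k+\eta T)$ be a periodically perforated domain with hole $T$ having $C^1$ boundary, as in the context, $\varepsilon,\eta\in(0,1]$. Let $$A_p(\varepsilon,\eta)=\sup\|\nabla u\|_{L^p(\omega_{\varepsilon,\eta})},$$ where the supremum is over all weak solutions $u\in W^{1,2}_0(\omega_{\varepsilon,\eta})$ of $-\Delta u=\mathrm{div}(f)$ in $\omega_{\varepsilon,\eta}$ with $f\in L^p(\omega_{\varepsilon,\eta};\mathbb{R}^d)\cap L^2(\omega_{\varepsilon,\eta};\mathbb{R}^d)$ and $\|f\|_{L^p(\omega_{\varepsilon,\eta})}=1$. Then, for $d\ge3$, $$A_p(\varepsilon,\eta)\ge c\,\eta^{-d|\frac12-\frac1p|},$$ and for $d=2$, $$A_p(\varepsilon,\eta)\ge c\,|\ln(\eta/2)|^{-\frac12}\eta^{-2|\frac12-\frac1p|},$$ where $c>0$ depends only on $d$, $p$ and $T$.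
   Context: $Y=[-1/2,1/2]^d$. The hole $T$ is the closure of a bounded subdomain of $Y$ with $C^1$ boundary such that $Y\setminus T$ is connected, $B(0,c_0)\subset T$ and $\mathrm{dist}(\partial T,\partial Y)\ge c_0$ for some $c_0>0$. $W^{1,2}_0(\Omega)$ is the completion of $C_0^\infty(\Omega)$ with respect to the norm $\|\nabla\psi\|_{L^2(\Omega)}$; a weak solution of $-\Delta u=\mathrm{div}(f)$ satisfies $\int\nabla u\cdot\nabla\phi=-\int f\cdot\nabla\phi$ for all $\phi\in C_0^\infty$. *)

theory Defs
  imports "HOL-Analysis.Analysis"
begin

definition grad :: "(real^'n \<Rightarrow> real) \<Rightarrow> real^'n \<Rightarrow> real^'n" where
  "grad f x = (\<chi> i. frechet_derivative f (at x) (axis i 1))"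

text \<open>Functions of class \<open>C\<^sup>k\<close> on the whole space.\<close>

primrec class_C :: "nat \<Rightarrow> (real^'n \<Rightarrow> real) \<Rightarrow> bool" where
  "class_C 0 f \<longleftrightarrow> continuous_on UNIV f"
| "class_C (Suc k) f \<longleftrightarrow>
     (\<forall>x. f differentiable (at x)) \<and> (\<forall>i. class_C k (\<lambda>x. grad f x $ i))"

text \<open>The space \<open>C\<^sub>0\<^sup>\<infinity>(\<Omega>)\<close>; its elements are regarded as functions on the whole space, extended by zero.\<close>

definition test_functions :: "(real^'n) set \<Rightarrow> (real^'n \<Rightarrow> real) set" where
  "test_functions \<Omega> = {\<phi>. (\<forall>k. class_C k \<phi>) \<and>
     compact (closure {x. \<phi> x \<noteq> 0}) \<and> closure {x. \<phi> x \<noteq> 0} \<subseteq> \<Omega>}"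

text \<open>Locally, after a rotation, the set is the region above the graph of a \<open>C\<^sup>1\<close> function \<open>h\<close>.
  The unit vector \<open>e\<close> is the direction of the last rotated coordinate, and \<open>h\<close> is only evaluated
  on the hyperplane orthogonal to \<open>e\<close>.\<close>

definition C1_boundary :: "(real^'n) set \<Rightarrow> bool" where
  "C1_boundary D \<longleftrightarrow> (\<forall>z\<in>frontier D. \<exists>r>0. \<exists>e h. norm e = 1 \<and> class_C 1 h \<and>
     (\<forall>y\<in>ball z r. y \<in> D \<longleftrightarrow> h (y - (y \<bullet> e) *\<^sub>R e) < y \<bullet> e))"

definition unit_cell :: "(real^'n) set" where
  "unit_cell = cbox (\<chi> i. - 1/2) (\<chi> i. 1/2)"

definition admissible_hole :: "(real^'n) set \<Rightarrow> bool" where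
  "admissible_hole T \<longleftrightarrow>
     (\<exists>D. open D \<and> connected D \<and> D \<noteq> {} \<and> bounded D \<and> D \<subseteq> unit_cell \<and> C1_boundary D \<and>
          T = closure D) \<and>
     connected (unit_cell - T) \<and>
     (\<exists>c0>0. ball 0 c0 \<subseteq> T \<and> c0 \<le> setdist (frontier T) (frontier unit_cell))"

definition perforated_domain :: "(real^'n) set \<Rightarrow> real \<Rightarrow> real \<Rightarrow> (real^'n) set" where
  "perforated_domain T \<epsilon> \<eta> =
     UNIV - (\<Union>k\<in>{k. \<forall>i. k $ i \<in> \<int>}. (\<lambda>x. \<epsilon> *\<^sub>R (k + \<eta> *\<^sub>R x)) ` T)"

definition Lp_norm :: "real \<Rightarrow> 'a measure \<Rightarrow> ('a \<Rightarrow> 'b::real_normed_vector) \<Rightarrow> ennreal" where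
  "Lp_norm p M g =
     (let I = \<integral>\<^sup>+ x. ennreal (norm (g x) powr p) \<partial>M
      in if I = \<infinity> then \<infinity> else ennreal (enn2real I powr (1 / p)))"

definition in_Lp :: "real \<Rightarrow> 'a measure \<Rightarrow> ('a \<Rightarrow> 'b::real_normed_vector) \<Rightarrow> bool" where
  "in_Lp p M g \<longleftrightarrow> g \<in> borel_measurable M \<and> Lp_norm p M g < \<infinity>"

text \<open>\<open>W012 \<Omega> u G\<close>: the function \<open>u\<close> belongs to the completion \<open>W\<^sub>0\<^sup>1\<^sup>,\<^sup>2(\<Omega>)\<close> of \<open>C\<^sub>0\<^sup>\<infinity>(\<Omega>)\<close> with
  respect to the \<open>L\<^sup>2(\<Omega>)\<close> norm of the gradient, and \<open>G\<close> is its gradient. An element of the completion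
  is given by a Cauchy sequence \<open>\<psi>\<close>, its gradient is the \<open>L\<^sup>2\<close> limit of the gradients of \<open>\<psi>\<close>, and
  it is identified with the limit of \<open>\<psi>\<close> in \<open>L\<^sup>1\<close> on compact subsets of \<open>\<Omega>\<close>. In a perforated domain
  this limit always exists and determines the element, by the Poincare inequality.\<close>

definition W012 :: "(real^'n) set \<Rightarrow> (real^'n \<Rightarrow> real) \<Rightarrow> (real^'n \<Rightarrow> real^'n) \<Rightarrow> bool" where
  "W012 \<Omega> u G \<longleftrightarrow>
     u \<in> borel_measurable (lebesgue_on \<Omega>) \<and> in_Lp 2 (lebesgue_on \<Omega>) G \<and>
     (\<exists>\<psi>. (\<forall>n::nat. \<psi> n \<in> test_functions \<Omega>) \<and>
        (\<lambda>n. Lp_norm 2 (lebesgue_on \<Omega>) (\<lambda>x. grad (\<psi> n) x - G x)) \<longlonglongrightarrow> 0 \<and>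
        (\<forall>K. compact K \<and> K \<subseteq> \<Omega> \<longrightarrow>
           (\<lambda>n. Lp_norm 1 (lebesgue_on K) (\<lambda>x. \<psi> n x - u x)) \<longlonglongrightarrow> 0))"

text \<open>\<open>u\<close>, with gradient \<open>G\<close>, is a weak solution in \<open>W\<^sub>0\<^sup>1\<^sup>,\<^sup>2(\<Omega>)\<close> of \<open>- \<Delta> u = div f\<close> in \<open>\<Omega>\<close>.\<close>

definition weak_solution ::
  "(real^'n) set \<Rightarrow> (real^'n \<Rightarrow> real^'n) \<Rightarrow> (real^'n \<Rightarrow> real) \<Rightarrow> (real^'n \<Rightarrow> real^'n) \<Rightarrow> bool" where
  "weak_solution \<Omega> f u G \<longleftrightarrow> W012 \<Omega> u G \<and>
     (\<forall>\<phi>\<in>test_functions \<Omega>.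
        (\<integral>x. G x \<bullet> grad \<phi> x \<partial>lebesgue_on \<Omega>) = - (\<integral>x. f x \<bullet> grad \<phi> x \<partial>lebesgue_on \<Omega>))"

definition A_const :: "real \<Rightarrow> (real^'n) set \<Rightarrow> real \<Rightarrow> real \<Rightarrow> ennreal" where
  "A_const p T \<epsilon> \<eta> =
     (let \<Omega> = perforated_domain T \<epsilon> \<eta>; M = lebesgue_on \<Omega>
      in Sup {Lp_norm p M G | u G f.
           weak_solution \<Omega> f u G \<and> in_Lp p M f \<and> in_Lp 2 M f \<and> Lp_norm p M f = 1})"

end

(*
  Fix a bump Phi living at the critical scale L, where L^2 = eta^(2-d), or L^2 = |ln (eta/2)| if d = 2. Subtracting from
  Phi a multiple of a truncated Newtonian potential N_k at each lattice point k gives a function W whose Laplacian, off the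
  holes, is O(L^-2) and has mean zero on each lattice cell, hence is negligible in the dual of W_0^{1,2} by the
  Poincare inequality. Near each hole W is O(1); cutting it off there produces a test function phi that nearly solves
  -Laplace phi = div f with f = O(1/eta) concentrated on the eta-neighbourhoods of the holes, while phi pairs with
  h = grad Phi, which is O(1/L) and spread over the ball of radius L, as strongly as h does with itself. For p <= 2
  the datum f, for p >= 2 (by duality) the datum h realises the lower bound.
*)

theory Submission
  imports Defs "HOL-Real_Asymp.Real_Asymp"
begin

section \<open>Smooth functions\<close>

text \<open>Why the scale \<open>L\<close> is forced. Cancelling the cell averages of the Laplacian
  of \<open>\<Phi>\<close> takes charges of size L^-2 at the lattice points. At a hole of size
  \<open>\<eta>\<close> the potential of such a charge is L^-2 \<eta>^(2-d), or L^-2 |ln \<eta>| in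
  the plane. It stays O(1), which keeps the cut-off datum of size 1/\<eta>, only if L is at least
  critical. A larger L is wasteful: the datum f has p-norm about \<eta>^-1 (L \<eta>)^(d/p), h has
  dual norm about L^-1 L^(d(1-1/p)), the pairing is about L^(d-2), so the quotient is L^-1
  \<eta>^(1-d/p); at critical L this is the claimed power for p \<le> 2. With datum h, 1/p is
  replaced by 1-1/p. The obstacle is that every error must be small against L^(d-2). The residual
  Laplacian and the pairing of grad \<open>\<Phi>\<close> with the potentials lose a factor 1/L, the
  pairing with f a factor L \<eta>^(d-1). These are small only as \<open>\<eta>\<close> tends to 0;
  for \<open>\<eta>\<close> bounded away from 0 an explicit solution near a corner of the cell gives
  a uniform bound, and a minimum of two constants joins the ranges.\<close>

lemma grad_eqI:
  assumes "(f has_derivative (\<lambda>h. v \<bullet> h)) (at x)"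
  shows "grad f x = v"
proof -
  have "frechet_derivative f (at x) = (\<lambda>h. v \<bullet> h)"
    using assms by (simp add: frechet_derivative_at[symmetric])
  then show ?thesis by (simp add: grad_def vec_eq_iff inner_axis)
qed

lemma has_derivative_grad:
  fixes f :: "real^'n \<Rightarrow> real"
  assumes "f differentiable (at x)"
  shows "(f has_derivative (\<lambda>h. grad f x \<bullet> h)) (at x)"
proof -
  have d: "(f has_derivative frechet_derivative f (at x)) (at x)"
    using assms by (simp add: frechet_derivative_works)
  then interpret bounded_linear "frechet_derivative f (at x)" by (rule has_derivative_bounded_linear)
  have "frechet_derivative f (at x) h = grad f x \<bullet> h" for h
  proof -
    have "frechet_derivative f (at x) h = frechet_derivative f (at x) (\<Sum>i\<in>UNIV. h $ i *\<^sub>R axis i 1)"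
      using basis_expansion[of h] by (simp add: scalar_mult_eq_scaleR)
    also have "\<dots> = (\<Sum>i\<in>UNIV. h $ i * frechet_derivative f (at x) (axis i 1))"
      by (simp add: sum scaleR)
    finally show ?thesis by (simp add: grad_def inner_vec_def mult.commute)
  qed
  then have "frechet_derivative f (at x) = (\<lambda>h. grad f x \<bullet> h)" by (simp add: fun_eq_iff)
  with d show ?thesis by metis
qed

lemma class_C_SucI:
  assumes "\<And>x. (f has_derivative (\<lambda>h. V x \<bullet> h)) (at x)" "\<And>i. class_C k (\<lambda>x. V x $ i)"
  shows "class_C (Suc k) f"
proof -
  have "grad f x = V x" for x by (rule grad_eqI) (rule assms(1))
  then show ?thesis using assms by (auto simp: differentiable_def)
qed

lemma class_C_SucD:
  assumes "class_C (Suc k) f"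
  shows "(f has_derivative (\<lambda>h. grad f x \<bullet> h)) (at x)" "class_C k (\<lambda>x. grad f x $ i)"
  using assms by (auto intro: has_derivative_grad)

lemma class_C_pred: "class_C (Suc k) f \<Longrightarrow> class_C k f"
proof (induction k arbitrary: f)
  case 0
  then have "\<forall>x. isCont f x" by (simp add: differentiable_imp_continuous_within)
  then show ?case by (simp add: continuous_at_imp_continuous_on)
next
  case (Suc k)
  then show ?case by (metis class_C.simps(2))
qed

lemma class_C_const: "class_C k (\<lambda>x. c)"
proof (induction k arbitrary: c)
  case (Suc k)
  show ?case by (rule class_C_SucI[where V="\<lambda>x. 0"]) (auto simp: Suc)
qed simp

lemma class_C_coord: "class_C k (\<lambda>x. x $ i - c)"
proof (cases k)
  case (Suc k)
  show ?thesis unfolding Suc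
  proof (rule class_C_SucI[where V="\<lambda>x. axis i 1"])
    show "((\<lambda>x. x $ i - c) has_derivative (\<lambda>h. axis i 1 \<bullet> h)) (at x)" for x :: "real^'a"
      by (auto intro!: derivative_eq_intros bounded_linear.has_derivative[OF bounded_linear_vec_nth]
          simp: inner_axis' )
  qed (simp add: class_C_const)
qed (auto intro!: continuous_intros)

lemma class_C_add: "class_C k f \<Longrightarrow> class_C k g \<Longrightarrow> class_C k (\<lambda>x. f x + g x)"
proof (induction k arbitrary: f g)
  case (Suc k)
  show ?case
    by (rule class_C_SucI[where V="\<lambda>x. grad f x + grad g x"])
      (use Suc in \<open>auto intro!: Suc.IH derivative_eq_intros class_C_SucD(1) simp: inner_add_left simp del: class_C.simps dest: class_C_SucD(2)\<close>)
qed (auto intro!: continuous_intros)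

lemma class_C_mult: "class_C k f \<Longrightarrow> class_C k g \<Longrightarrow> class_C k (\<lambda>x. f x * g x)"
proof (induction k arbitrary: f g)
  case (Suc k)
  show ?case
    by (rule class_C_SucI[where V="\<lambda>x. f x *\<^sub>R grad g x + g x *\<^sub>R grad f x"])
      (use Suc in \<open>auto intro!: Suc.IH class_C_add derivative_eq_intros class_C_SucD(1) simp: inner_add_left algebra_simps simp del: class_C.simps dest: class_C_SucD(2) class_C_pred\<close>)
qed (auto intro!: continuous_intros)

lemma class_C_diff: "class_C k f \<Longrightarrow> class_C k g \<Longrightarrow> class_C k (\<lambda>x. f x - g x)"
  using class_C_add[of k f "\<lambda>x. (-1) * g x"] class_C_mult[OF class_C_const, of k g "-1"] by simp

lemma class_C_sum: "(\<And>i. i \<in> I \<Longrightarrow> class_C k (f i)) \<Longrightarrow> class_C k (\<lambda>x. \<Sum>i\<in>I. f i x)"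
  by (induction I rule: infinite_finite_induct) (auto intro: class_C_add class_C_const)

lemma class_C_scale: "class_C k f \<Longrightarrow> class_C k (\<lambda>x. f (r *\<^sub>R x))"
proof (induction k arbitrary: f)
  case 0
  then show ?case
    by (auto intro!: continuous_on_compose2[of UNIV f] continuous_intros)
next
  case (Suc k)
  show ?case
  proof (rule class_C_SucI[where V="\<lambda>x. r *\<^sub>R grad f (r *\<^sub>R x)"])
    show "((\<lambda>x. f (r *\<^sub>R x)) has_derivative (\<lambda>h. (r *\<^sub>R grad f (r *\<^sub>R x)) \<bullet> h)) (at x)" for x
      using has_derivative_compose[OF bounded_linear_imp_has_derivative[OF bounded_linear_scaleR_right]
          class_C_SucD(1)[OF Suc.prems]] by simp
    show "class_C k (\<lambda>x. (r *\<^sub>R grad f (r *\<^sub>R x)) $ i)" for i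
      using class_C_mult[OF class_C_const Suc.IH[OF class_C_SucD(2)[OF Suc.prems, of i]], of r] by simp
  qed
qed

section \<open>Smooth profiles in one variable and radial functions\<close>

primrec Ck :: "nat \<Rightarrow> (real \<Rightarrow> real) \<Rightarrow> bool" where
  "Ck 0 g \<longleftrightarrow> continuous_on UNIV g"
| "Ck (Suc n) g \<longleftrightarrow> (\<exists>g'. (\<forall>s. (g has_real_derivative g' s) (at s)) \<and> Ck n g')"

definition smooth1 :: "(real \<Rightarrow> real) \<Rightarrow> bool" where
  "smooth1 g \<longleftrightarrow> (\<forall>n. Ck n g)"

lemma Ck_pred: "Ck (Suc n) g \<Longrightarrow> Ck n g"
proof (induction n arbitrary: g)
  case 0
  then obtain g' where "\<forall>s. (g has_real_derivative g' s) (at s)" by auto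
  then have "\<forall>s. isCont g s" by (blast intro: DERIV_isCont)
  then show ?case by (simp add: continuous_at_imp_continuous_on)
next
  case (Suc n)
  then show ?case by (metis Ck.simps(2))
qed

lemma Ck_const: "Ck n (\<lambda>s. c)"
  by (induction n arbitrary: c) (auto intro!: exI[of _ "\<lambda>s. 0"])

lemma Ck_add: "Ck n f \<Longrightarrow> Ck n g \<Longrightarrow> Ck n (\<lambda>s. f s + g s)"
proof (induction n arbitrary: f g)
  case (Suc n)
  then obtain f' g' where "\<forall>s. (f has_real_derivative f' s) (at s)" "Ck n f'"
    "\<forall>s. (g has_real_derivative g' s) (at s)" "Ck n g'" by auto
  with Suc.IH show ?case by (auto intro!: exI[of _ "\<lambda>s. f' s + g' s"] derivative_intros)
qed (auto intro!: continuous_intros)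

lemma Ck_mult: "Ck n f \<Longrightarrow> Ck n g \<Longrightarrow> Ck n (\<lambda>s. f s * g s)"
proof (induction n arbitrary: f g)
  case (Suc n)
  then obtain f' g' where *: "\<forall>s. (f has_real_derivative f' s) (at s)" "Ck n f'"
    "\<forall>s. (g has_real_derivative g' s) (at s)" "Ck n g'" by auto
  have "Ck n (\<lambda>s. f s * g' s + f' s * g s)"
    by (intro Ck_add Suc.IH * Ck_pred[OF Suc.prems(1)] Ck_pred[OF Suc.prems(2)])
  with * show ?case
    by (auto intro!: exI[of _ "\<lambda>s. f s * g' s + f' s * g s"] derivative_eq_intros)
qed (auto intro!: continuous_intros)

lemma Ck_affine: "Ck n f \<Longrightarrow> Ck n (\<lambda>s. f (r * s + c))"
proof (induction n arbitrary: f)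
  case 0
  then show ?case by (auto intro!: continuous_on_compose2[of UNIV f] continuous_intros)
next
  case (Suc n)
  then obtain f' where *: "\<forall>s. (f has_real_derivative f' s) (at s)" "Ck n f'" by auto
  have "Ck n (\<lambda>s. f' (r * s + c) * r)" by (intro Ck_mult Ck_const Suc.IH *)
  moreover have "((\<lambda>s. f (r * s + c)) has_real_derivative f' (r * s + c) * r) (at s)" for s
    by (rule DERIV_chain2[of f]) (use * in \<open>auto intro!: derivative_eq_intros\<close>)
  ultimately show ?case unfolding Ck.simps by (intro exI conjI allI)
qed

text \<open>The induction on the order runs over all profiles at once, because the gradient
  \<open>g' (s x) *\<^sub>R grad s x\<close> replaces \<open>g\<close> by its derivative.\<close>

lemma class_C_compose:
  assumes "\<And>k. class_C k s" "Ck n g"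
  shows "class_C n (\<lambda>x. g (s x))"
  using assms(2)
proof (induction n arbitrary: g)
  case 0
  then show ?case using assms(1)[of 0]
    by (auto intro!: continuous_on_compose2[of UNIV g])
next
  case (Suc n)
  then obtain g' where g': "\<And>t. (g has_real_derivative g' t) (at t)" "Ck n g'" by auto
  have s1: "class_C (Suc n) s" by (rule assms)
  show ?case
  proof (rule class_C_SucI[where V="\<lambda>x. g' (s x) *\<^sub>R grad s x"])
    show "((\<lambda>x. g (s x)) has_derivative (\<lambda>h. (g' (s x) *\<^sub>R grad s x) \<bullet> h)) (at x)" for x
      using has_derivative_compose[OF class_C_SucD(1)[OF s1] g'(1)[of "s x", unfolded has_field_derivative_def]]
      by simp
    show "class_C n (\<lambda>x. (g' (s x) *\<^sub>R grad s x) $ i)" for i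
      using class_C_mult[OF Suc.IH[OF g'(2)] class_C_SucD(2)[OF s1]] by simp
  qed
qed

lemma class_C_dist_square: "class_C k (\<lambda>x::real^'n. (norm (x - a))\<^sup>2)"
proof -
  have "(norm (x - a))\<^sup>2 = (\<Sum>i\<in>UNIV. (x $ i - a $ i) * (x $ i - a $ i))" for x :: "real^'n"
    by (simp add: power2_norm_eq_inner inner_vec_def)
  then show ?thesis by (auto intro!: class_C_sum class_C_mult class_C_coord)
qed

text \<open>Radial functions are written in the squared distance, a polynomial, so that no
  smoothness is lost at the centre \<open>a\<close>. All later profiles use this variable.\<close>

lemma class_C_radial: "smooth1 g \<Longrightarrow> class_C k (\<lambda>x. g ((norm (x - a))\<^sup>2))"
  using class_C_compose[OF class_C_dist_square] by (auto simp: smooth1_def)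

lemma has_derivative_radial:
  fixes a :: "real^'n"
  assumes "(g has_real_derivative g') (at ((norm (x - a))\<^sup>2))"
  shows "((\<lambda>x. g ((norm (x - a))\<^sup>2)) has_derivative (\<lambda>h. ((2 * g') *\<^sub>R (x - a)) \<bullet> h)) (at x)"
proof -
  have "((\<lambda>x. (norm (x - a))\<^sup>2) has_derivative (\<lambda>h. 2 * ((x - a) \<bullet> h))) (at x)"
    unfolding power2_norm_eq_inner
    by (auto intro!: derivative_eq_intros simp: inner_commute)
  from has_derivative_compose[OF this assms[unfolded has_field_derivative_def]] show ?thesis
    by (simp add: mult.left_commute mult.assoc)
qed

lemma smooth1I_deriv:
  assumes "\<And>s. (g has_real_derivative g' s) (at s)" "smooth1 g'"
  shows "smooth1 g"
proof -
  have "Ck (Suc n) g" for n using assms by (auto simp: smooth1_def)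
  then show ?thesis unfolding smooth1_def using Ck_pred by blast
qed

text \<open>Each order of \<open>Ck\<close> supplies its own derivative; by uniqueness all of them
  equal \<open>deriv g\<close>, which is therefore of every order.\<close>

lemma smooth1D:
  assumes "smooth1 g"
  obtains g' where "\<And>s. (g has_real_derivative g' s) (at s)" "smooth1 g'"
proof
  have *: "\<exists>g'. (\<forall>s. (g has_real_derivative g' s) (at s)) \<and> Ck n g'" for n
    using assms unfolding smooth1_def by (metis Ck.simps(2))
  show 1: "(g has_real_derivative deriv g s) (at s)" for s
    using *[of 0] by (metis DERIV_imp_deriv)
  have "Ck n (deriv g)" for n
  proof -
    obtain g' where g': "\<forall>s. (g has_real_derivative g' s) (at s)" "Ck n g'" using * by blast
    then have "g' = deriv g" using 1 by (auto intro: DERIV_unique)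
    then show ?thesis using g' by simp
  qed
  then show "smooth1 (deriv g)" by (simp add: smooth1_def)
qed

lemma smooth1_const: "smooth1 (\<lambda>s. c)" by (simp add: smooth1_def Ck_const)
lemma smooth1_add: "smooth1 f \<Longrightarrow> smooth1 g \<Longrightarrow> smooth1 (\<lambda>s. f s + g s)"
  by (simp add: smooth1_def Ck_add)
lemma smooth1_mult: "smooth1 f \<Longrightarrow> smooth1 g \<Longrightarrow> smooth1 (\<lambda>s. f s * g s)"
  by (simp add: smooth1_def Ck_mult)
lemma smooth1_affine: "smooth1 f \<Longrightarrow> smooth1 (\<lambda>s. f (r * s + c))"
  by (simp add: smooth1_def Ck_affine)
lemma smooth1_diff: "smooth1 f \<Longrightarrow> smooth1 g \<Longrightarrow> smooth1 (\<lambda>s. f s - g s)"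
  using smooth1_add[of f "\<lambda>s. (-1) * g s"] smooth1_mult[OF smooth1_const, of g "-1"] by simp

lemma smooth1_continuous: "smooth1 g \<Longrightarrow> continuous_on A g"
  unfolding smooth1_def by (metis Ck.simps(1) continuous_on_subset subset_UNIV)

text \<open>Off the support of \<open>G\<close> the product vanishes, so the singularity of \<open>powr\<close> at \<open>0\<close> is harmless.\<close>

lemma smooth1_powr_mult:
  assumes "smooth1 G" "\<And>s. s < c \<Longrightarrow> G s = 0" "0 < c"
  shows "smooth1 (\<lambda>s. s powr a * G s)"
proof -
  have "Ck n (\<lambda>s. s powr a * G s)" if "smooth1 G" "\<And>s. s < c \<Longrightarrow> G s = 0" for n a G
    using that
  proof (induction n arbitrary: a G)
    case (0 a G)
    obtain G' where G': "\<And>s. (G has_real_derivative G' s) (at s)" using 0 smooth1D by blast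
    have "isCont (\<lambda>s. s powr a * G s) s" for s
    proof (cases "s > 0")
      case True
      then show ?thesis using G'[of s] by (intro continuous_intros DERIV_isCont) auto
    next
      case False
      have "\<forall>\<^sub>F t in nhds s. t < c" using False assms(3) by (intro eventually_nhds_in_open[of "{..<c}", simplified]) auto
      then have "\<forall>\<^sub>F t in nhds s. t powr a * G t = 0" by eventually_elim (simp add: 0)
      then show ?thesis using isCont_cong[of "\<lambda>s. s powr a * G s" "\<lambda>s. 0" s] by auto
    qed
    then show ?case by (auto intro!: continuous_at_imp_continuous_on)
  next
    case (Suc n)
    obtain G' where G': "\<And>s. (G has_real_derivative G' s) (at s)" "smooth1 G'"
      using Suc smooth1D by blast
    have z: "G' s = 0" if "s < c" for s
    proof -
      have "\<forall>\<^sub>F t in nhds s. t < c" using that by (intro eventually_nhds_in_open[of "{..<c}", simplified]) auto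
      then have "\<forall>\<^sub>F t in nhds s. G t = 0" by eventually_elim (simp add: Suc)
      then have "(G has_real_derivative 0) (at s)"
        using DERIV_cong_ev[of s s G "\<lambda>s. 0" 0 0] by simp
      then show ?thesis using G' DERIV_unique by blast
    qed
    have "Ck n (\<lambda>s. a * (s powr (a - 1) * G s) + s powr a * G' s)"
      by (intro Ck_add Ck_mult[OF Ck_const] Suc.IH G' Suc.prems z)
    moreover have "((\<lambda>s. s powr a * G s) has_real_derivative a * (s powr (a - 1) * G s) + s powr a * G' s) (at s)" for s
    proof (cases "s > 0")
      case True
      then show ?thesis using G'(1)[of s]
        by (auto intro!: derivative_eq_intros simp: field_simps)
    next
      case False
      have "\<forall>\<^sub>F t in nhds s. t < c" using False assms(3) by (intro eventually_nhds_in_open[of "{..<c}", simplified]) auto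
      then have "\<forall>\<^sub>F t in nhds s. t powr a * G t = 0" by eventually_elim (simp add: Suc)
      then have "((\<lambda>s. s powr a * G s) has_real_derivative 0) (at s)"
        using DERIV_cong_ev[of s s "\<lambda>s. s powr a * G s" "\<lambda>s. 0" 0 0] by simp
      then show ?thesis using False z[of s] Suc.prems(2)[of s] assms(3) by simp
    qed
    ultimately show ?case unfolding Ck.simps by (intro exI conjI allI)
  qed
  then show ?thesis using assms by (auto simp: smooth1_def)
qed

section \<open>A smooth step from the flat exponential\<close>

definition flat_exp :: "real poly \<Rightarrow> real \<Rightarrow> real" where
  "flat_exp q s = (if s > 0 then poly q (1 / s) * exp (- 1 / s) else 0)"

lemma poly_mult_exp_neg_tendsto_0: "((\<lambda>u::real. poly q u * exp (- u)) \<longlongrightarrow> 0) at_top"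
proof -
  have "((\<lambda>u::real. \<Sum>i\<le>degree q. coeff q i * (u ^ i / exp u)) \<longlongrightarrow> (\<Sum>i\<le>degree q. coeff q i * 0)) at_top"
    by (intro tendsto_sum tendsto_mult tendsto_const tendsto_power_div_exp_0)
  moreover have "(\<Sum>i\<le>degree q. coeff q i * (u ^ i / exp u)) = poly q u * exp (- u)" for u :: real
    by (simp add: poly_altdef sum_distrib_right exp_minus divide_inverse mult.assoc)
  ultimately show ?thesis by simp
qed

text \<open>Polynomials in 1/s times exp(-1/s) are closed under differentiation: the inner
  derivative of 1/s gives the factor s^-2, which is the polynomial \<open>[:0,0,1:]\<close> at 1/s.
  At 0 the difference quotient is u q(u) exp(-u) with u = 1/s, which tends to 0.\<close>

lemma has_real_derivative_flat_exp:
  "(flat_exp q has_real_derivative flat_exp ([:0,0,1:] * (q - pderiv q)) s) (at s)"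
proof (cases "s > 0")
  case True
  have "\<forall>\<^sub>F t in nhds s. 0 < t" using True by (intro eventually_nhds_in_open[of "{0<..}", simplified]) auto
  then have ev: "\<forall>\<^sub>F t in nhds s. flat_exp q t = poly q (1 / t) * exp (- 1 / t)"
    by eventually_elim (simp add: flat_exp_def)
  have "((\<lambda>t. poly q (1 / t) * exp (- 1 / t)) has_real_derivative
      poly (pderiv q) (1 / s) * (- 1 / s\<^sup>2) * exp (- 1 / s) + poly q (1 / s) * (exp (- 1 / s) * (1 / s\<^sup>2))) (at s)"
    using True
    by (auto intro!: derivative_eq_intros DERIV_chain2[OF poly_DERIV] simp: power2_eq_square field_simps)
  also have "poly (pderiv q) (1 / s) * (- 1 / s\<^sup>2) * exp (- 1 / s) + poly q (1 / s) * (exp (- 1 / s) * (1 / s\<^sup>2))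
      = flat_exp ([:0,0,1:] * (q - pderiv q)) s"
    using True by (simp add: flat_exp_def power2_eq_square field_simps)
  finally show ?thesis using DERIV_cong_ev[OF refl ev refl] by simp
next
  case False
  show ?thesis
  proof (cases "s = 0")
    case True
    have "((\<lambda>y. (flat_exp q y - flat_exp q 0) / (y - 0)) \<longlongrightarrow> 0) (at_right 0)"
    proof -
      have "((\<lambda>y. poly ([:0,1:] * q) (inverse y) * exp (- inverse y)) \<longlongrightarrow> 0) (at_right (0::real))"
        by (rule filterlim_compose[OF poly_mult_exp_neg_tendsto_0 filterlim_inverse_at_top_right])
      moreover have "\<forall>\<^sub>F y in at_right (0::real). poly ([:0,1:] * q) (inverse y) * exp (- inverse y)
          = (flat_exp q y - flat_exp q 0) / (y - 0)"
        using eventually_at_right_less[of "0::real"]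
        by eventually_elim (simp add: flat_exp_def field_simps)
      ultimately show ?thesis by (rule Lim_transform_eventually)
    qed
    moreover have "((\<lambda>y. (flat_exp q y - flat_exp q 0) / (y - 0)) \<longlongrightarrow> 0) (at_left 0)"
    proof -
      have "\<forall>\<^sub>F y in at_left (0::real). 0 = (flat_exp q y - flat_exp q 0) / (y - 0)"
        by (auto simp: flat_exp_def eventually_at_filter)
      then show ?thesis by (rule Lim_transform_eventually[OF tendsto_const])
    qed
    ultimately show ?thesis unfolding True has_field_derivative_iff
      by (auto simp: flat_exp_def intro: filterlim_split_at)
  next
    case False
    with \<open>\<not> s > 0\<close> have "\<forall>\<^sub>F t in nhds s. t < 0"
      by (intro eventually_nhds_in_open[of "{..<0}", simplified]) auto
    then have "\<forall>\<^sub>F t in nhds s. flat_exp q t = 0" by eventually_elim (simp add: flat_exp_def)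
    then show ?thesis using DERIV_cong_ev[of s s "flat_exp q" "\<lambda>s. 0" 0 0] \<open>\<not> s > 0\<close>
      by (simp add: flat_exp_def)
  qed
qed

lemma smooth1_flat_exp: "smooth1 (flat_exp q)"
proof -
  have "Ck n (flat_exp q)" for n
  proof (induction n arbitrary: q)
    case 0
    have "\<forall>s. isCont (flat_exp q) s" using has_real_derivative_flat_exp by (blast intro: DERIV_isCont)
    then show ?case by (simp add: continuous_at_imp_continuous_on)
  next
    case (Suc n)
    then show ?case unfolding Ck.simps using has_real_derivative_flat_exp by blast
  qed
  then show ?thesis by (simp add: smooth1_def)
qed

lemma ex_antiderivative:
  fixes g :: "real \<Rightarrow> real"
  assumes "continuous_on UNIV g"
  shows "\<exists>G. \<forall>s. (G has_real_derivative g s) (at s)"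
proof -
  \<comment> \<open>For either sign of \<open>s\<close> one of the two intervals is empty or a
    point, so this is the oriented integral from 0 to \<open>s\<close>.\<close>
  define G where "G s = integral {0..s} g - integral {s..0} g" for s
  have int: "g integrable_on {a..b}" for a b
    by (rule integrable_continuous_real) (rule continuous_on_subset[OF assms], simp)
  have "(G has_real_derivative g s) (at s)" for s
  proof -
    define a where "a = \<bar>s\<bar> + 1"
    have eq: "G t = integral {- a..t} g - integral {- a..0} g" if "t \<in> {- a<..<a}" for t
    proof (cases "t \<ge> 0")
      case True
      then show ?thesis using Henstock_Kurzweil_Integration.integral_combine[of "-a" 0 t g] int that
        by (cases "t = 0") (auto simp: G_def a_def)
    next
      case False
      then show ?thesis using Henstock_Kurzweil_Integration.integral_combine[of "-a" t 0 g] int that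
        by (auto simp: G_def a_def)
    qed
    have "((\<lambda>t. integral {- a..t} g) has_real_derivative g s) (at s within {- a..a})"
      by (rule integral_has_real_derivative) (auto simp: a_def intro: continuous_on_subset[OF assms])
    then have "((\<lambda>t. integral {- a..t} g) has_real_derivative g s) (at s)"
      by (subst (asm) at_within_interior) (auto simp: a_def)
    then have d: "((\<lambda>t. integral {- a..t} g - integral {- a..0} g) has_real_derivative g s) (at s)"
      by (auto intro!: derivative_eq_intros)
    have "\<forall>\<^sub>F t in nhds s. t \<in> {- a<..<a}"
      by (rule eventually_nhds_in_open) (auto simp: a_def)
    then have "\<forall>\<^sub>F t in nhds s. G t = integral {- a..t} g - integral {- a..0} g"
      by eventually_elim (rule eq)
    from DERIV_cong_ev[OF refl this refl] d show ?thesis by simp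
  qed
  then show ?thesis by blast
qed

lemma deriv_nonneg_imp_le:
  fixes f :: "real \<Rightarrow> real"
  assumes "\<And>s. (f has_real_derivative f' s) (at s)" "\<And>s. a \<le> s \<Longrightarrow> s \<le> b \<Longrightarrow> 0 \<le> f' s" "a \<le> b"
  shows "f a \<le> f b"
  by (rule DERIV_nonneg_imp_nondecreasing[OF assms(3)]) (use assms in blast)

lemma deriv_zero_imp_eq:
  fixes f :: "real \<Rightarrow> real"
  assumes "\<And>s. (f has_real_derivative f' s) (at s)" "\<And>s. a \<le> s \<Longrightarrow> s \<le> b \<Longrightarrow> f' s = 0" "a \<le> b"
  shows "f a = f b"
proof (rule antisym)
  show "f a \<le> f b" by (rule deriv_nonneg_imp_le[of f f']) (use assms in auto)
  have "- f a \<le> - f b" by (rule deriv_nonneg_imp_le[of "\<lambda>s. - f s" "\<lambda>s. - f' s"]) (use assms in \<open>auto intro: derivative_intros\<close>)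
  then show "f b \<le> f a" by simp
qed

lemma smooth_step_exists:
  obtains st st' :: "real \<Rightarrow> real" where
    "\<And>s. (st has_real_derivative st' s) (at s)" "smooth1 st'" "smooth1 st" "\<And>s. 0 \<le> st' s"
    "\<And>s. s \<le> 1 \<Longrightarrow> st s = 0" "\<And>s. 2 \<le> s \<Longrightarrow> st s = 1"
    "\<And>s. 1 < s \<Longrightarrow> s < 2 \<Longrightarrow> 0 < st' s" "\<And>s. s \<le> 1 \<or> 2 \<le> s \<Longrightarrow> st' s = 0"
proof -
  define e where "e = flat_exp 1"
  have e: "smooth1 e" "e s = (if s > 0 then exp (- 1 / s) else 0)" for s
    by (auto simp: e_def smooth1_flat_exp flat_exp_def)
  \<comment> \<open>A product of two flat exponentials, positive exactly on (1, 2); its normalised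
    antiderivative is the step.\<close>
  define b where "b s = e (1 * s + - 1) * e ((-1) * s + 2)" for s
  have sb: "smooth1 b" unfolding b_def by (intro smooth1_mult smooth1_affine e)
  obtain B where B: "\<And>s. (B has_real_derivative b s) (at s)"
    using ex_antiderivative[OF smooth1_continuous[OF sb]] by blast
  have b0: "0 \<le> b s" for s by (simp add: b_def e)
  have bz: "b s = 0" if "s \<le> 1 \<or> 2 \<le> s" for s using that by (auto simp: b_def e)
  have bp: "b s > 0" if "1 < s" "s < 2" for s using that by (auto simp: b_def e)
  have "B 1 < B 2"
    by (rule DERIV_pos_imp_increasing_open[of 1 2 B])
      (use B bp in \<open>auto intro!: continuous_at_imp_continuous_on DERIV_isCont\<close>)
  define c where "c = B 2 - B 1"
  have c: "c > 0" using \<open>B 1 < B 2\<close> by (simp add: c_def)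
  have d: "((\<lambda>s. (B s - B 1) / c) has_real_derivative b s * (1 / c)) (at s)" for s
    using B[of s] c by (auto intro!: derivative_eq_intros)
  have s': "smooth1 (\<lambda>s. b s * (1 / c))" by (intro smooth1_mult sb smooth1_const)
  show ?thesis
  proof (rule that[OF d s' smooth1I_deriv[OF d s']])
    show "(B s - B 1) / c = 0" if "s \<le> 1" for s
      using deriv_zero_imp_eq[of B b s 1] B bz that by auto
    show "(B s - B 1) / c = 1" if "2 \<le> s" for s
    proof -
      have "B 2 = B s" using deriv_zero_imp_eq[of B b 2 s] B bz that by auto
      then show ?thesis using \<open>B 1 < B 2\<close> by (simp add: c_def)
    qed
  qed (use b0 bz bp c in auto)
qed

section \<open>Square-integrable functions\<close>

text \<open>The discriminant inequality, by evaluation at the minimiser t = - B / C. It yields both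
  the Cauchy-Schwarz inequality and the near-orthogonality of almost minimisers.\<close>

lemma quadratic_nonneg_imp:
  fixes A B C :: real
  assumes "\<And>t. 0 \<le> A + 2 * t * B + t\<^sup>2 * C" "0 \<le> C"
  shows "B\<^sup>2 \<le> A * C"
proof (cases "C = 0")
  case True
  have "B = 0"
  proof (rule ccontr)
    assume "B \<noteq> 0"
    \<comment> \<open>For \<open>C = 0\<close> the expression is affine in t, and at this t it
      equals -1.\<close>
    then show False using assms(1)[of "- (A + 1) / (2 * B)"] True by (simp add: field_simps)
  qed
  then show ?thesis using True by simp
next
  case False
  then have C: "C > 0" using assms(2) by simp
  have "0 \<le> A + 2 * (- B / C) * B + (- B / C)\<^sup>2 * C" by (rule assms(1))
  also have "\<dots> = A - B\<^sup>2 / C" using C by (simp add: field_simps power2_eq_square)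
  finally show ?thesis using C by (simp add: field_simps)
qed

definition sq_int :: "'a measure \<Rightarrow> ('a \<Rightarrow> 'b::euclidean_space) \<Rightarrow> bool" where
  "sq_int M g \<longleftrightarrow> g \<in> borel_measurable M \<and> integrable M (\<lambda>x. (norm (g x))\<^sup>2)"

lemma norm_add_power2_le: "(norm (a + b))\<^sup>2 \<le> 2 * (norm a)\<^sup>2 + 2 * (norm (b::'b::real_normed_vector))\<^sup>2"
proof -
  have "(norm (a + b))\<^sup>2 \<le> (norm a + norm b)\<^sup>2" by (intro power_mono norm_triangle_ineq) auto
  also have "\<dots> \<le> 2 * (norm a)\<^sup>2 + 2 * (norm b)\<^sup>2"
    using sum_squares_bound[of "norm a" "norm b"] by (simp add: power2_sum)
  finally show ?thesis .
qed

lemma sq_int_scaleR: "sq_int M g \<Longrightarrow> sq_int M (\<lambda>x. t *\<^sub>R g x)"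
  by (auto simp: sq_int_def power_mult_distrib)

lemma sq_int_add:
  assumes f: "sq_int M f" and g: "sq_int M g" shows "sq_int M (\<lambda>x. f x + g x)"
  unfolding sq_int_def
proof
  have [measurable]: "f \<in> borel_measurable M" "g \<in> borel_measurable M" using f g by (auto simp: sq_int_def)
  show "(\<lambda>x. f x + g x) \<in> borel_measurable M" by measurable
  show "integrable M (\<lambda>x. (norm (f x + g x))\<^sup>2)"
  proof (rule Bochner_Integration.integrable_bound)
    show "integrable M (\<lambda>x. 2 * (norm (f x))\<^sup>2 + 2 * (norm (g x))\<^sup>2)"
      using f g by (auto simp: sq_int_def)
    show "AE x in M. norm ((norm (f x + g x))\<^sup>2) \<le> norm (2 * (norm (f x))\<^sup>2 + 2 * (norm (g x))\<^sup>2)"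
      using norm_add_power2_le by (auto intro!: AE_I2)
  qed measurable
qed

lemma sq_int_diff: "sq_int M f \<Longrightarrow> sq_int M g \<Longrightarrow> sq_int M (\<lambda>x. f x - g x)"
  using sq_int_add[of M f "\<lambda>x. (-1) *\<^sub>R g x"] sq_int_scaleR[of M g "-1"] by simp

lemma integrable_inner_sq_int:
  assumes f: "sq_int M f" and g: "sq_int M g" shows "integrable M (\<lambda>x. f x \<bullet> g x)"
proof (rule Bochner_Integration.integrable_bound)
  have [measurable]: "f \<in> borel_measurable M" "g \<in> borel_measurable M" using f g by (auto simp: sq_int_def)
  show "integrable M (\<lambda>x. (norm (f x))\<^sup>2 + (norm (g x))\<^sup>2)" using f g by (auto simp: sq_int_def)
  have "norm (f x \<bullet> g x) \<le> norm ((norm (f x))\<^sup>2 + (norm (g x))\<^sup>2)" for x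
  proof -
    have "norm (f x \<bullet> g x) \<le> norm (f x) * norm (g x)" using Cauchy_Schwarz_ineq2 by simp
    also have "\<dots> \<le> (norm (f x))\<^sup>2 + (norm (g x))\<^sup>2"
      using sum_squares_bound[of "norm (f x)" "norm (g x)"]
      using mult_nonneg_nonneg[OF norm_ge_zero[of "f x"] norm_ge_zero[of "g x"]] by linarith
    finally show ?thesis by simp
  qed
  then show "AE x in M. norm (f x \<bullet> g x) \<le> norm ((norm (f x))\<^sup>2 + (norm (g x))\<^sup>2)" by simp
  show "(\<lambda>x. f x \<bullet> g x) \<in> borel_measurable M" by measurable
qed

lemma integral_sq_add_scaleR:
  assumes f: "sq_int M f" and g: "sq_int M g"
  shows "(\<integral>x. (norm (f x + t *\<^sub>R g x))\<^sup>2 \<partial>M)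
    = (\<integral>x. (norm (f x))\<^sup>2 \<partial>M) + 2 * t * (\<integral>x. f x \<bullet> g x \<partial>M) + t\<^sup>2 * (\<integral>x. (norm (g x))\<^sup>2 \<partial>M)"
proof -
  have "(norm (f x + t *\<^sub>R g x))\<^sup>2 = (norm (f x))\<^sup>2 + (2 * t) * (f x \<bullet> g x) + t\<^sup>2 * (norm (g x))\<^sup>2" for x
    by (simp only: power2_norm_eq_inner) (simp add: inner_add_left inner_add_right inner_commute power2_eq_square algebra_simps)
  then show ?thesis using f g integrable_inner_sq_int[OF f g] by (simp add: sq_int_def)
qed

definition norm2 :: "'a measure \<Rightarrow> ('a \<Rightarrow> 'b::euclidean_space) \<Rightarrow> real" where
  "norm2 M g = sqrt (\<integral>x. (norm (g x))\<^sup>2 \<partial>M)"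

lemma norm2_nonneg[simp]: "0 \<le> norm2 M g" by (simp add: norm2_def)

lemma norm2_power2: "(norm2 M g)\<^sup>2 = (\<integral>x. (norm (g x))\<^sup>2 \<partial>M)" by (simp add: norm2_def)

lemma integral_inner_le_norm2:
  assumes f: "sq_int M f" and g: "sq_int M g"
  shows "\<bar>\<integral>x. f x \<bullet> g x \<partial>M\<bar> \<le> norm2 M f * norm2 M g"
proof -
  have "(\<integral>x. f x \<bullet> g x \<partial>M)\<^sup>2 \<le> (\<integral>x. (norm (f x))\<^sup>2 \<partial>M) * (\<integral>x. (norm (g x))\<^sup>2 \<partial>M)"
  proof (rule quadratic_nonneg_imp)
    show "0 \<le> (\<integral>x. (norm (f x))\<^sup>2 \<partial>M) + 2 * t * (\<integral>x. f x \<bullet> g x \<partial>M) + t\<^sup>2 * (\<integral>x. (norm (g x))\<^sup>2 \<partial>M)" for t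
      unfolding integral_sq_add_scaleR[OF f g, symmetric] by simp
  qed simp
  then have "\<bar>\<integral>x. f x \<bullet> g x \<partial>M\<bar>\<^sup>2 \<le> (norm2 M f * norm2 M g)\<^sup>2"
    by (simp add: power_mult_distrib norm2_power2)
  then show ?thesis by (rule power2_le_imp_le) simp
qed

lemma norm2_self: "norm2 M f * norm2 M f = (\<integral>x. f x \<bullet> f x \<partial>M)"
  by (simp add: norm2_def power2_norm_eq_inner)

text \<open>Fatou's lemma along a subsequence. The exponent \<open>k\<close> is left free because
  the estimate serves for L2 with \<open>k = 2\<close> and for L1 with \<open>k = 1\<close>.\<close>

lemma nn_integral_limit_le:
  fixes g :: "nat \<Rightarrow> 'a \<Rightarrow> 'b::euclidean_space"
  assumes [measurable]: "\<And>n. g n \<in> borel_measurable M" and [measurable]: "G \<in> borel_measurable M"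
    and lim: "AE x in M. (\<lambda>i. g (r i) x) \<longlonglongrightarrow> G x"
    and bd: "\<And>i. i \<ge> N \<Longrightarrow> (\<integral>\<^sup>+x. ennreal (norm (h x - g (r i) x) ^ k) \<partial>M) \<le> e"
    and [measurable]: "h \<in> borel_measurable M"
  shows "(\<integral>\<^sup>+x. ennreal (norm (h x - G x) ^ k) \<partial>M) \<le> e"
proof -
  have "(\<integral>\<^sup>+x. ennreal (norm (h x - G x) ^ k) \<partial>M)
      = (\<integral>\<^sup>+x. liminf (\<lambda>i. ennreal (norm (h x - g (r i) x) ^ k)) \<partial>M)"
  proof (rule nn_integral_cong_AE)
    show "AE x in M. ennreal (norm (h x - G x) ^ k) = liminf (\<lambda>i. ennreal (norm (h x - g (r i) x) ^ k))"
      using lim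
    proof eventually_elim
      case (elim x)
      then have "(\<lambda>i. ennreal (norm (h x - g (r i) x) ^ k)) \<longlonglongrightarrow> ennreal (norm (h x - G x) ^ k)"
        by (intro tendsto_intros)
      from lim_imp_Liminf[OF sequentially_bot this] show ?case by simp
    qed
  qed
  also have "\<dots> \<le> liminf (\<lambda>i. \<integral>\<^sup>+x. ennreal (norm (h x - g (r i) x) ^ k) \<partial>M)"
    by (rule nn_integral_liminf) measurable
  also have "\<dots> \<le> e"
    by (rule Liminf_le) (use bd in \<open>auto simp: eventually_sequentially\<close>)
  finally show ?thesis .
qed

lemma Cauchy_scaleR_cancel:
  fixes X :: "nat \<Rightarrow> 'b::real_normed_vector"
  assumes "Cauchy (\<lambda>i. c *\<^sub>R X i)" "c \<noteq> 0"
  shows "Cauchy X"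
proof -
  have "Cauchy (\<lambda>i. (1 / c) *\<^sub>R (c *\<^sub>R X i))"
    by (rule bounded_linear.Cauchy[OF bounded_linear_scaleR_right assms(1)])
  then show ?thesis using assms(2) by simp
qed

text \<open>Multiplication by the square root of a positive integrable function turns an L2 Cauchy
  sequence into an L1 Cauchy sequence, which has a subsequence converging almost everywhere; Fatou's
  lemma brings the estimate back to L2.\<close>

lemma L2_complete:
  fixes g :: "nat \<Rightarrow> 'a \<Rightarrow> 'b::euclidean_space"
  assumes "sigma_finite_measure M" and g: "\<And>n. sq_int M (g n)"
    and cau: "\<And>e. e > 0 \<Longrightarrow> \<exists>N. \<forall>m\<ge>N. \<forall>n\<ge>N. norm2 M (\<lambda>x. g m x - g n x) < e"
  obtains G where "sq_int M G" "(\<lambda>n. norm2 M (\<lambda>x. g n x - G x)) \<longlonglongrightarrow> 0"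
proof -
  interpret sigma_finite_measure M by fact
  obtain f :: "'a \<Rightarrow> real" where f: "f \<in> borel_measurable M" "\<And>x. 0 < f x" "integrable M f"
    using obtain_positive_integrable_function by metis
  define w where "w x = sqrt (f x)" for x
  have [measurable]: "w \<in> borel_measurable M" unfolding w_def using f by measurable
  have w: "sq_int M w" "\<And>x. 0 < w x" using f by (auto simp: sq_int_def w_def less_imp_le)
  have [measurable]: "g n \<in> borel_measurable M" for n using g by (simp add: sq_int_def)
  have normg: "sq_int M (\<lambda>x. norm (h x))" if "sq_int M h" for h :: "'a \<Rightarrow> 'b"
    using that by (auto simp: sq_int_def)
  have intw: "integrable M (\<lambda>x. w x *\<^sub>R h x)" "(\<integral>x. norm (w x *\<^sub>R h x) \<partial>M) \<le> norm2 M w * norm2 M h"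
    if h: "sq_int M h" for h :: "'a \<Rightarrow> 'b"
  proof -
    have i: "integrable M (\<lambda>x. w x * norm (h x))" using integrable_inner_sq_int[OF w(1) normg[OF h]] by simp
    have [measurable]: "h \<in> borel_measurable M" "w \<in> borel_measurable M" using h w by (auto simp: sq_int_def)
    show "integrable M (\<lambda>x. w x *\<^sub>R h x)"
      by (rule Bochner_Integration.integrable_bound[OF i]) (use w in \<open>auto simp: less_imp_le\<close>)
    have "(\<integral>x. norm (w x *\<^sub>R h x) \<partial>M) = (\<integral>x. w x \<bullet> norm (h x) \<partial>M)"
      using w by (simp add: less_imp_le)
    also have "\<dots> \<le> norm2 M w * norm2 M (\<lambda>x. norm (h x))"
      using integral_inner_le_norm2[OF w(1) normg[OF h]] by simp
    finally show "(\<integral>x. norm (w x *\<^sub>R h x) \<partial>M) \<le> norm2 M w * norm2 M h" by (simp add: norm2_def)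
  qed
  obtain r where r: "strict_mono r" "AE x in M. Cauchy (\<lambda>i. w x *\<^sub>R g (r i) x)"
  proof (rule cauchy_L1_AE_cauchy_subseq[of M "\<lambda>n x. w x *\<^sub>R g n x"])
    show "integrable M (\<lambda>x. w x *\<^sub>R g n x)" for n by (rule intw g)+
    fix e :: real assume "e > 0"
    then have "e / (norm2 M w + 1) > 0" by (simp add: add_nonneg_pos)
    from cau[OF this] obtain N where N: "\<And>m n. m \<ge> N \<Longrightarrow> n \<ge> N \<Longrightarrow> norm2 M (\<lambda>x. g m x - g n x) < e / (norm2 M w + 1)"
      by blast
    have "LINT x|M. norm (w x *\<^sub>R g i x - w x *\<^sub>R g j x) < e" if "i \<ge> N" "j \<ge> N" for i j
    proof -
      have "(LINT x|M. norm (w x *\<^sub>R g i x - w x *\<^sub>R g j x)) \<le> norm2 M w * norm2 M (\<lambda>x. g i x - g j x)"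
        using intw(2)[OF sq_int_diff[OF g g], of i j] by (simp add: scaleR_diff_right)
      also have "\<dots> \<le> (norm2 M w + 1) * norm2 M (\<lambda>x. g i x - g j x)"
        by (intro mult_right_mono) auto
      also have "\<dots> < e" using N[OF that] norm2_nonneg[of M w] by (simp add: field_simps add_nonneg_pos)
      finally show ?thesis .
    qed
    then show "\<exists>N. \<forall>i\<ge>N. \<forall>j\<ge>N. LINT x|M. norm (w x *\<^sub>R g i x - w x *\<^sub>R g j x) < e" by blast
  qed blast
  define G where "G x = lim (\<lambda>i. g (r i) x)" for x
  have [measurable]: "G \<in> borel_measurable M" unfolding G_def by measurable
  have lim: "AE x in M. (\<lambda>i. g (r i) x) \<longlonglongrightarrow> G x"
    using r(2)
  proof eventually_elim
    case (elim x)
    have "w x \<noteq> 0" using w(2)[of x] by simp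
    with elim have "Cauchy (\<lambda>i. g (r i) x)" by (rule Cauchy_scaleR_cancel)
    then have "convergent (\<lambda>i. g (r i) x)" by (rule Cauchy_convergent)
    then show ?case unfolding G_def by (rule convergent_LIMSEQ_iff[THEN iffD1])
  qed
  have main: "sq_int M (\<lambda>x. g n x - G x) \<and> norm2 M (\<lambda>x. g n x - G x) \<le> e"
    if "e > 0" and N: "\<And>m n. m \<ge> N \<Longrightarrow> n \<ge> N \<Longrightarrow> norm2 M (\<lambda>x. g m x - g n x) < e" and "n \<ge> N" for e N n
  proof -
    have le: "(\<integral>\<^sup>+x. ennreal (norm (g n x - G x) ^ 2) \<partial>M) \<le> ennreal (e\<^sup>2)"
    proof (rule nn_integral_limit_le[where g=g and r=r and G=G, OF _ _ lim])
      fix i assume "i \<ge> N"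
      then have "r i \<ge> N" using seq_suble[OF r(1), of i] by simp
      have "(\<integral>\<^sup>+x. ennreal (norm (g n x - g (r i) x) ^ 2) \<partial>M) = ennreal (\<integral>x. norm (g n x - g (r i) x) ^ 2 \<partial>M)"
        using sq_int_diff[OF g g, of n "r i"] by (intro nn_integral_eq_integral) (auto simp: sq_int_def)
      also have "\<dots> = ennreal ((norm2 M (\<lambda>x. g n x - g (r i) x))\<^sup>2)" by (simp add: norm2_power2)
      also have "\<dots> \<le> ennreal (e\<^sup>2)"
        using N[OF \<open>n \<ge> N\<close> \<open>r i \<ge> N\<close>] by (intro ennreal_leI power_mono) auto
      finally show "(\<integral>\<^sup>+x. ennreal (norm (g n x - g (r i) x) ^ 2) \<partial>M) \<le> ennreal (e\<^sup>2)" .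
    qed measurable
    have i: "integrable M (\<lambda>x. norm (g n x - G x) ^ 2)"
    proof (rule integrableI_bounded)
      show "(\<integral>\<^sup>+x. ennreal (norm (norm (g n x - G x) ^ 2)) \<partial>M) < \<infinity>"
        using le by (auto simp: le_less_trans)
    qed measurable
    have "ennreal (\<integral>x. norm (g n x - G x) ^ 2 \<partial>M) \<le> ennreal (e\<^sup>2)"
      using le nn_integral_eq_integral[OF i] by simp
    then have "(\<integral>x. norm (g n x - G x) ^ 2 \<partial>M) \<le> e\<^sup>2" by simp
    then have "norm2 M (\<lambda>x. g n x - G x) \<le> e" using \<open>e > 0\<close> real_le_lsqrt unfolding norm2_def by auto
    with i show ?thesis by (simp add: sq_int_def)
  qed
  obtain N1 where "\<And>m n. m \<ge> N1 \<Longrightarrow> n \<ge> N1 \<Longrightarrow> norm2 M (\<lambda>x. g m x - g n x) < 1" using cau[of 1] by auto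
  then have "sq_int M (\<lambda>x. g N1 x - G x)" using main[of 1 N1 N1] by simp
  from sq_int_diff[OF g this, of N1] have "sq_int M G" by simp
  moreover have "(\<lambda>n. norm2 M (\<lambda>x. g n x - G x)) \<longlonglongrightarrow> 0"
  proof (rule LIMSEQ_I)
    fix e :: real assume "e > 0"
    then obtain N where N: "\<And>m n. m \<ge> N \<Longrightarrow> n \<ge> N \<Longrightarrow> norm2 M (\<lambda>x. g m x - g n x) < e / 2"
      using cau[of "e / 2"] by auto
    have "norm (norm2 M (\<lambda>x. g n x - G x) - 0) < e" if "n \<ge> N" for n
      using main[OF _ N that] \<open>e > 0\<close> by simp
    then show "\<exists>N. \<forall>n\<ge>N. norm (norm2 M (\<lambda>x. g n x - G x) - 0) < e" by blast
  qed
  ultimately show ?thesis by (rule that)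
qed

text \<open>The linear space \<open>S\<close> need not be closed, so the solution is obtained as the
  limit of a minimising sequence of the squared norm of F + g. Almost minimisers satisfy the
  Euler-Lagrange equation up to a small multiple of the norm of the test element, and this already
  makes the sequence Cauchy. The limit \<open>G\<close> is minus the projection of \<open>F\<close>
  onto the closure of \<open>S\<close>; the sequence is returned because later arguments pass to the
  limit along it.\<close>

lemma L2_variational_solution:
  fixes F :: "'a \<Rightarrow> 'b::euclidean_space"
  assumes sf: "sigma_finite_measure M" and S0: "(\<lambda>x. 0) \<in> S"
    and Sadd: "\<And>g h t. g \<in> S \<Longrightarrow> h \<in> S \<Longrightarrow> (\<lambda>x. g x + t *\<^sub>R h x) \<in> S"
    and Ssq: "\<And>g. g \<in> S \<Longrightarrow> sq_int M g" and F: "sq_int M F"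
  obtains g G where "\<And>n::nat. g n \<in> S" "sq_int M G" "(\<lambda>n. norm2 M (\<lambda>x. g n x - G x)) \<longlonglongrightarrow> 0"
    "\<And>h. h \<in> S \<Longrightarrow> (\<integral>x. G x \<bullet> h x \<partial>M) = - (\<integral>x. F x \<bullet> h x \<partial>M)"
proof -
  define J where "J g = (\<integral>x. (norm (F x + 1 *\<^sub>R g x))\<^sup>2 \<partial>M)" for g
  have Jt: "J (\<lambda>x. g x + t *\<^sub>R h x) = J g + 2 * t * ((\<integral>x. g x \<bullet> h x \<partial>M) + (\<integral>x. F x \<bullet> h x \<partial>M)) + t\<^sup>2 * (norm2 M h)\<^sup>2"
    if "g \<in> S" "h \<in> S" for g h t
  proof -
    have "J (\<lambda>x. g x + t *\<^sub>R h x) = (\<integral>x. (norm ((F x + g x) + t *\<^sub>R h x))\<^sup>2 \<partial>M)"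
      by (simp add: J_def add.assoc)
    also have "\<dots> = J g + 2 * t * (\<integral>x. (F x + g x) \<bullet> h x \<partial>M) + t\<^sup>2 * (norm2 M h)\<^sup>2"
      by (subst integral_sq_add_scaleR) (use that Ssq F in \<open>auto simp: J_def norm2_power2 intro!: sq_int_add\<close>)
    also have "(\<integral>x. (F x + g x) \<bullet> h x \<partial>M) = (\<integral>x. g x \<bullet> h x \<partial>M) + (\<integral>x. F x \<bullet> h x \<partial>M)"
      using integrable_inner_sq_int[OF F Ssq[OF that(2)]] integrable_inner_sq_int[OF Ssq[OF that(1)] Ssq[OF that(2)]]
      by (simp add: inner_add_left)
    finally show ?thesis .
  qed
  have J0: "0 \<le> J g" for g by (simp add: J_def)
  define m where "m = Inf (J ` S)"
  have bdd: "bdd_below (J ` S)" using J0 by (auto simp: bdd_below_def)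
  have m: "m \<le> J g" if "g \<in> S" for g unfolding m_def using bdd that by (auto intro: cInf_lower)
  have "\<exists>g\<in>S. J g < m + 1 / real (Suc n)" for n
  proof -
    have "\<exists>y\<in>J ` S. y < m + 1 / real (Suc n)"
      using cInf_lessD[of "J ` S" "m + 1 / real (Suc n)"] S0 by (auto simp: m_def)
    then show ?thesis by blast
  qed
  then obtain g where g: "\<And>n. g n \<in> S" "\<And>n. J (g n) < m + 1 / real (Suc n)" by metis
  define a where "a n = sqrt (1 / real (Suc n))" for n
  have a0: "a \<longlonglongrightarrow> 0" unfolding a_def
    using tendsto_real_sqrt[OF LIMSEQ_inverse_real_of_nat] by (simp add: inverse_eq_divide)
  have D: "\<bar>(\<integral>x. g n x \<bullet> h x \<partial>M) + (\<integral>x. F x \<bullet> h x \<partial>M)\<bar> \<le> a n * norm2 M h" if h: "h \<in> S" for n h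
  proof -
    \<comment> \<open>Along the line g n + t h the functional \<open>J\<close> is a quadratic in t
      that never drops below J (g n) - 1/(n+1), so its discriminant is controlled.\<close>
    have "((\<integral>x. g n x \<bullet> h x \<partial>M) + (\<integral>x. F x \<bullet> h x \<partial>M))\<^sup>2 \<le> (1 / real (Suc n)) * (norm2 M h)\<^sup>2"
    proof (rule quadratic_nonneg_imp)
      fix t
      show "0 \<le> 1 / real (Suc n) + 2 * t * ((\<integral>x. g n x \<bullet> h x \<partial>M) + (\<integral>x. F x \<bullet> h x \<partial>M)) + t\<^sup>2 * (norm2 M h)\<^sup>2"
        using m[OF Sadd[OF g(1)[of n] h, of t]] Jt[OF g(1)[of n] h, of t] g(2)[of n] by linarith
    qed simp
    also have "\<dots> = (a n * norm2 M h)\<^sup>2" by (simp add: a_def power_mult_distrib)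
    finally have "\<bar>(\<integral>x. g n x \<bullet> h x \<partial>M) + (\<integral>x. F x \<bullet> h x \<partial>M)\<bar>\<^sup>2 \<le> (a n * norm2 M h)\<^sup>2" by simp
    then show ?thesis by (rule power2_le_imp_le) (simp add: a_def)
  qed
  have cau: "norm2 M (\<lambda>x. g m x - g n x) \<le> a m + a n" for m n
  proof -
    \<comment> \<open>The difference of two almost minimisers is used as test element in both of
      their approximate equations.\<close>
    define h where "h x = g m x - g n x" for x
    have h: "h \<in> S" using Sadd[OF g(1)[of m] g(1)[of n], of "-1"] by (simp add: h_def[abs_def])
    have "norm2 M h * norm2 M h = (\<integral>x. g m x \<bullet> h x - g n x \<bullet> h x \<partial>M)"
      by (simp add: norm2_self h_def inner_diff_left)
    also have "\<dots> = (\<integral>x. g m x \<bullet> h x \<partial>M) - (\<integral>x. g n x \<bullet> h x \<partial>M)"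
      using integrable_inner_sq_int[OF Ssq[OF g(1)] Ssq[OF h]] by simp
    also have "\<dots> \<le> (a m + a n) * norm2 M h"
      using D[OF h, of m] D[OF h, of n] by (simp add: algebra_simps abs_le_iff)
    finally have "norm2 M h * norm2 M h \<le> (a m + a n) * norm2 M h" .
    then have "norm2 M h \<le> a m + a n \<or> norm2 M h = 0"
      using norm2_nonneg[of M h] mult_le_cancel_right by force
    moreover have "0 \<le> a m + a n" by (simp add: a_def)
    ultimately show ?thesis unfolding h_def by auto
  qed
  obtain G where G: "sq_int M G" "(\<lambda>n. norm2 M (\<lambda>x. g n x - G x)) \<longlonglongrightarrow> 0"
  proof (rule L2_complete[OF sf])
    show "sq_int M (g n)" for n by (rule Ssq g)+
    fix e :: real assume "e > 0"
    then obtain N where N: "\<And>n. n \<ge> N \<Longrightarrow> \<bar>a n\<bar> < e / 2" using LIMSEQ_D[OF a0, of "e / 2"] by auto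
    have "norm2 M (\<lambda>x. g m x - g n x) < e" if "m \<ge> N" "n \<ge> N" for m n
      using cau[of m n] N[OF that(1)] N[OF that(2)] by linarith
    then show "\<exists>N. \<forall>m\<ge>N. \<forall>n\<ge>N. norm2 M (\<lambda>x. g m x - g n x) < e" by blast
  qed blast
  show ?thesis
  proof (rule that[OF g(1) G])
    fix h assume h: "h \<in> S"
    have "\<bar>(\<integral>x. G x \<bullet> h x \<partial>M) + (\<integral>x. F x \<bullet> h x \<partial>M)\<bar> \<le> (a n + norm2 M (\<lambda>x. g n x - G x)) * norm2 M h" for n
    proof -
      have "(\<integral>x. (g n x - G x) \<bullet> h x \<partial>M) = (\<integral>x. g n x \<bullet> h x \<partial>M) - (\<integral>x. G x \<bullet> h x \<partial>M)"
        using integrable_inner_sq_int[OF Ssq[OF g(1)] Ssq[OF h]] integrable_inner_sq_int[OF G(1) Ssq[OF h]]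
        by (simp add: inner_diff_left)
      then show ?thesis
        using integral_inner_le_norm2[OF sq_int_diff[OF Ssq[OF g(1)] G(1)] Ssq[OF h], of n] D[OF h, of n]
        by (simp add: algebra_simps abs_le_iff)
    qed
    moreover have "(\<lambda>n. (a n + norm2 M (\<lambda>x. g n x - G x)) * norm2 M h) \<longlonglongrightarrow> (0 + 0) * norm2 M h"
      by (intro tendsto_intros a0 G)
    ultimately have "\<bar>(\<integral>x. G x \<bullet> h x \<partial>M) + (\<integral>x. F x \<bullet> h x \<partial>M)\<bar> \<le> (0 + 0) * norm2 M h"
      by (intro LIMSEQ_le_const) auto
    then show "(\<integral>x. G x \<bullet> h x \<partial>M) = - (\<integral>x. F x \<bullet> h x \<partial>M)" by simp
  qed
qed

section \<open>Poincare inequalities\<close>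

lemma class_C_continuous: "class_C k f \<Longrightarrow> continuous_on UNIV f"
  by (induction k) (auto dest: class_C_pred simp del: class_C.simps(2))

lemma class_C_continuous_grad:
  assumes "class_C (Suc k) f"
  shows "continuous_on UNIV (grad f)"
proof -
  have "continuous_on UNIV (\<lambda>x. \<chi> i. grad f x $ i)"
    by (intro continuous_on_vec_lambda class_C_continuous[OF class_C_SucD(2)[OF assms]])
  then show ?thesis by simp
qed

lemma nn_integral_lborel_affine:
  fixes f :: "'a::euclidean_space \<Rightarrow> ennreal"
  assumes [measurable]: "f \<in> borel_measurable borel" and c: "c \<noteq> 0"
  shows "(\<integral>\<^sup>+x. f x \<partial>lborel) = ennreal (\<bar>c\<bar> ^ DIM('a)) * (\<integral>\<^sup>+x. f (t + c *\<^sub>R x) \<partial>lborel)"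
  by (subst lborel_affine[OF c, of t])
    (simp add: nn_integral_density nn_integral_distr nn_integral_cmult)

lemma has_real_derivative_along_line:
  fixes f :: "real^'n \<Rightarrow> real"
  assumes "class_C (Suc 0) f"
  shows "((\<lambda>s. f (y + s *\<^sub>R v)) has_real_derivative grad f (y + s *\<^sub>R v) \<bullet> v) (at s)"
proof -
  have "((\<lambda>s. y + s *\<^sub>R v) has_derivative (\<lambda>h. h *\<^sub>R v)) (at s)"
    by (auto intro!: derivative_eq_intros)
  from has_derivative_compose[OF this class_C_SucD(1)[OF assms]]
  have d: "((\<lambda>s. f (y + s *\<^sub>R v)) has_derivative (\<lambda>h. grad f (y + s *\<^sub>R v) \<bullet> (h *\<^sub>R v))) (at s)" .
  show ?thesis unfolding has_field_derivative_def
    by (rule has_derivative_eq_rhs[OF d]) (simp add: fun_eq_iff mult.commute)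
qed

text \<open>The fundamental theorem of calculus on the half of the segment next to \<open>y\<close>.
  The parameter interval appears as an indicator on the whole line, ready for exchanging the order
  of integration.\<close>

lemma half_segment_le:
  fixes f :: "real^'n \<Rightarrow> real"
  assumes f: "class_C (Suc 0) f"
  shows "ennreal \<bar>f (y + (1/2) *\<^sub>R (x - y)) - f y\<bar>
    \<le> (\<integral>\<^sup>+s. ennreal (norm (x - y) * norm (grad f (y + s *\<^sub>R (x - y))) * indicator {0..1/2} s) \<partial>lborel)"
proof -
  define g where "g s = grad f (y + s *\<^sub>R (x - y)) \<bullet> (x - y)" for s
  have c: "isCont g s" for s
  proof -
    have "continuous_on UNIV g" unfolding g_def
      by (intro continuous_intros continuous_on_compose2[OF class_C_continuous_grad[OF f]]) auto
    then show ?thesis by (simp add: continuous_on_eq_continuous_at)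
  qed
  have hb: "has_bochner_integral lborel (\<lambda>s. g s * indicator {0..1/2} s)
      (f (y + (1/2) *\<^sub>R (x - y)) - f (y + 0 *\<^sub>R (x - y)))"
    by (rule has_bochner_integral_FTC_Icc_real)
      (use has_real_derivative_along_line[OF f, of y "x - y"] c in \<open>auto simp: g_def[abs_def]\<close>)
  have "ennreal \<bar>f (y + (1/2) *\<^sub>R (x - y)) - f y\<bar>
      \<le> (\<integral>\<^sup>+s. ennreal (norm (g s * indicator {0..1/2} s)) \<partial>lborel)"
    using integral_norm_bound_ennreal[of lborel "\<lambda>s. g s * indicator {0..1/2} s"] hb
    by (simp add: has_bochner_integral_iff)
  also have "\<dots> \<le> (\<integral>\<^sup>+s. ennreal (norm (x - y) * norm (grad f (y + s *\<^sub>R (x - y))) * indicator {0..1/2} s) \<partial>lborel)"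
  proof (intro nn_integral_mono ennreal_leI)
    fix s :: real
    have "\<bar>g s\<bar> \<le> norm (x - y) * norm (grad f (y + s *\<^sub>R (x - y)))"
      unfolding g_def by (metis Cauchy_Schwarz_ineq2 mult.commute)
    then show "norm (g s * indicator {0..1/2} s) \<le> norm (x - y) * norm (grad f (y + s *\<^sub>R (x - y))) * indicator {0..1/2} s"
      by (simp add: abs_mult indicator_def)
  qed
  finally show ?thesis .
qed

text \<open>The values \<open>f x\<close> and \<open>f y\<close> are compared through the midpoint, so that the change of variables
  \<open>y \<mapsto> y + s (x - y)\<close> is only needed for \<open>s \<le> 1/2\<close>, where its Jacobian is at least \<open>2\<^sup>-\<^sup>d\<close>.\<close>

lemma poincare_double_integral:
  fixes f :: "real^'n \<Rightarrow> real"
  assumes f: "class_C (Suc 0) f" and S: "convex S" and [measurable]: "S \<in> sets borel"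
    and D: "\<And>x y. x \<in> S \<Longrightarrow> y \<in> S \<Longrightarrow> norm (x - y) \<le> D"
  shows "(\<integral>\<^sup>+x. (\<integral>\<^sup>+y. ennreal (\<bar>f x - f y\<bar> * indicator S x * indicator S y) \<partial>lborel) \<partial>lborel)
    \<le> ennreal (2 ^ CARD('n) * D) * emeasure lborel S * (\<integral>\<^sup>+x. ennreal (norm (grad f x) * indicator S x) \<partial>lborel)"
proof -
  have [measurable]: "f \<in> borel_measurable borel"
    by (rule borel_measurable_continuous_onI) (rule class_C_continuous[OF f])
  have [measurable]: "grad f \<in> borel_measurable borel"
    by (rule borel_measurable_continuous_onI) (rule class_C_continuous_grad[OF f])
  define H where "H x = ennreal (norm (grad f x) * indicator S x)" for x
  have [measurable]: "H \<in> borel_measurable borel" unfolding H_def by measurable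
  define A where "A x y = ennreal (\<bar>f (y + (1/2) *\<^sub>R (x - y)) - f y\<bar> * indicator S x * indicator S y)" for x y
  have [measurable]: "(\<lambda>p. A (fst p) (snd p)) \<in> borel_measurable (lborel \<Otimes>\<^sub>M lborel)"
    "(\<lambda>p. A (snd p) (fst p)) \<in> borel_measurable (lborel \<Otimes>\<^sub>M lborel)"
    unfolding A_def by measurable
  have [measurable]: "A x \<in> borel_measurable borel" "(\<lambda>x. A x y) \<in> borel_measurable borel" for x y
    unfolding A_def by measurable
  have "(\<integral>\<^sup>+x. (\<integral>\<^sup>+y. ennreal (\<bar>f x - f y\<bar> * indicator S x * indicator S y) \<partial>lborel) \<partial>lborel)
      \<le> (\<integral>\<^sup>+x. (\<integral>\<^sup>+y. A x y + A y x \<partial>lborel) \<partial>lborel)"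
  proof (intro nn_integral_mono)
    fix x y :: "real^'n"
    have m: "y + (1/2) *\<^sub>R (x - y) = x + (1/2) *\<^sub>R (y - x)"
      by (simp add: vec_eq_iff field_simps)
    have "\<bar>f x - f y\<bar> \<le> \<bar>f (y + (1/2) *\<^sub>R (x - y)) - f y\<bar> + \<bar>f (x + (1/2) *\<^sub>R (y - x)) - f x\<bar>"
      unfolding m by simp
    then have "\<bar>f x - f y\<bar> * indicator S x * indicator S y
        \<le> \<bar>f (y + (1/2) *\<^sub>R (x - y)) - f y\<bar> * indicator S x * indicator S y
          + \<bar>f (x + (1/2) *\<^sub>R (y - x)) - f x\<bar> * indicator S y * indicator S x"
      by (auto simp: indicator_def)
    then show "ennreal (\<bar>f x - f y\<bar> * indicator S x * indicator S y) \<le> A x y + A y x"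
      unfolding A_def by (simp add: ennreal_plus[symmetric] ennreal_leI del: ennreal_plus)
  qed
  also have "\<dots> = (\<integral>\<^sup>+x. (\<integral>\<^sup>+y. A x y \<partial>lborel) + (\<integral>\<^sup>+y. A y x \<partial>lborel) \<partial>lborel)"
    by (intro nn_integral_cong nn_integral_add) auto
  also have "\<dots> = (\<integral>\<^sup>+x. (\<integral>\<^sup>+y. A x y \<partial>lborel) \<partial>lborel) + (\<integral>\<^sup>+x. (\<integral>\<^sup>+y. A y x \<partial>lborel) \<partial>lborel)"
    by (intro nn_integral_add) measurable
  also have "(\<integral>\<^sup>+x. (\<integral>\<^sup>+y. A y x \<partial>lborel) \<partial>lborel) = (\<integral>\<^sup>+x. (\<integral>\<^sup>+y. A x y \<partial>lborel) \<partial>lborel)"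
    by (rule lborel_pair.Fubini') (simp add: case_prod_beta')
  finally have 1: "(\<integral>\<^sup>+x. (\<integral>\<^sup>+y. ennreal (\<bar>f x - f y\<bar> * indicator S x * indicator S y) \<partial>lborel) \<partial>lborel)
      \<le> 2 * (\<integral>\<^sup>+x. (\<integral>\<^sup>+y. A x y \<partial>lborel) \<partial>lborel)" by (simp add: mult_2)
  have inner: "(\<integral>\<^sup>+y. A x y \<partial>lborel) \<le> ennreal (2 ^ CARD('n) * D / 2) * (\<integral>\<^sup>+x. H x \<partial>lborel) * indicator S x" for x
  proof (cases "x \<in> S")
    case True
    have D0: "0 \<le> D" using D[OF True True] by simp
    have "(\<integral>\<^sup>+y. A x y \<partial>lborel)
        \<le> (\<integral>\<^sup>+y. (\<integral>\<^sup>+s. ennreal (D * indicator {0..1/2} s) * H (y + s *\<^sub>R (x - y)) \<partial>lborel) \<partial>lborel)"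
    proof (rule nn_integral_mono)
      fix y
      show "A x y \<le> (\<integral>\<^sup>+s. ennreal (D * indicator {0..1/2} s) * H (y + s *\<^sub>R (x - y)) \<partial>lborel)"
      proof (cases "y \<in> S")
        case y: True
        have "A x y = ennreal \<bar>f (y + (1/2) *\<^sub>R (x - y)) - f y\<bar>" using True y by (simp add: A_def)
        also have "\<dots> \<le> (\<integral>\<^sup>+s. ennreal (norm (x - y) * norm (grad f (y + s *\<^sub>R (x - y))) * indicator {0..1/2} s) \<partial>lborel)"
          by (rule half_segment_le[OF f])
        also have "\<dots> \<le> (\<integral>\<^sup>+s. ennreal (D * indicator {0..1/2} s) * H (y + s *\<^sub>R (x - y)) \<partial>lborel)"
        proof (rule nn_integral_mono)
          fix s :: real
          show "ennreal (norm (x - y) * norm (grad f (y + s *\<^sub>R (x - y))) * indicator {0..1/2} s)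
              \<le> ennreal (D * indicator {0..1/2} s) * H (y + s *\<^sub>R (x - y))"
          proof (cases "s \<in> {0..1/2}")
            case s: True
            have "(1 - s) *\<^sub>R y + s *\<^sub>R x \<in> S" by (rule convexD_alt[OF S y True]) (use s in auto)
            moreover have "(1 - s) *\<^sub>R y + s *\<^sub>R x = y + s *\<^sub>R (x - y)" by (simp add: algebra_simps)
            ultimately have "y + s *\<^sub>R (x - y) \<in> S" by simp
            then show ?thesis using s D[OF True y] D0
              by (auto simp: H_def ennreal_mult[symmetric] intro!: ennreal_leI mult_right_mono)
          qed simp
        qed
        finally show ?thesis .
      qed (simp add: A_def)
    qed
    also have "\<dots> = (\<integral>\<^sup>+s. (\<integral>\<^sup>+y. ennreal (D * indicator {0..1/2} s) * H (y + s *\<^sub>R (x - y)) \<partial>lborel) \<partial>lborel)"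
      by (rule lborel_pair.Fubini') measurable
    also have "\<dots> \<le> (\<integral>\<^sup>+s. ennreal (D * 2 ^ CARD('n)) * (\<integral>\<^sup>+x. H x \<partial>lborel) * indicator {0..1/2::real} s \<partial>lborel)"
    proof (rule nn_integral_mono)
      fix s :: real
      show "(\<integral>\<^sup>+y. ennreal (D * indicator {0..1/2} s) * H (y + s *\<^sub>R (x - y)) \<partial>lborel)
          \<le> ennreal (D * 2 ^ CARD('n)) * (\<integral>\<^sup>+x. H x \<partial>lborel) * indicator {0..1/2::real} s"
      proof (cases "s \<in> {0..1/2}")
        case s: True
        have eq: "y + s *\<^sub>R (x - y) = s *\<^sub>R x + (1 - s) *\<^sub>R y" for y by (simp add: algebra_simps)
        have "(1/2) ^ CARD('n) \<le> \<bar>1 - s\<bar> ^ CARD('n)" using s by (intro power_mono) auto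
        then have p: "1 \<le> 2 ^ CARD('n) * \<bar>1 - s\<bar> ^ CARD('n)"
          by (simp add: field_simps power_one_over)
        have "(\<integral>\<^sup>+y. H (s *\<^sub>R x + (1 - s) *\<^sub>R y) \<partial>lborel) = ennreal 1 * (\<integral>\<^sup>+y. H (s *\<^sub>R x + (1 - s) *\<^sub>R y) \<partial>lborel)" by simp
        also have "\<dots> \<le> ennreal (2 ^ CARD('n) * \<bar>1 - s\<bar> ^ CARD('n)) * (\<integral>\<^sup>+y. H (s *\<^sub>R x + (1 - s) *\<^sub>R y) \<partial>lborel)"
          by (intro mult_right_mono ennreal_leI p) simp
        also have "\<dots> = ennreal (2 ^ CARD('n)) * (\<integral>\<^sup>+x. H x \<partial>lborel)"
          using s by (subst (2) nn_integral_lborel_affine[where c="1 - s" and t="s *\<^sub>R x"])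
            (auto simp: ennreal_mult mult.assoc)
        finally show ?thesis using s D0
          by (simp add: eq nn_integral_cmult ennreal_mult mult.assoc mult_left_mono)
      qed simp
    qed
    \<comment> \<open>The length 1/2 of the parameter interval later absorbs the factor 2 that comes
      from the two half segments.\<close>
    also have "\<dots> = ennreal (D * 2 ^ CARD('n)) * (\<integral>\<^sup>+x. H x \<partial>lborel) * ennreal (1/2)"
      by (subst nn_integral_cmult_indicator) auto
    also have "\<dots> = ennreal (2 ^ CARD('n) * D / 2) * (\<integral>\<^sup>+x. H x \<partial>lborel) * indicator S x"
    proof -
      have "ennreal (2 ^ CARD('n) * D / 2) = ennreal (D * 2 ^ CARD('n)) * ennreal (1/2)"
        using D0 by (subst ennreal_mult[symmetric]) (auto simp: mult.commute)
      then show ?thesis using True by (simp add: mult_ac)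
    qed
    finally show ?thesis .
  qed (simp add: A_def)
  have "(\<integral>\<^sup>+x. (\<integral>\<^sup>+y. A x y \<partial>lborel) \<partial>lborel)
      \<le> (\<integral>\<^sup>+x. ennreal (2 ^ CARD('n) * D / 2) * (\<integral>\<^sup>+x. H x \<partial>lborel) * indicator S x \<partial>lborel)"
    by (intro nn_integral_mono inner)
  also have "\<dots> = ennreal (2 ^ CARD('n) * D / 2) * (\<integral>\<^sup>+x. H x \<partial>lborel) * emeasure lborel S"
    by (subst nn_integral_cmult_indicator) auto
  finally have 2: "2 * (\<integral>\<^sup>+x. (\<integral>\<^sup>+y. A x y \<partial>lborel) \<partial>lborel)
      \<le> 2 * (ennreal (2 ^ CARD('n) * D / 2) * (\<integral>\<^sup>+x. H x \<partial>lborel) * emeasure lborel S)"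
    by (rule mult_left_mono) simp
  show ?thesis
  proof (cases "S = {}")
    case False
    then obtain x where "x \<in> S" by blast
    then have D0: "0 \<le> D" using D[of x x] by simp
    have "2 * ennreal (2 ^ CARD('n) * D / 2) = ennreal (2 ^ CARD('n) * D)"
      using D0 ennreal_mult[of 2 "2 ^ CARD('n) * D / 2"] by simp
    then have "2 * (ennreal (2 ^ CARD('n) * D / 2) * (\<integral>\<^sup>+x. H x \<partial>lborel) * emeasure lborel S)
        = ennreal (2 ^ CARD('n) * D) * emeasure lborel S * (\<integral>\<^sup>+x. H x \<partial>lborel)"
      by (simp flip: mult.assoc) (simp add: mult_ac)
    then show ?thesis using order_trans[OF 1 2] unfolding H_def by simp
  qed simp
qed

lemma integrable_continuous_support:
  fixes g :: "'a::euclidean_space \<Rightarrow> 'b::euclidean_space"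
  assumes "continuous_on UNIV g" "bounded K" "\<And>x. x \<notin> K \<Longrightarrow> g x = 0"
  shows "integrable lborel g"
proof -
  have "compact (closure K)" using assms(2) by (simp add: compact_closure)
  then have "integrable lborel (\<lambda>x. indicator (closure K) x *\<^sub>R g x)"
    by (rule borel_integrable_compact) (rule continuous_on_subset[OF assms(1)], simp)
  moreover have "indicator (closure K) x *\<^sub>R g x = g x" for x
    using assms(3)[of x] closure_subset[of K] by (auto simp: indicator_def)
  ultimately show ?thesis by simp
qed

text \<open>Since \<open>\<rho>\<close> has mean zero, \<open>f\<close> may be replaced by f - f y
  for any y in \<open>S\<close>. Averaging over y, with \<open>S\<close> of measure one, leaves the
  double integral of |f x - f y|. This is how a mean-zero source on a lattice cell becomes small in
  the dual of the energy space.\<close>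

lemma poincare_mean_zero:
  fixes f \<rho> :: "real^'n \<Rightarrow> real"
  assumes f: "class_C (Suc 0) f" and S: "convex S" "bounded S" and [measurable]: "S \<in> sets borel"
    and D: "\<And>x y. x \<in> S \<Longrightarrow> y \<in> S \<Longrightarrow> norm (x - y) \<le> D" and D0: "0 \<le> D"
    and S1: "emeasure lborel S = 1"
    and [measurable]: "\<rho> \<in> borel_measurable borel" and \<rho>: "\<And>x. \<bar>\<rho> x\<bar> \<le> R * indicator S x"
    and \<rho>0: "(\<integral>x. \<rho> x \<partial>lborel) = 0"
  shows "\<bar>\<integral>x. f x * \<rho> x \<partial>lborel\<bar> \<le> R * 2 ^ CARD('n) * D * (\<integral>x. norm (grad f x) * indicator S x \<partial>lborel)"
proof -
  have cf: "continuous_on UNIV f" and cg: "continuous_on UNIV (grad f)"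
    using class_C_continuous[OF f] class_C_continuous_grad[OF f] by auto
  have [measurable]: "f \<in> borel_measurable borel" "grad f \<in> borel_measurable borel"
    using cf cg by (auto intro: borel_measurable_continuous_onI)
  have cS: "compact (closure S)" using S by (simp add: compact_closure)
  have intS: "integrable lborel (\<lambda>x. indicator S x *\<^sub>R g x)"
    if "continuous_on UNIV g" for g :: "real^'n \<Rightarrow> real"
  proof (rule Bochner_Integration.integrable_bound)
    have [measurable]: "g \<in> borel_measurable borel" using that by (rule borel_measurable_continuous_onI)
    show "integrable lborel (\<lambda>x. indicator (closure S) x *\<^sub>R g x)"
      by (rule borel_integrable_compact[OF cS]) (rule continuous_on_subset[OF that], simp)
    show "(\<lambda>x. indicator S x *\<^sub>R g x) \<in> borel_measurable lborel" by measurable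
    show "AE x in lborel. norm (indicator S x *\<^sub>R g x) \<le> norm (indicator (closure S) x *\<^sub>R g x)"
      using closure_subset[of S] by (auto simp: indicator_def)
  qed
  obtain z where "z \<in> S" using S1 by fastforce
  then have R0: "0 \<le> R" using \<rho>[of z] by simp
  have i1: "integrable lborel \<rho>"
    by (rule Bochner_Integration.integrable_bound[OF integrable_mult_right[OF intS[OF continuous_on_const[of _ 1]], of R]])
      (use \<rho> R0 in \<open>auto simp: indicator_def\<close>)
  have i2: "integrable lborel (\<lambda>x. f x * \<rho> x)"
  proof (rule Bochner_Integration.integrable_bound[OF integrable_mult_right[OF intS[OF cf], of R]])
    have "\<bar>f x\<bar> * \<bar>\<rho> x\<bar> \<le> \<bar>f x\<bar> * (R * indicator S x)" for x
      by (intro mult_left_mono \<rho>) auto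
    then show "AE x in lborel. norm (f x * \<rho> x) \<le> norm (R * (indicator S x *\<^sub>R f x))"
      using R0 by (auto simp: abs_mult mult_ac)
  qed measurable
  have i3: "integrable lborel (\<lambda>x. norm (grad f x) * indicator S x)"
    using intS[of "\<lambda>x. norm (grad f x)"] cg by (auto simp: mult.commute intro: continuous_intros)
  let ?I = "\<integral>x. f x * \<rho> x \<partial>lborel"
  have pt: "ennreal \<bar>?I\<bar> * indicator S y \<le> ennreal R * (\<integral>\<^sup>+x. ennreal (\<bar>f x - f y\<bar> * indicator S x * indicator S y) \<partial>lborel)" for y
  proof (cases "y \<in> S")
    case True
    have "?I = (\<integral>x. f x * \<rho> x - f y * \<rho> x \<partial>lborel)"
      using i1 i2 \<rho>0 by simp
    then have "ennreal \<bar>?I\<bar> = ennreal (norm (\<integral>x. f x * \<rho> x - f y * \<rho> x \<partial>lborel))" by simp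
    also have "\<dots> \<le> (\<integral>\<^sup>+x. ennreal (norm (f x * \<rho> x - f y * \<rho> x)) \<partial>lborel)"
      using i1 i2 by (intro integral_norm_bound_ennreal) auto
    also have "\<dots> \<le> (\<integral>\<^sup>+x. ennreal R * ennreal (\<bar>f x - f y\<bar> * indicator S x * indicator S y) \<partial>lborel)"
    proof (rule nn_integral_mono)
      fix x
      have "norm (f x * \<rho> x - f y * \<rho> x) = \<bar>f x - f y\<bar> * \<bar>\<rho> x\<bar>"
        by (simp add: abs_mult left_diff_distrib[symmetric])
      also have "\<dots> \<le> \<bar>f x - f y\<bar> * (R * indicator S x)" by (intro mult_left_mono \<rho>) auto
      finally show "ennreal (norm (f x * \<rho> x - f y * \<rho> x)) \<le> ennreal R * ennreal (\<bar>f x - f y\<bar> * indicator S x * indicator S y)"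
        using R0 True by (subst ennreal_mult[symmetric]) (auto intro!: ennreal_leI simp: mult_ac)
    qed
    also have "\<dots> = ennreal R * (\<integral>\<^sup>+x. ennreal (\<bar>f x - f y\<bar> * indicator S x * indicator S y) \<partial>lborel)"
      by (rule nn_integral_cmult) measurable
    finally show ?thesis using True by simp
  qed simp
  have "ennreal \<bar>?I\<bar> = (\<integral>\<^sup>+y. ennreal \<bar>?I\<bar> * indicator S y \<partial>lborel)"
    using S1 by (subst nn_integral_cmult_indicator) auto
  also have "\<dots> \<le> (\<integral>\<^sup>+y. ennreal R * (\<integral>\<^sup>+x. ennreal (\<bar>f y - f x\<bar> * indicator S y * indicator S x) \<partial>lborel) \<partial>lborel)"
    by (intro nn_integral_mono order_trans[OF pt]) (simp add: abs_minus_commute mult_ac)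
  also have "\<dots> = ennreal R * (\<integral>\<^sup>+y. (\<integral>\<^sup>+x. ennreal (\<bar>f y - f x\<bar> * indicator S y * indicator S x) \<partial>lborel) \<partial>lborel)"
    by (rule nn_integral_cmult) measurable
  also have "\<dots> \<le> ennreal R * (ennreal (2 ^ CARD('n) * D) * emeasure lborel S * (\<integral>\<^sup>+x. ennreal (norm (grad f x) * indicator S x) \<partial>lborel))"
    by (intro mult_left_mono poincare_double_integral f S D) auto
  also have "\<dots> = ennreal (R * 2 ^ CARD('n) * D * (\<integral>x. norm (grad f x) * indicator S x \<partial>lborel))"
    using i3 S1 R0 D0 by (subst nn_integral_eq_integral) (auto simp: ennreal_mult mult.assoc)
  finally show ?thesis using R0 D0 by (subst (asm) ennreal_le_iff) auto
qed

section \<open>Test functions and integrals over an open set\<close>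

lemma grad_zero_locally:
  fixes f :: "real^'n \<Rightarrow> real"
  assumes "open U" "x \<in> U" "\<And>y. y \<in> U \<Longrightarrow> f y = 0"
  shows "grad f x = 0"
proof (rule grad_eqI)
  have "(f has_derivative (\<lambda>h. 0)) (at x)"
    by (rule has_derivative_transform_within_open[OF has_derivative_const assms(1,2)]) (simp add: assms(3))
  then show "(f has_derivative (\<lambda>h. 0 \<bullet> h)) (at x)" by simp
qed

lemma test_functionsD:
  assumes "f \<in> test_functions \<Omega>"
  shows "class_C k f" "bounded {x. f x \<noteq> 0}" "x \<notin> \<Omega> \<Longrightarrow> f x = 0" "x \<notin> \<Omega> \<Longrightarrow> grad f x = 0"
    "x \<notin> closure {x. f x \<noteq> 0} \<Longrightarrow> grad f x = 0" "bounded (closure {x. f x \<noteq> 0})"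
proof -
  show "class_C k f" using assms by (simp add: test_functions_def)
  have c: "compact (closure {x. f x \<noteq> 0})" and s: "closure {x. f x \<noteq> 0} \<subseteq> \<Omega>"
    using assms by (auto simp: test_functions_def)
  show "bounded (closure {x. f x \<noteq> 0})" using c by (simp add: compact_imp_bounded)
  then show "bounded {x. f x \<noteq> 0}" by (rule bounded_subset) (rule closure_subset)
  show "f x = 0" if "x \<notin> \<Omega>" using that s closure_subset[of "{x. f x \<noteq> 0}"] by auto
  show *: "grad f x = 0" if "x \<notin> closure {x. f x \<noteq> 0}" for x
    by (rule grad_zero_locally[of "- closure {x. f x \<noteq> 0}"]) (use that closure_subset[of "{x. f x \<noteq> 0}"] in auto)
  show "grad f x = 0" if "x \<notin> \<Omega>" using * s that by blast
qed

lemma grad_add_scale: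
  assumes "class_C (Suc 0) f" "class_C (Suc 0) g"
  shows "grad (\<lambda>x. f x + t * g x) x = grad f x + t *\<^sub>R grad g x"
  by (rule grad_eqI)
    (auto intro!: derivative_eq_intros class_C_SucD(1) assms simp: inner_add_left)

lemma zero_test_function: "(\<lambda>x. 0) \<in> test_functions \<Omega>"
  by (simp add: test_functions_def class_C_const)

lemma test_functions_add_scale:
  assumes "f \<in> test_functions \<Omega>" "g \<in> test_functions \<Omega>"
  shows "(\<lambda>x. f x + t * g x) \<in> test_functions \<Omega>"
proof -
  have sub: "{x. f x + t * g x \<noteq> 0} \<subseteq> {x. f x \<noteq> 0} \<union> {x. g x \<noteq> 0}" by auto
  have "closure {x. f x + t * g x \<noteq> 0} \<subseteq> closure {x. f x \<noteq> 0} \<union> closure {x. g x \<noteq> 0}"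
    using closure_mono[OF sub] by (simp add: closure_Un)
  moreover have "bounded {x. f x + t * g x \<noteq> 0}"
    using bounded_subset[OF _ sub] test_functionsD(2)[OF assms(1)] test_functionsD(2)[OF assms(2)] by simp
  ultimately show ?thesis using assms
    by (auto simp: test_functions_def compact_closure intro!: class_C_add class_C_mult class_C_const)
qed

lemma nn_integral_lebesgue_on:
  assumes "open (\<Omega> :: (real^'n) set)"
  shows "(\<integral>\<^sup>+x. f x \<partial>lebesgue_on \<Omega>) = (\<integral>\<^sup>+x. f x * indicator \<Omega> x \<partial>lborel)"
  using assms by (simp add: nn_integral_restrict_space nn_integral_completion)

lemma borel_measurable_lebesgue_on_borel:
  assumes "g \<in> borel_measurable borel"
  shows "g \<in> borel_measurable (lebesgue_on \<Omega>)"
  using assms by (intro measurable_restrict_space1 measurable_completion) simp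

lemma integral_lebesgue_on_eq:
  fixes g :: "real^'n \<Rightarrow> 'b::euclidean_space"
  assumes "open \<Omega>" and [measurable]: "g \<in> borel_measurable borel" and "\<And>x. x \<notin> \<Omega> \<Longrightarrow> g x = 0"
  shows "integral\<^sup>L (lebesgue_on \<Omega>) g = integral\<^sup>L lborel g"
    "integrable (lebesgue_on \<Omega>) g \<longleftrightarrow> integrable lborel g"
proof -
  have eq: "(\<lambda>x. indicator \<Omega> x *\<^sub>R g x) = g"
  proof
    show "indicator \<Omega> x *\<^sub>R g x = g x" for x by (cases "x \<in> \<Omega>") (simp_all add: assms(3))
  qed
  show "integral\<^sup>L (lebesgue_on \<Omega>) g = integral\<^sup>L lborel g"
    using assms(1) by (subst integral_restrict_space) (auto simp: eq integral_completion)
  show "integrable (lebesgue_on \<Omega>) g \<longleftrightarrow> integrable lborel g"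
    using assms(1) by (subst integrable_restrict_space) (auto simp: eq integrable_completion)
qed

lemma sq_int_grad_test:
  assumes "f \<in> test_functions \<Omega>"
  shows "sq_int lborel (grad f)"
proof -
  have c: "continuous_on UNIV (grad f)" by (rule class_C_continuous_grad[OF test_functionsD(1)[OF assms, of "Suc 0"]])
  have "integrable lborel (\<lambda>x. (norm (grad f x))\<^sup>2)"
    by (rule integrable_continuous_support[OF _ test_functionsD(6)[OF assms]])
      (use test_functionsD(5)[OF assms] c in \<open>auto intro!: continuous_intros\<close>)
  then show ?thesis using c by (auto simp: sq_int_def intro: borel_measurable_continuous_onI)
qed

lemma sq_int_lebesgue_on:
  fixes g :: "real^'n \<Rightarrow> 'b::euclidean_space"
  assumes "open \<Omega>" "sq_int lborel g"
  shows "sq_int (lebesgue_on \<Omega>) g"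
proof -
  have [measurable]: "g \<in> borel_measurable borel" "\<Omega> \<in> sets borel" using assms by (auto simp: sq_int_def)
  have "integrable lborel (\<lambda>x. indicator \<Omega> x *\<^sub>R (norm (g x))\<^sup>2)"
    by (rule integrable_mult_indicator) (use assms in \<open>auto simp: sq_int_def\<close>)
  then have "integrable (lebesgue_on \<Omega>) (\<lambda>x. (norm (g x))\<^sup>2)"
    using assms(1) by (subst integrable_restrict_space) (auto simp: integrable_completion)
  then show ?thesis by (simp add: sq_int_def borel_measurable_lebesgue_on_borel)
qed

lemma norm2_lebesgue_on:
  fixes g :: "real^'n \<Rightarrow> 'b::euclidean_space"
  assumes "open \<Omega>" "g \<in> borel_measurable borel" "\<And>x. x \<notin> \<Omega> \<Longrightarrow> g x = 0"
  shows "norm2 (lebesgue_on \<Omega>) g = norm2 lborel g"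
  unfolding norm2_def using assms by (subst integral_lebesgue_on_eq) auto

lemma norm2_lebesgue_on_le:
  fixes g :: "real^'n \<Rightarrow> 'b::euclidean_space"
  assumes "open \<Omega>" "sq_int lborel g"
  shows "norm2 (lebesgue_on \<Omega>) g \<le> norm2 lborel g"
proof -
  have [measurable]: "g \<in> borel_measurable borel" "\<Omega> \<in> sets borel" using assms by (auto simp: sq_int_def)
  have i: "integrable (lebesgue_on \<Omega>) (\<lambda>x. (norm (g x))\<^sup>2)" "integrable lborel (\<lambda>x. (norm (g x))\<^sup>2)"
    using sq_int_lebesgue_on[OF assms] assms(2) by (auto simp: sq_int_def)
  have "ennreal (\<integral>x. (norm (g x))\<^sup>2 \<partial>lebesgue_on \<Omega>) = (\<integral>\<^sup>+x. ennreal ((norm (g x))\<^sup>2) * indicator \<Omega> x \<partial>lborel)"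
    using i by (subst nn_integral_eq_integral[symmetric]) (auto simp: nn_integral_lebesgue_on[OF assms(1)])
  also have "\<dots> \<le> (\<integral>\<^sup>+x. ennreal ((norm (g x))\<^sup>2) \<partial>lborel)"
    by (intro nn_integral_mono) (auto simp: indicator_def)
  also have "\<dots> = ennreal (\<integral>x. (norm (g x))\<^sup>2 \<partial>lborel)" using i by (subst nn_integral_eq_integral) auto
  finally show ?thesis unfolding norm2_def by (simp add: ennreal_le_iff)
qed

lemma integral_norm_indicator_le:
  fixes g :: "real^'n \<Rightarrow> 'b::euclidean_space"
  assumes g: "sq_int lborel g" and [measurable]: "S \<in> sets borel" and S: "emeasure lborel S < \<infinity>"
  shows "integrable lborel (\<lambda>x. norm (g x) * indicator S x)"
    "(\<integral>x. norm (g x) * indicator S x \<partial>lborel) \<le> norm2 lborel g * sqrt (measure lborel S)"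
proof -
  have 1: "sq_int lborel (\<lambda>x. norm (g x))" using g by (auto simp: sq_int_def)
  have sq: "(indicator S x :: real)\<^sup>2 = indicator S x" for x by (simp add: indicator_def)
  then have 2: "sq_int lborel (indicator S :: _ \<Rightarrow> real)" using S by (simp add: sq_int_def)
  show "integrable lborel (\<lambda>x. norm (g x) * indicator S x)"
    using integrable_inner_sq_int[OF 1 2] by simp
  have "norm2 lborel (indicator S :: _ \<Rightarrow> real) = sqrt (measure lborel S)" by (simp add: norm2_def sq)
  moreover have "norm2 lborel (\<lambda>x. norm (g x)) = norm2 lborel g" by (simp add: norm2_def)
  ultimately show "(\<integral>x. norm (g x) * indicator S x \<partial>lborel) \<le> norm2 lborel g * sqrt (measure lborel S)"
    using integral_inner_le_norm2[OF 1 2] by simp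
qed

text \<open>At a point x where \<open>f\<close> vanishes, |f y| equals |f x - f y|. Integration over
  x in the small ball therefore bounds the integral of |f| over the large ball by the Poincare
  double integral. A hole supplies such a small ball, so the gradient alone controls the function
  locally.\<close>

lemma friedrichs_L1:
  fixes z :: "real^'n"
  assumes r: "0 < r" "r \<le> R"
  shows "\<exists>C\<ge>0. \<forall>f. class_C (Suc 0) f \<and> (\<forall>x\<in>ball z r. f x = 0) \<and> sq_int lborel (grad f)
    \<longrightarrow> (\<integral>\<^sup>+x. ennreal (\<bar>f x\<bar> * indicator (ball z R) x) \<partial>lborel) \<le> ennreal (C * norm2 lborel (grad f))"
proof -
  define m where "m = measure lborel (ball z r)"
  define M where "M = measure lborel (ball z R)"
  have m: "emeasure lborel (ball z r) = ennreal m" "0 < m"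
    unfolding m_def using r content_ball_pos[of r z] emeasure_lborel_ball_finite[of z r]
    by (auto intro!: emeasure_eq_ennreal_measure)
  have M: "emeasure lborel (ball z R) = ennreal M" "0 \<le> M"
    unfolding M_def using emeasure_lborel_ball_finite[of z R] by (auto intro!: emeasure_eq_ennreal_measure)
  define C where "C = 2 ^ CARD('n) * (2 * R) * M * sqrt M / m"
  have C0: "0 \<le> C" unfolding C_def using r m M by simp
  moreover have "(\<integral>\<^sup>+x. ennreal (\<bar>f x\<bar> * indicator (ball z R) x) \<partial>lborel) \<le> ennreal (C * norm2 lborel (grad f))"
    if f: "class_C (Suc 0) f" "\<And>x. x \<in> ball z r \<Longrightarrow> f x = 0" "sq_int lborel (grad f)" for f
  proof -
    have [measurable]: "f \<in> borel_measurable borel" "grad f \<in> borel_measurable borel"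
      using class_C_continuous[OF f(1)] class_C_continuous_grad[OF f(1)] by (auto intro: borel_measurable_continuous_onI)
    let ?I = "\<integral>\<^sup>+x. ennreal (\<bar>f x\<bar> * indicator (ball z R) x) \<partial>lborel"
    have "?I * ennreal m = (\<integral>\<^sup>+x. ?I * indicator (ball z r) x \<partial>lborel)"
      by (subst nn_integral_cmult_indicator) (auto simp: m)
    also have "\<dots> \<le> (\<integral>\<^sup>+x. (\<integral>\<^sup>+y. ennreal (\<bar>f x - f y\<bar> * indicator (ball z R) x * indicator (ball z R) y) \<partial>lborel) \<partial>lborel)"
    proof (rule nn_integral_mono)
      fix x
      show "?I * indicator (ball z r) x \<le> (\<integral>\<^sup>+y. ennreal (\<bar>f x - f y\<bar> * indicator (ball z R) x * indicator (ball z R) y) \<partial>lborel)"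
      proof (cases "x \<in> ball z r")
        case True
        then have "x \<in> ball z R" using r by auto
        then show ?thesis using True f(2)[of x] by simp
      qed simp
    qed
    also have "\<dots> \<le> ennreal (2 ^ CARD('n) * (2 * R)) * emeasure lborel (ball z R) * (\<integral>\<^sup>+x. ennreal (norm (grad f x) * indicator (ball z R) x) \<partial>lborel)"
    proof (rule poincare_double_integral[OF f(1)])
      show "norm (x - y) \<le> 2 * R" if "x \<in> ball z R" "y \<in> ball z R" for x y
        using that dist_triangle_less_add[of x z R y R] by (simp add: dist_norm norm_minus_commute)
    qed auto
    also have "(\<integral>\<^sup>+x. ennreal (norm (grad f x) * indicator (ball z R) x) \<partial>lborel) = ennreal (\<integral>x. norm (grad f x) * indicator (ball z R) x \<partial>lborel)"
      by (intro nn_integral_eq_integral integral_norm_indicator_le f) (auto simp: M)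
    also have "ennreal (2 ^ CARD('n) * (2 * R)) * emeasure lborel (ball z R) * \<dots>
        \<le> ennreal (2 ^ CARD('n) * (2 * R)) * emeasure lborel (ball z R) * ennreal (norm2 lborel (grad f) * sqrt M)"
      using integral_norm_indicator_le(2)[OF f(3), of "ball z R"]
      by (intro mult_left_mono ennreal_leI) (auto simp: M M_def[symmetric])
    also have "\<dots> = ennreal (C * norm2 lborel (grad f)) * ennreal m"
      unfolding M(1) using r m M C0
      by (simp add: ennreal_mult[symmetric] C_def mult_ac)
    finally have "?I * ennreal m \<le> ennreal (C * norm2 lborel (grad f)) * ennreal m" .
    then show ?thesis using m(2) ennreal_mult_le_mult_iff[of "ennreal m" ?I "ennreal (C * norm2 lborel (grad f))"]
      by (simp add: mult.commute)
  qed
  ultimately show ?thesis by blast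
qed

lemma tendsto_0_if_eventually_le:
  fixes X :: "nat \<Rightarrow> ennreal"
  assumes "\<And>\<epsilon>::real. \<epsilon> > 0 \<Longrightarrow> \<exists>N. \<forall>n\<ge>N. X n \<le> ennreal \<epsilon>"
  shows "X \<longlonglongrightarrow> 0"
proof (rule order_tendstoI)
  fix a :: ennreal assume "0 < a"
  then obtain b where b: "0 < b" "b < a" using dense by blast
  then have "b < top" by (meson less_le_trans top_greatest)
  with b have "0 < enn2real b" "ennreal (enn2real b) = b" by (auto simp: enn2real_positive_iff)
  with assms[of "enn2real b"] b show "\<forall>\<^sub>F n in sequentially. X n < a"
    by (auto simp: eventually_sequentially intro: le_less_trans)
qed simp

text \<open>One positive weight on the whole space turns the L1 bounds on all balls into a single
  weighted L1 bound. One almost everywhere convergent subsequence then defines \<open>u\<close> for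
  all balls at once, and Fatou's lemma gives convergence of the full sequence on each ball.\<close>

lemma ex_L1_loc_limit:
  fixes \<psi> :: "nat \<Rightarrow> real^'n \<Rightarrow> real"
  assumes [measurable]: "\<And>n. \<psi> n \<in> borel_measurable borel" and C: "\<And>k::nat. 0 \<le> C k"
    and bd: "\<And>m n k. (\<integral>\<^sup>+x. ennreal (\<bar>\<psi> m x - \<psi> n x\<bar> * indicator (ball z (real k + 1)) x) \<partial>lborel) \<le> ennreal (C k * d m n)"
    and bd0: "\<And>n k. (\<integral>\<^sup>+x. ennreal (\<bar>\<psi> n x\<bar> * indicator (ball z (real k + 1)) x) \<partial>lborel) \<le> ennreal (C k * e n)"
    and d: "\<And>m n. 0 \<le> d m n" "\<And>n. 0 \<le> e n" "\<And>\<delta>. \<delta> > 0 \<Longrightarrow> \<exists>N. \<forall>m\<ge>N. \<forall>n\<ge>N. d m n < \<delta>"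
  obtains u where "u \<in> borel_measurable borel"
    "\<And>k. (\<lambda>n. \<integral>\<^sup>+x. ennreal (\<bar>\<psi> n x - u x\<bar> * indicator (ball z (real k + 1)) x) \<partial>lborel) \<longlonglongrightarrow> 0"
proof -
  \<comment> \<open>\<open>N x\<close> is the index of the unit shell containing \<open>x\<close>,
    so \<open>x\<close> lies in the ball of radius N x + 1. In \<open>c\<close> the factor 2^k makes
    the sum over all balls converge, and C k + 1 compensates the constant of the k-th ball while
    staying positive.\<close>
  define N where "N x = nat \<lfloor>norm (x - z)\<rfloor>" for x
  define c where "c k = 1 / ((C k + 1) * 2 ^ k)" for k
  define w where "w x = c (N x)" for x
  have c: "0 < c k" for k using C[of k] by (simp add: c_def)
  have [measurable]: "ball z (real k + 1) \<in> sets borel" for k by simp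
  have [measurable]: "N \<in> borel \<rightarrow>\<^sub>M count_space UNIV" unfolding N_def by measurable
  have [measurable]: "w \<in> borel_measurable borel" unfolding w_def by measurable
  have w: "0 < w x" for x by (simp add: w_def c)
  have W: "(\<integral>\<^sup>+x. ennreal (w x * \<bar>h x\<bar>) \<partial>lborel) \<le> ennreal (2 * a)"
    if [measurable]: "h \<in> borel_measurable borel" and a: "0 \<le> a"
      and h: "\<And>k. (\<integral>\<^sup>+x. ennreal (\<bar>h x\<bar> * indicator (ball z (real k + 1)) x) \<partial>lborel) \<le> ennreal (C k * a)" for h a
  proof -
    let ?f = "\<lambda>k x. ennreal (c k) * ennreal (\<bar>h x\<bar> * indicator (ball z (real k + 1)) x)"
    have "(\<integral>\<^sup>+x. ennreal (w x * \<bar>h x\<bar>) \<partial>lborel) \<le> (\<integral>\<^sup>+x. (\<Sum>k. ?f k x) \<partial>lborel)"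
    proof (rule nn_integral_mono)
      fix x
      have "norm (x - z) < real (N x) + 1" unfolding N_def by (simp add: of_nat_nat)
      then have "x \<in> ball z (real (N x) + 1)" by (simp add: dist_norm norm_minus_commute)
      then have "ennreal (w x * \<bar>h x\<bar>) = sum (\<lambda>k. ?f k x) {N x}"
        using c[of "N x"] by (simp add: w_def ennreal_mult less_imp_le)
      also have "\<dots> \<le> (\<Sum>k. ?f k x)" by (rule sum_le_suminf) auto
      finally show "ennreal (w x * \<bar>h x\<bar>) \<le> (\<Sum>k. ?f k x)" .
    qed
    also have "\<dots> = (\<Sum>k. \<integral>\<^sup>+x. ?f k x \<partial>lborel)" by (rule nn_integral_suminf) measurable
    also have "\<dots> \<le> (\<Sum>k. ennreal ((1/2) ^ k * a))"
    proof (intro suminf_le)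
      fix k
      have "(\<integral>\<^sup>+x. ?f k x \<partial>lborel) = ennreal (c k) * (\<integral>\<^sup>+x. ennreal (\<bar>h x\<bar> * indicator (ball z (real k + 1)) x) \<partial>lborel)"
        by (rule nn_integral_cmult) measurable
      also have "\<dots> \<le> ennreal (c k) * ennreal (C k * a)" by (intro mult_left_mono h) simp
      also have "\<dots> = ennreal (c k * (C k * a))" using c[of k] C[of k] a by (simp add: ennreal_mult)
      also have "\<dots> \<le> ennreal ((1/2) ^ k * a)"
      proof (rule ennreal_leI)
        have "c k * C k = (C k / (C k + 1)) * (1/2) ^ k" by (simp add: c_def power_one_over divide_simps)
        also have "\<dots> \<le> 1 * (1/2) ^ k" using C[of k] by (intro mult_right_mono) auto
        finally have "c k * C k \<le> (1/2) ^ k" by simp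
        from mult_right_mono[OF this a] show "c k * (C k * a) \<le> (1/2) ^ k * a" by (simp add: mult.assoc)
      qed
      finally show "(\<integral>\<^sup>+x. ?f k x \<partial>lborel) \<le> ennreal ((1/2) ^ k * a)" .
    qed auto
    also have "\<dots> = ennreal (2 * a)"
      using a sums_mult2[OF geometric_sums[of "1/2::real"], of a] by (intro suminf_ennreal_eq) auto
    finally show ?thesis .
  qed
  have int: "integrable lborel (\<lambda>x. w x *\<^sub>R h x)" "(\<integral>x. norm (w x *\<^sub>R h x) \<partial>lborel) \<le> 2 * a"
    if [measurable]: "h \<in> borel_measurable borel" and a: "0 \<le> a"
      and h: "\<And>k. (\<integral>\<^sup>+x. ennreal (\<bar>h x\<bar> * indicator (ball z (real k + 1)) x) \<partial>lborel) \<le> ennreal (C k * a)" for h a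
  proof -
    have eq: "\<bar>w x * h x\<bar> = w x * \<bar>h x\<bar>" for x using w[of x] by (simp add: abs_mult)
    show i: "integrable lborel (\<lambda>x. w x *\<^sub>R h x)"
      by (rule integrableI_bounded) (use W[OF that] in \<open>auto simp: eq le_less_trans\<close>)
    have "ennreal (\<integral>x. norm (w x *\<^sub>R h x) \<partial>lborel) \<le> ennreal (2 * a)"
      using W[OF that] nn_integral_eq_integral[OF integrable_norm[OF i]] by (simp add: eq less_imp_le[OF w])
    then show "(\<integral>x. norm (w x *\<^sub>R h x) \<partial>lborel) \<le> 2 * a" using a by (simp add: ennreal_le_iff)
  qed
  obtain r where r: "strict_mono r" "AE x in lborel. Cauchy (\<lambda>i. w x *\<^sub>R \<psi> (r i) x)"
  proof (rule cauchy_L1_AE_cauchy_subseq[of lborel "\<lambda>n x. w x *\<^sub>R \<psi> n x"])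
    show "integrable lborel (\<lambda>x. w x *\<^sub>R \<psi> n x)" for n by (rule int[OF _ d(2) bd0]) measurable
    fix \<delta> :: real assume "\<delta> > 0"
    then obtain N where N: "\<And>m n. m \<ge> N \<Longrightarrow> n \<ge> N \<Longrightarrow> d m n < \<delta> / 2" using d(3)[of "\<delta> / 2"] by auto
    have "(LINT x|lborel. norm (w x *\<^sub>R \<psi> i x - w x *\<^sub>R \<psi> j x)) < \<delta>" if "i \<ge> N" "j \<ge> N" for i j
    proof -
      have "(LINT x|lborel. norm (w x *\<^sub>R (\<psi> i x - \<psi> j x))) \<le> 2 * d i j"
        by (rule int(2)[OF _ d(1) bd]) measurable
      then show ?thesis using N[OF that] by (simp add: right_diff_distrib)
    qed
    then show "\<exists>N. \<forall>i\<ge>N. \<forall>j\<ge>N. (LINT x|lborel. norm (w x *\<^sub>R \<psi> i x - w x *\<^sub>R \<psi> j x)) < \<delta>" by blast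
  qed blast
  define u where "u x = lim (\<lambda>i. \<psi> (r i) x)" for x
  have [measurable]: "u \<in> borel_measurable borel" unfolding u_def by measurable
  have lim: "AE x in lborel. (\<lambda>i. \<psi> (r i) x) \<longlonglongrightarrow> u x"
    using r(2)
  proof eventually_elim
    case (elim x)
    have "w x \<noteq> 0" using w[of x] by simp
    with elim have "Cauchy (\<lambda>i. \<psi> (r i) x)" by (rule Cauchy_scaleR_cancel)
    then have "convergent (\<lambda>i. \<psi> (r i) x)" by (rule Cauchy_convergent)
    then show ?case unfolding u_def by (rule convergent_LIMSEQ_iff[THEN iffD1])
  qed
  show ?thesis
  proof (rule that[of u])
    fix k
    let ?B = "indicator (ball z (real k + 1)) :: _ \<Rightarrow> real"
    have main: "(\<integral>\<^sup>+x. ennreal (norm (\<psi> n x * ?B x - u x * ?B x) ^ 1) \<partial>lborel) \<le> ennreal (C k * \<delta>)"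
      if N: "\<And>m n. m \<ge> N \<Longrightarrow> n \<ge> N \<Longrightarrow> d m n < \<delta>" and n: "n \<ge> N" for n N \<delta>
    proof (rule nn_integral_limit_le[where g="\<lambda>n x. \<psi> n x * ?B x" and r=r and N=N])
      show "AE x in lborel. (\<lambda>i. \<psi> (r i) x * ?B x) \<longlonglongrightarrow> u x * ?B x"
        using lim by eventually_elim (intro tendsto_intros)
      fix i assume "i \<ge> N"
      then have ri: "r i \<ge> N" using seq_suble[OF r(1), of i] by simp
      have "(\<integral>\<^sup>+x. ennreal (norm (\<psi> n x * ?B x - \<psi> (r i) x * ?B x) ^ 1) \<partial>lborel)
          = (\<integral>\<^sup>+x. ennreal (\<bar>\<psi> n x - \<psi> (r i) x\<bar> * ?B x) \<partial>lborel)"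
        by (intro nn_integral_cong) (auto simp: indicator_def)
      also have "\<dots> \<le> ennreal (C k * d n (r i))" by (rule bd)
      also have "\<dots> \<le> ennreal (C k * \<delta>)" using N[OF n ri] C[of k] by (intro ennreal_leI mult_left_mono) auto
      finally show "(\<integral>\<^sup>+x. ennreal (norm (\<psi> n x * ?B x - \<psi> (r i) x * ?B x) ^ 1) \<partial>lborel) \<le> ennreal (C k * \<delta>)" .
    qed measurable
    show "(\<lambda>n. \<integral>\<^sup>+x. ennreal (\<bar>\<psi> n x - u x\<bar> * ?B x) \<partial>lborel) \<longlonglongrightarrow> 0"
    proof (rule tendsto_0_if_eventually_le)
      fix \<epsilon> :: real assume "\<epsilon> > 0"
      then have "\<epsilon> / (C k + 1) > 0" using C[of k] by simp
      from d(3)[OF this] obtain N where N: "\<And>m n. m \<ge> N \<Longrightarrow> n \<ge> N \<Longrightarrow> d m n < \<epsilon> / (C k + 1)" by blast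
      have "(\<integral>\<^sup>+x. ennreal (\<bar>\<psi> n x - u x\<bar> * ?B x) \<partial>lborel) \<le> ennreal \<epsilon>" if "n \<ge> N" for n
      proof -
        have "(\<integral>\<^sup>+x. ennreal (\<bar>\<psi> n x - u x\<bar> * ?B x) \<partial>lborel) = (\<integral>\<^sup>+x. ennreal (norm (\<psi> n x * ?B x - u x * ?B x) ^ 1) \<partial>lborel)"
          by (intro nn_integral_cong) (auto simp: indicator_def)
        also have "\<dots> \<le> ennreal (C k * (\<epsilon> / (C k + 1)))" by (rule main[OF N that])
        also have "\<dots> \<le> ennreal \<epsilon>" using C[of k] \<open>\<epsilon> > 0\<close> by (intro ennreal_leI) (simp add: divide_simps)
        finally show ?thesis .
      qed
      then show "\<exists>N. \<forall>n\<ge>N. (\<integral>\<^sup>+x. ennreal (\<bar>\<psi> n x - u x\<bar> * ?B x) \<partial>lborel) \<le> ennreal \<epsilon>" by blast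
    qed
  qed measurable
qed

section \<open>Weak solutions\<close>

lemma norm2_triangle:
  assumes f: "sq_int M f" and g: "sq_int M g"
  shows "norm2 M (\<lambda>x. f x + g x) \<le> norm2 M f + norm2 M g"
proof (rule power2_le_imp_le)
  have "(norm2 M (\<lambda>x. f x + 1 *\<^sub>R g x))\<^sup>2 = (norm2 M f)\<^sup>2 + 2 * 1 * (\<integral>x. f x \<bullet> g x \<partial>M) + 1\<^sup>2 * (norm2 M g)\<^sup>2"
    unfolding norm2_power2 by (rule integral_sq_add_scaleR[OF f g])
  also have "\<dots> \<le> (norm2 M f + norm2 M g)\<^sup>2"
    using integral_inner_le_norm2[OF f g] by (simp add: power2_sum)
  finally show "(norm2 M (\<lambda>x. f x + g x))\<^sup>2 \<le> (norm2 M f + norm2 M g)\<^sup>2" by simp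
qed simp

lemma norm2_minus: "norm2 M (\<lambda>x. f x - g x) = norm2 M (\<lambda>x. g x - f x)"
  by (simp add: norm2_def norm_minus_commute)

lemma norm2_diff_triangle:
  assumes "sq_int M f" "sq_int M g" "sq_int M h"
  shows "norm2 M (\<lambda>x. f x - h x) \<le> norm2 M (\<lambda>x. f x - g x) + norm2 M (\<lambda>x. g x - h x)"
  using norm2_triangle[OF sq_int_diff[OF assms(1,2)] sq_int_diff[OF assms(2,3)]] by simp

lemma Lp_norm_2:
  assumes "sq_int M g"
  shows "Lp_norm 2 M g = ennreal (norm2 M g)" "in_Lp 2 M g"
proof -
  have eq: "norm (g x) powr 2 = (norm (g x))\<^sup>2" for x
    by (cases "norm (g x) = 0") (auto simp: powr_numeral)
  have "(\<integral>\<^sup>+x. ennreal (norm (g x) powr 2) \<partial>M) = ennreal (\<integral>x. (norm (g x))\<^sup>2 \<partial>M)"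
    unfolding eq using assms by (intro nn_integral_eq_integral) (auto simp: sq_int_def)
  then show "Lp_norm 2 M g = ennreal (norm2 M g)"
    by (simp add: Lp_norm_def norm2_def powr_half_sqrt)
  then show "in_Lp 2 M g" using assms by (simp add: in_Lp_def sq_int_def)
qed

lemma Lp_norm_1:
  assumes "p = 1"
  shows "Lp_norm p M g = (\<integral>\<^sup>+x. ennreal (norm (g x)) \<partial>M)"
  using assms by (auto simp: Lp_norm_def Let_def less_top)

lemma sigma_finite_lebesgue_on:
  assumes "open (\<Omega> :: (real^'n) set)"
  shows "sigma_finite_measure (lebesgue_on \<Omega>)"
proof
  show "\<exists>A. countable A \<and> A \<subseteq> sets (lebesgue_on \<Omega>) \<and> \<Union> A = space (lebesgue_on \<Omega>) \<and>
    (\<forall>a\<in>A. emeasure (lebesgue_on \<Omega>) a \<noteq> \<infinity>)"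
  proof (intro exI conjI ballI)
    let ?A = "range (\<lambda>n::nat. \<Omega> \<inter> ball 0 (real n))"
    show "countable ?A" by simp
    show "?A \<subseteq> sets (lebesgue_on \<Omega>)" using assms by (auto simp: sets_restrict_space_iff)
    have "\<exists>n::nat. x \<in> ball 0 (real n)" for x :: "real^'n"
      using reals_Archimedean2[of "norm x"] by auto
    then show "\<Union> ?A = space (lebesgue_on \<Omega>)" by auto
    fix a assume "a \<in> ?A"
    then obtain n :: nat where a: "a = \<Omega> \<inter> ball 0 (real n)" by auto
    have "emeasure (lebesgue_on \<Omega>) a = emeasure lebesgue a"
      using assms by (subst emeasure_restrict_space) (auto simp: a)
    also have "\<dots> \<le> emeasure lebesgue (ball 0 (real n) :: (real^'n) set)" by (intro emeasure_mono) (auto simp: a)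
    also have "\<dots> < \<infinity>" using emeasure_lborel_ball_finite by (simp add: emeasure_completion)
    finally show "emeasure (lebesgue_on \<Omega>) a \<noteq> \<infinity>" by simp
  qed
qed

lemma tendsto_integral_inner:
  assumes H: "sq_int M H" and g: "\<And>n. sq_int M (g n)" and G: "sq_int M G"
    and lim: "(\<lambda>n. norm2 M (\<lambda>x. g n x - G x)) \<longlonglongrightarrow> 0"
  shows "(\<lambda>n. \<integral>x. H x \<bullet> g n x \<partial>M) \<longlonglongrightarrow> (\<integral>x. H x \<bullet> G x \<partial>M)"
proof -
  have "(\<lambda>n. (\<integral>x. H x \<bullet> g n x \<partial>M) - (\<integral>x. H x \<bullet> G x \<partial>M)) \<longlonglongrightarrow> 0"
  proof (rule Lim_null_comparison)
    show "(\<lambda>n. norm2 M H * norm2 M (\<lambda>x. g n x - G x)) \<longlonglongrightarrow> 0"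
      using tendsto_mult[OF tendsto_const lim, of "norm2 M H"] by simp
    have "norm ((\<integral>x. H x \<bullet> g n x \<partial>M) - (\<integral>x. H x \<bullet> G x \<partial>M)) \<le> norm2 M H * norm2 M (\<lambda>x. g n x - G x)" for n
    proof -
      have "(\<integral>x. H x \<bullet> g n x \<partial>M) - (\<integral>x. H x \<bullet> G x \<partial>M) = (\<integral>x. H x \<bullet> (g n x - G x) \<partial>M)"
        using integrable_inner_sq_int[OF H g] integrable_inner_sq_int[OF H G] by (simp add: inner_diff_right)
      then show ?thesis using integral_inner_le_norm2[OF H sq_int_diff[OF g G], of n] by simp
    qed
    then show "\<forall>\<^sub>F n in sequentially. norm ((\<integral>x. H x \<bullet> g n x \<partial>M) - (\<integral>x. H x \<bullet> G x \<partial>M)) \<le> norm2 M H * norm2 M (\<lambda>x. g n x - G x)"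
      by simp
  qed
  then show ?thesis by (rule LIM_zero_cancel)
qed

lemma norm2_grad_test:
  assumes "open \<Omega>" "f \<in> test_functions \<Omega>"
  shows "norm2 (lebesgue_on \<Omega>) (grad f) = norm2 lborel (grad f)"
  using assms sq_int_grad_test[OF assms(2)]
  by (intro norm2_lebesgue_on) (auto simp: sq_int_def dest: test_functionsD(4))

text \<open>The variational problem is solved in the space of gradients of test functions. Because
  the domain misses a ball, the Friedrichs inequality converts convergence of gradients into local
  L1 convergence of the functions, which \<open>W012\<close> demands. The approximating sequence is
  part of the conclusion so that a solution can later be tested with itself.\<close>

lemma weak_solution_exists:
  fixes \<Omega> :: "(real^'n) set"
  assumes \<Omega>: "open \<Omega>" and r: "0 < r" "\<Omega> \<inter> ball z r = {}" and F: "sq_int (lebesgue_on \<Omega>) F"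
  obtains u G \<psi> where "weak_solution \<Omega> F u G" "sq_int (lebesgue_on \<Omega>) G" "\<And>n::nat. \<psi> n \<in> test_functions \<Omega>"
    "(\<lambda>n. norm2 (lebesgue_on \<Omega>) (\<lambda>x. grad (\<psi> n) x - G x)) \<longlonglongrightarrow> 0"
proof -
  let ?M = "lebesgue_on \<Omega>"
  define S where "S = grad ` test_functions \<Omega>"
  have sqT: "sq_int ?M (grad f)" if "f \<in> test_functions \<Omega>" for f
    using sq_int_lebesgue_on[OF \<Omega> sq_int_grad_test[OF that]] .
  obtain g G where g: "\<And>n::nat. g n \<in> S" and G: "sq_int ?M G" "(\<lambda>n. norm2 ?M (\<lambda>x. g n x - G x)) \<longlonglongrightarrow> 0"
    "\<And>h. h \<in> S \<Longrightarrow> (\<integral>x. G x \<bullet> h x \<partial>?M) = - (\<integral>x. F x \<bullet> h x \<partial>?M)"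
  proof (rule L2_variational_solution[OF sigma_finite_lebesgue_on[OF \<Omega>] _ _ _ F, of S])
    have "grad (\<lambda>x. 0) = (\<lambda>x::real^'n. 0)" by (intro ext grad_eqI) simp
    then show "(\<lambda>x. 0) \<in> S" unfolding S_def using zero_test_function by (metis image_eqI)
    show "(\<lambda>x. g x + t *\<^sub>R h x) \<in> S" if "g \<in> S" "h \<in> S" for g h t
    proof -
      from that obtain f k where fk: "f \<in> test_functions \<Omega>" "g = grad f" "k \<in> test_functions \<Omega>" "h = grad k"
        by (auto simp: S_def)
      have "grad (\<lambda>x. f x + t * k x) = (\<lambda>x. g x + t *\<^sub>R h x)"
        using grad_add_scale[OF test_functionsD(1)[OF fk(1)] test_functionsD(1)[OF fk(3)], of t]
        by (simp add: fk fun_eq_iff)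
      then show ?thesis unfolding S_def using test_functions_add_scale[OF fk(1,3), of t] by (metis image_eqI)
    qed
    show "sq_int ?M g" if "g \<in> S" for g using that sqT by (auto simp: S_def)
  qed blast
  obtain \<psi> where \<psi>: "\<And>n. \<psi> n \<in> test_functions \<Omega>" "\<And>n. g n = grad (\<psi> n)"
    using g unfolding S_def image_iff by metis
  define d where "d m n = norm2 ?M (\<lambda>x. g m x - g n x)" for m n
  have dd: "grad (\<lambda>x. \<psi> m x - \<psi> n x) = (\<lambda>x. g m x - g n x)" for m n
    using grad_add_scale[OF test_functionsD(1)[OF \<psi>(1)] test_functionsD(1)[OF \<psi>(1)], of m "-1" n]
    by (simp add: \<psi>(2) fun_eq_iff)
  have td: "(\<lambda>x. \<psi> m x - \<psi> n x) \<in> test_functions \<Omega>" for m n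
    using test_functions_add_scale[OF \<psi>(1) \<psi>(1), of m "-1" n] by simp
  \<comment> \<open>The radius is capped at 1 so that the small ball lies in the ball of radius k +
    1 for every \<open>k\<close>, including 0.\<close>
  define r' where "r' = min r 1"
  have "\<exists>C. \<forall>k. 0 \<le> C k \<and> (\<forall>f. class_C (Suc 0) f \<and> (\<forall>x\<in>ball z r'. f x = 0) \<and> sq_int lborel (grad f)
    \<longrightarrow> (\<integral>\<^sup>+x. ennreal (\<bar>f x\<bar> * indicator (ball z (real k + 1)) x) \<partial>lborel) \<le> ennreal (C k * norm2 lborel (grad f)))"
  proof (rule choice, rule allI)
    fix k :: nat
    have "0 < r'" "r' \<le> real k + 1" using r by (auto simp: r'_def)
    from friedrichs_L1[OF this, of z] show "\<exists>C. 0 \<le> C \<and> (\<forall>f. class_C (Suc 0) f \<and> (\<forall>x\<in>ball z r'. f x = 0) \<and> sq_int lborel (grad f)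
      \<longrightarrow> (\<integral>\<^sup>+x. ennreal (\<bar>f x\<bar> * indicator (ball z (real k + 1)) x) \<partial>lborel) \<le> ennreal (C * norm2 lborel (grad f)))"
      by auto
  qed
  then obtain C where C: "\<And>k::nat. 0 \<le> C k"
    "\<And>k f. class_C (Suc 0) f \<Longrightarrow> (\<forall>x\<in>ball z r'. f x = 0) \<Longrightarrow> sq_int lborel (grad f)
    \<Longrightarrow> (\<integral>\<^sup>+x. ennreal (\<bar>f x\<bar> * indicator (ball z (real k + 1)) x) \<partial>lborel) \<le> ennreal (C k * norm2 lborel (grad f))"
    by blast
  have CT: "(\<integral>\<^sup>+x. ennreal (\<bar>f x\<bar> * indicator (ball z (real k + 1)) x) \<partial>lborel) \<le> ennreal (C k * norm2 ?M (grad f))"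
    if f: "f \<in> test_functions \<Omega>" for f k
    unfolding norm2_grad_test[OF \<Omega> f]
  proof (rule C(2))
    have "x \<notin> \<Omega>" if "x \<in> ball z r'" for x using that r by (auto simp: r'_def)
    then show "\<forall>x\<in>ball z r'. f x = 0" using test_functionsD(3)[OF f] by blast
  qed (rule test_functionsD(1)[OF f] sq_int_grad_test[OF f])+
  obtain u where u: "u \<in> borel_measurable borel"
    "\<And>k. (\<lambda>n. \<integral>\<^sup>+x. ennreal (\<bar>\<psi> n x - u x\<bar> * indicator (ball z (real k + 1)) x) \<partial>lborel) \<longlonglongrightarrow> 0"
  proof (rule ex_L1_loc_limit[of \<psi> C z d "\<lambda>n. norm2 ?M (grad (\<psi> n))"])
    show "\<psi> n \<in> borel_measurable borel" for n
      by (rule borel_measurable_continuous_onI) (rule class_C_continuous[OF test_functionsD(1)[OF \<psi>(1)]])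
    show "0 \<le> C k" for k by (rule C)
    show "(\<integral>\<^sup>+x. ennreal (\<bar>\<psi> m x - \<psi> n x\<bar> * indicator (ball z (real k + 1)) x) \<partial>lborel) \<le> ennreal (C k * d m n)" for m n k
      using CT[OF td, of m n k] by (simp add: d_def dd)
    show "(\<integral>\<^sup>+x. ennreal (\<bar>\<psi> n x\<bar> * indicator (ball z (real k + 1)) x) \<partial>lborel) \<le> ennreal (C k * norm2 ?M (grad (\<psi> n)))" for n k
      by (rule CT[OF \<psi>(1)])
    fix \<delta> :: real assume "\<delta> > 0"
    then obtain N where N: "\<And>n. n \<ge> N \<Longrightarrow> norm2 ?M (\<lambda>x. g n x - G x) < \<delta> / 2"
      using LIMSEQ_D[OF G(2), of "\<delta> / 2"] by auto
    have "d m n < \<delta>" if "m \<ge> N" "n \<ge> N" for m n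
      using norm2_diff_triangle[OF sqT[OF \<psi>(1)] G(1) sqT[OF \<psi>(1)], of m n] N[OF that(1)] N[OF that(2)]
      by (simp add: d_def \<psi>(2) norm2_minus[of _ G])
    then show "\<exists>N. \<forall>m\<ge>N. \<forall>n\<ge>N. d m n < \<delta>" by blast
  qed (auto simp: d_def)
  have "W012 \<Omega> u G"
    unfolding W012_def
  proof (intro conjI exI allI impI)
    show "u \<in> borel_measurable (lebesgue_on \<Omega>)" by (rule borel_measurable_lebesgue_on_borel[OF u(1)])
    show "in_Lp 2 ?M G" by (rule Lp_norm_2[OF G(1)])
    show "\<psi> n \<in> test_functions \<Omega>" for n by (rule \<psi>)
    have "Lp_norm 2 ?M (\<lambda>x. grad (\<psi> n) x - G x) = ennreal (norm2 ?M (\<lambda>x. g n x - G x))" for n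
      using Lp_norm_2(1)[OF sq_int_diff[OF sqT[OF \<psi>(1)] G(1)], of n] by (simp add: \<psi>(2))
    then show "(\<lambda>n. Lp_norm 2 ?M (\<lambda>x. grad (\<psi> n) x - G x)) \<longlonglongrightarrow> 0"
      using tendsto_ennrealI[OF G(2)] by simp
    fix K assume "compact K \<and> K \<subseteq> \<Omega>"
    then have "bounded K" "K \<in> sets borel" by (auto simp: compact_imp_bounded compact_imp_closed)
    then obtain a where a: "K \<subseteq> ball z a" using bounded_subset_ballD by blast
    obtain k :: nat where "a < real k" using reals_Archimedean2 by blast
    then have K: "K \<subseteq> ball z (real k + 1)" using a by force
    show "(\<lambda>n. Lp_norm 1 (lebesgue_on K) (\<lambda>x. \<psi> n x - u x)) \<longlonglongrightarrow> 0"
    proof (rule tendsto_sandwich[OF _ _ tendsto_const u(2)[of k]])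
      have "Lp_norm 1 (lebesgue_on K) (\<lambda>x. \<psi> n x - u x) \<le> (\<integral>\<^sup>+x. ennreal (\<bar>\<psi> n x - u x\<bar> * indicator (ball z (real k + 1)) x) \<partial>lborel)" for n
      proof -
        have "Lp_norm 1 (lebesgue_on K) (\<lambda>x. \<psi> n x - u x) = (\<integral>\<^sup>+x. ennreal (norm (\<psi> n x - u x)) * indicator K x \<partial>lborel)"
          using \<open>K \<in> sets borel\<close> by (simp add: Lp_norm_1 nn_integral_restrict_space nn_integral_completion)
        also have "\<dots> \<le> (\<integral>\<^sup>+x. ennreal (\<bar>\<psi> n x - u x\<bar> * indicator (ball z (real k + 1)) x) \<partial>lborel)"
          using K by (intro nn_integral_mono) (auto simp: indicator_def)
        finally show ?thesis .
      qed
      then show "\<forall>\<^sub>F n in sequentially. Lp_norm 1 (lebesgue_on K) (\<lambda>x. \<psi> n x - u x) \<le> (\<integral>\<^sup>+x. ennreal (\<bar>\<psi> n x - u x\<bar> * indicator (ball z (real k + 1)) x) \<partial>lborel)"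
        by simp
    qed simp
  qed
  then have "weak_solution \<Omega> F u G" unfolding weak_solution_def using G(3) by (auto simp: S_def)
  from that[OF this G(1) \<psi>(1)] G(2) show ?thesis by (simp add: \<psi>(2))
qed

lemma Lp_norm_scaleR:
  assumes "0 < c" "0 < p" and [measurable]: "g \<in> borel_measurable M"
  shows "Lp_norm p M (\<lambda>x. c *\<^sub>R g x) = ennreal c * Lp_norm p M (g :: _ \<Rightarrow> 'b::euclidean_space)"
proof -
  let ?I = "\<integral>\<^sup>+x. ennreal (norm (g x) powr p) \<partial>M"
  have I: "(\<integral>\<^sup>+x. ennreal (norm (c *\<^sub>R g x) powr p) \<partial>M) = ennreal (c powr p) * ?I"
    using assms by (subst nn_integral_cmult[symmetric]) (auto intro!: nn_integral_cong simp: powr_mult ennreal_mult)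
  show ?thesis
  proof (cases "?I = \<infinity>")
    case True
    then show ?thesis unfolding Lp_norm_def I Let_def using assms by (simp add: ennreal_mult_top)
  next
    case False
    have "enn2real (ennreal (c powr p) * ?I) powr (1 / p) = c * enn2real ?I powr (1 / p)"
      using assms by (simp add: enn2real_mult powr_mult powr_powr)
    then show ?thesis unfolding Lp_norm_def I Let_def using assms False
      by (simp add: ennreal_mult ennreal_mult_eq_top_iff)
  qed
qed

text \<open>\<open>A_const\<close> admits only data of p-norm exactly 1; this is what allows a datum
  to be normalised.\<close>

lemma weak_solution_scaleR:
  fixes \<Omega> :: "(real^'n) set"
  assumes \<Omega>: "open \<Omega>" and w: "weak_solution \<Omega> F u G" and c: "0 < c" 
  shows "weak_solution \<Omega> (\<lambda>x. c *\<^sub>R F x) (\<lambda>x. c *\<^sub>R u x) (\<lambda>x. c *\<^sub>R G x)"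
proof -
  let ?M = "lebesgue_on \<Omega>"
  from w obtain \<psi> where m[measurable]: "u \<in> borel_measurable ?M" and G: "in_Lp 2 ?M G" and \<psi>: "\<And>n::nat. \<psi> n \<in> test_functions \<Omega>"
      "(\<lambda>n. Lp_norm 2 ?M (\<lambda>x. grad (\<psi> n) x - G x)) \<longlonglongrightarrow> 0"
      "\<And>K. compact K \<Longrightarrow> K \<subseteq> \<Omega> \<Longrightarrow> (\<lambda>n. Lp_norm 1 (lebesgue_on K) (\<lambda>x. \<psi> n x - u x)) \<longlonglongrightarrow> 0"
    unfolding weak_solution_def W012_def by blast
  have [measurable]: "G \<in> borel_measurable ?M" using G by (simp add: in_Lp_def)
  have t: "(\<lambda>x. c * \<psi> n x) \<in> test_functions \<Omega>" for n
    using test_functions_add_scale[OF zero_test_function \<psi>(1), of c n] by simp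
  have gt: "grad (\<lambda>x. c * \<psi> n x) x = c *\<^sub>R grad (\<psi> n) x" for n x
    using has_derivative_grad[of "\<psi> n" x] test_functionsD(1)[OF \<psi>(1), of "Suc 0" n]
    by (intro grad_eqI) (auto intro!: derivative_eq_intros)
  have gm[measurable]: "grad (\<psi> n) \<in> borel_measurable ?M" for n
    using sq_int_grad_test[OF \<psi>(1)] by (intro borel_measurable_lebesgue_on_borel) (auto simp: sq_int_def)
  have "W012 \<Omega> (\<lambda>x. c *\<^sub>R u x) (\<lambda>x. c *\<^sub>R G x)"
    unfolding W012_def
  proof (intro conjI exI[of _ "\<lambda>n x. c * \<psi> n x"] allI impI)
    show "(\<lambda>x. c *\<^sub>R u x) \<in> borel_measurable ?M" by measurable
    show "in_Lp 2 ?M (\<lambda>x. c *\<^sub>R G x)"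
      using G c by (auto simp: in_Lp_def Lp_norm_scaleR ennreal_mult_less_top)
    have "Lp_norm 2 ?M (\<lambda>x. grad (\<lambda>x. c * \<psi> n x) x - c *\<^sub>R G x) = ennreal c * Lp_norm 2 ?M (\<lambda>x. grad (\<psi> n) x - G x)" for n
      using c by (subst Lp_norm_scaleR[symmetric]) (auto simp: gt scaleR_diff_right)
    then show "(\<lambda>n. Lp_norm 2 ?M (\<lambda>x. grad (\<lambda>x. c * \<psi> n x) x - c *\<^sub>R G x)) \<longlonglongrightarrow> 0"
      using ennreal_tendsto_cmult[OF _ \<psi>(2), of "ennreal c"] by simp
    fix K assume K: "compact K \<and> K \<subseteq> \<Omega>"
    have [measurable]: "u \<in> borel_measurable (lebesgue_on K)"
      using K \<Omega> m by (intro measurable_restrict_mono[OF m]) auto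
    have [measurable]: "\<psi> n \<in> borel_measurable (lebesgue_on K)" for n
      by (intro borel_measurable_lebesgue_on_borel borel_measurable_continuous_onI)
        (rule class_C_continuous[OF test_functionsD(1)[OF \<psi>(1)]])
    have "Lp_norm 1 (lebesgue_on K) (\<lambda>x. c * \<psi> n x - c *\<^sub>R u x) = ennreal c * Lp_norm 1 (lebesgue_on K) (\<lambda>x. \<psi> n x - u x)" for n
      using c by (subst Lp_norm_scaleR[symmetric]) (auto simp: right_diff_distrib)
    then show "(\<lambda>n. Lp_norm 1 (lebesgue_on K) (\<lambda>x. c * \<psi> n x - c *\<^sub>R u x)) \<longlonglongrightarrow> 0"
      using ennreal_tendsto_cmult[OF _ \<psi>(3), of "ennreal c" K] K by simp
  qed (rule t)
  then show ?thesis using w by (simp add: weak_solution_def)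
qed

text \<open>Convexity: the power p lies above its tangent at \<open>t\<close>, with equality at
  \<open>x = t\<close>. It comes from Young's inequality for x/t and 1. With \<open>t\<close> free
  it can be integrated over a set of finite measure and optimised afterwards, which takes the place
  of Hoelder's inequality.\<close>

lemma young_tangent:
  fixes x t p :: real
  assumes "1 < p" "0 \<le> x" "0 < t"
  shows "x \<le> x powr p / (p * t powr (p - 1)) + (1 - 1 / p) * t"
proof -
  have "(x / t) * 1 \<le> (x / t) powr p / p + 1 powr (p / (p - 1)) / (p / (p - 1))"
    by (rule Youngs_inequality) (use assms in \<open>auto simp: field_simps\<close>)
  then have "x / t \<le> (x / t) powr p / p + (1 - 1 / p)" using assms by (simp add: field_simps)
  then have "x / t * t \<le> ((x / t) powr p / p + (1 - 1 / p)) * t" using assms by (intro mult_right_mono) auto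
  also have "\<dots> = x powr p / (p * (t powr p / t)) + (1 - 1 / p) * t"
    using assms by (simp add: powr_divide field_simps)
  also have "t powr p / t = t powr (p - 1)" using assms by (simp add: powr_diff)
  finally show ?thesis using assms by simp
qed

section \<open>Duality\<close>

text \<open>The choice t = b / m, the constant whose integral over a set of measure \<open>m\<close>
  is \<open>b\<close>, gives the Hoelder bound.\<close>

lemma powr_mean_lower_bound:
  fixes p b J m :: real
  assumes p: "1 < p" and b: "0 < b" and m: "0 < m"
    and le: "\<And>t. 0 < t \<Longrightarrow> b \<le> J / (p * t powr (p - 1)) + (1 - 1 / p) * t * m"
  shows "b * m powr (1 / p - 1) \<le> J powr (1 / p)"
proof -
  have "b \<le> J / (p * (b / m) powr (p - 1)) + (1 - 1 / p) * (b / m) * m" by (rule le) (use b m in simp)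
  also have "(1 - 1 / p) * (b / m) * m = b - b / p" using m by (simp add: field_simps)
  finally have "b / p \<le> (J / (b / m) powr (p - 1)) / p" by (simp add: mult.commute)
  then have "b \<le> J / (b / m) powr (p - 1)" using p divide_le_cancel[of b p "J / (b / m) powr (p - 1)"] by simp
  then have "b * (b / m) powr (p - 1) \<le> J" using b m by (simp add: pos_le_divide_eq)
  then have "(b * (b / m) powr (p - 1)) powr (1 / p) \<le> J powr (1 / p)"
    using b m p by (intro powr_mono2) auto
  also have "(b * (b / m) powr (p - 1)) powr (1 / p) = b * m powr (1 / p - 1)"
  proof -
    have "b * (b / m) powr (p - 1) = b powr p * m powr (1 - p)"
      using b m by (simp add: powr_divide powr_diff)
    then have "(b * (b / m) powr (p - 1)) powr (1 / p) = b * m powr ((1 - p) / p)"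
      using b m p by (simp add: powr_mult powr_powr)
    also have "(1 - p) / p = 1 / p - 1" using p by (simp add: field_simps)
    finally show ?thesis .
  qed
  finally show ?thesis .
qed

lemma mult_self_le_imp_le:
  fixes x e :: real
  assumes "x * x \<le> e * x" "0 \<le> x" "0 \<le> e"
  shows "x \<le> e"
  using assms by (cases "x = 0") (auto simp: mult_le_cancel_right)

text \<open>A quotient of two estimates: the p-norm of \<open>F\<close> is at most H1 m1^(1/p),
  while \<kappa> is at most H2 m2^(1-1/p) times the p-norm of \<open>G\<close>. Only sup bounds and
  measures of supports enter, so both concentrated and spread-out data are covered.\<close>

lemma A_const_ge_of_solution:
  fixes T :: "(real^'n) set" and \<epsilon> \<eta> :: real
  defines "M \<equiv> lebesgue_on (perforated_domain T \<epsilon> \<eta>)"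
  assumes \<Omega>: "open (perforated_domain T \<epsilon> \<eta>)" and p: "1 < p"
    and w: "weak_solution (perforated_domain T \<epsilon> \<eta>) F u G"
    and F: "sq_int M F" and G: "sq_int M G" and en: "(\<integral>x. G x \<bullet> G x \<partial>M) = - (\<integral>x. F x \<bullet> G x \<partial>M)"
    and h: "sq_int M h" and \<kappa>: "0 < \<kappa>" "\<kappa> \<le> \<bar>\<integral>x. h x \<bullet> G x \<partial>M\<bar>"
    and Fb: "\<And>x. norm (F x) \<le> H1 * indicator S1 x" and hb: "\<And>x. norm (h x) \<le> H2 * indicator S2 x"
    and [measurable]: "S1 \<in> sets borel" "S2 \<in> sets borel"
    and S1: "emeasure lborel S1 \<le> ennreal m1" and S2: "emeasure lborel S2 \<le> ennreal m2"
    and pos: "0 < H1" "0 < H2" "0 < m1" "0 < m2"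
  shows "A_const p T \<epsilon> \<eta> \<ge> ennreal (\<kappa> / (H1 * m1 powr (1 / p) * H2 * m2 powr (1 - 1 / p)))"
proof -
  let ?\<Omega> = "perforated_domain T \<epsilon> \<eta>"
  have [measurable]: "F \<in> borel_measurable M" "G \<in> borel_measurable M" "h \<in> borel_measurable M"
    using F G h by (auto simp: sq_int_def)
  have [measurable]: "S1 \<inter> ?\<Omega> \<in> sets M" "S2 \<inter> ?\<Omega> \<in> sets M"
    using \<Omega> unfolding M_def by (auto simp: sets_restrict_space_iff)
  have ind: "(\<integral>\<^sup>+x. ennreal (a * indicator S x) \<partial>M) \<le> ennreal (a * m)"
    if [measurable]: "S \<in> sets borel" and "emeasure lborel S \<le> ennreal m" "0 \<le> a" "0 \<le> m" for a S m
  proof -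
    have "(\<integral>\<^sup>+x. ennreal (a * indicator S x) \<partial>M) = (\<integral>\<^sup>+x. ennreal (a * indicator S x) * indicator ?\<Omega> x \<partial>lborel)"
      unfolding M_def by (rule nn_integral_lebesgue_on[OF \<Omega>])
    also have "\<dots> \<le> (\<integral>\<^sup>+x. ennreal a * indicator S x \<partial>lborel)"
      by (intro nn_integral_mono) (auto simp: indicator_def)
    also have "\<dots> = ennreal a * emeasure lborel S" by (rule nn_integral_cmult_indicator) simp
    also have "\<dots> \<le> ennreal a * ennreal m" using that by (intro mult_left_mono) auto
    also have "\<dots> = ennreal (a * m)" using that by (simp add: ennreal_mult)
    finally show ?thesis .
  qed
  define IF where "IF = (\<integral>\<^sup>+x. ennreal (norm (F x) powr p) \<partial>M)"
  have IF_le: "IF \<le> ennreal (H1 powr p * m1)"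
  proof -
    have "IF \<le> (\<integral>\<^sup>+x. ennreal (H1 powr p * indicator S1 x) \<partial>M)"
      unfolding IF_def
    proof (intro nn_integral_mono ennreal_leI)
      fix x
      show "norm (F x) powr p \<le> H1 powr p * indicator S1 x"
        using Fb[of x] p by (cases "x \<in> S1") (auto intro!: powr_mono2)
    qed
    also have "\<dots> \<le> ennreal (H1 powr p * m1)" using S1 pos by (intro ind) auto
    finally show ?thesis .
  qed
  then have IF_fin: "IF < \<infinity>" by (auto simp: le_less_trans)
  \<comment> \<open>Normalisation needs a nonzero datum. If \<open>F\<close> vanished almost
    everywhere, the energy identity would make the norm of \<open>G\<close> zero and the pairing
    with \<open>h\<close> could not reach \<kappa> > 0.\<close>
  have "IF \<noteq> 0"
  proof
    assume "IF = 0"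
    then have "AE x in M. F x = 0" unfolding IF_def by (subst (asm) nn_integral_0_iff_AE) auto
    then have "(\<integral>x. F x \<bullet> G x \<partial>M) = (\<integral>x. 0 \<partial>M)" by (intro integral_cong_AE) auto
    then have "norm2 M G * norm2 M G = 0" using en by (simp add: norm2_self)
    then have "\<bar>\<integral>x. h x \<bullet> G x \<partial>M\<bar> \<le> 0" using integral_inner_le_norm2[OF h G] by simp
    then show False using \<kappa> by simp
  qed
  define a where "a = enn2real IF powr (1 / p)"
  have IFp: "0 < enn2real IF" using \<open>IF \<noteq> 0\<close> IF_fin by (simp add: enn2real_positive_iff zero_less_iff_neq_zero less_top[symmetric])
  then have a: "0 < a" by (simp add: a_def)
  have LF: "Lp_norm p M F = ennreal a"
    using IF_fin by (simp add: Lp_norm_def IF_def[symmetric] a_def)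
  have a_le: "a \<le> H1 * m1 powr (1 / p)"
  proof -
    have "enn2real IF \<le> H1 powr p * m1" using IF_le pos by (intro enn2real_leI) auto
    then have "a \<le> (H1 powr p * m1) powr (1 / p)" unfolding a_def using p by (intro powr_mono2) auto
    also have "\<dots> = H1 * m1 powr (1 / p)" using pos p by (simp add: powr_mult powr_powr)
    finally show ?thesis .
  qed
  define B where "B = \<kappa> / H2 * m2 powr (1 / p - 1)"
  have B: "0 \<le> B" using \<kappa> pos by (simp add: B_def)
  have LG: "ennreal B \<le> Lp_norm p M G"
  proof (cases "(\<integral>\<^sup>+x. ennreal (norm (G x) powr p) \<partial>M) = \<infinity>")
    case True
    then show ?thesis by (simp add: Lp_norm_def)
  next
    case False
    then obtain J where J: "0 \<le> J" "(\<integral>\<^sup>+x. ennreal (norm (G x) powr p) \<partial>M) = ennreal J"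
      by (metis ennreal_cases infinity_ennreal_def)
    have "B \<le> J powr (1 / p)"
      unfolding B_def
    proof (rule powr_mean_lower_bound[OF p])
      fix t :: real assume t: "0 < t"
      have "ennreal \<kappa> \<le> ennreal (norm (\<integral>x. h x \<bullet> G x \<partial>M))" using \<kappa> by (simp add: ennreal_leI)
      also have "\<dots> \<le> (\<integral>\<^sup>+x. ennreal (norm (h x \<bullet> G x)) \<partial>M)"
        by (rule integral_norm_bound_ennreal[OF integrable_inner_sq_int[OF h G]])
      also have "\<dots> \<le> (\<integral>\<^sup>+x. ennreal (H2 / (p * t powr (p - 1))) * ennreal (norm (G x) powr p)
          + ennreal (H2 * ((1 - 1 / p) * t) * indicator S2 x) \<partial>M)"
      proof (rule nn_integral_mono)
        fix x
        have "norm (h x \<bullet> G x) \<le> norm (h x) * norm (G x)" using Cauchy_Schwarz_ineq2 by simp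
        also have "\<dots> \<le> (H2 * indicator S2 x) * (norm (G x) powr p / (p * t powr (p - 1)) + (1 - 1 / p) * t)"
          using hb[of x] young_tangent[OF p _ t, of "norm (G x)"] pos by (intro mult_mono) auto
        also have "\<dots> \<le> H2 / (p * t powr (p - 1)) * norm (G x) powr p + H2 * ((1 - 1 / p) * t) * indicator S2 x"
          using pos p t by (auto simp: indicator_def algebra_simps)
        finally show "ennreal (norm (h x \<bullet> G x)) \<le> ennreal (H2 / (p * t powr (p - 1))) * ennreal (norm (G x) powr p)
          + ennreal (H2 * ((1 - 1 / p) * t) * indicator S2 x)"
          using pos p t by (simp add: ennreal_mult[symmetric] ennreal_plus[symmetric] ennreal_leI del: ennreal_plus)
      qed
      also have "\<dots> = ennreal (H2 / (p * t powr (p - 1))) * ennreal J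
          + (\<integral>\<^sup>+x. ennreal (H2 * ((1 - 1 / p) * t) * indicator S2 x) \<partial>M)"
      proof -
        have [measurable]: "(\<lambda>x. ennreal (H2 * ((1 - 1 / p) * t) * indicator S2 x)) \<in> borel_measurable M"
          unfolding M_def by (intro borel_measurable_lebesgue_on_borel) measurable
        show ?thesis by (subst nn_integral_add) (auto simp: nn_integral_cmult J)
      qed
      also have "\<dots> \<le> ennreal (H2 / (p * t powr (p - 1))) * ennreal J + ennreal (H2 * ((1 - 1 / p) * t) * m2)"
        using S2 pos p t by (intro add_left_mono ind) auto
      also have "\<dots> = ennreal (H2 / (p * t powr (p - 1)) * J + H2 * ((1 - 1 / p) * t) * m2)"
      proof -
        have "ennreal a * ennreal J + ennreal c = ennreal (a * J + c)" if "0 \<le> a" "0 \<le> c" for a c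
          using that J by (simp add: ennreal_mult)
        then show ?thesis using pos p t by simp
      qed
      finally have "\<kappa> \<le> H2 / (p * t powr (p - 1)) * J + H2 * ((1 - 1 / p) * t) * m2"
        using pos p t J by (subst (asm) ennreal_le_iff) auto
      also have "\<dots> = (J / (p * t powr (p - 1)) + (1 - 1 / p) * t * m2) * H2" by (simp add: algebra_simps)
      finally show "\<kappa> / H2 \<le> J / (p * t powr (p - 1)) + (1 - 1 / p) * t * m2"
        using pos by (simp add: pos_divide_le_eq)
    qed (use \<kappa> pos in auto)
    then show ?thesis using J by (simp add: Lp_norm_def ennreal_leI)
  qed
  have "Lp_norm p M (\<lambda>x. (1 / a) *\<^sub>R G x) \<le> A_const p T \<epsilon> \<eta>"
    unfolding A_const_def Let_def
  proof (rule Sup_upper, rule CollectI, intro exI conjI)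
    show "weak_solution ?\<Omega> (\<lambda>x. (1 / a) *\<^sub>R F x) (\<lambda>x. (1 / a) *\<^sub>R u x) (\<lambda>x. (1 / a) *\<^sub>R G x)"
      by (rule weak_solution_scaleR[OF \<Omega> w]) (use a in simp)
    show "Lp_norm p M (\<lambda>x. (1 / a) *\<^sub>R G x) = Lp_norm p (lebesgue_on ?\<Omega>) (\<lambda>x. (1 / a) *\<^sub>R G x)"
      by (simp add: M_def)
    have L: "Lp_norm p M (\<lambda>x. (1 / a) *\<^sub>R F x) = 1"
      using a p by (subst Lp_norm_scaleR) (auto simp: LF ennreal_mult[symmetric])
    then show "Lp_norm p (lebesgue_on ?\<Omega>) (\<lambda>x. (1 / a) *\<^sub>R F x) = 1" by (simp add: M_def)
    have "in_Lp p M (\<lambda>x. (1 / a) *\<^sub>R F x)" unfolding in_Lp_def L by simp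
    then show "in_Lp p (lebesgue_on ?\<Omega>) (\<lambda>x. (1 / a) *\<^sub>R F x)" by (simp add: M_def)
    show "in_Lp 2 (lebesgue_on ?\<Omega>) (\<lambda>x. (1 / a) *\<^sub>R F x)"
      using Lp_norm_2(2)[OF sq_int_scaleR[OF F]] by (simp add: M_def)
  qed
  moreover have "ennreal (\<kappa> / (H1 * m1 powr (1 / p) * H2 * m2 powr (1 - 1 / p))) \<le> Lp_norm p M (\<lambda>x. (1 / a) *\<^sub>R G x)"
  proof -
    have "\<kappa> / (H1 * m1 powr (1 / p) * H2 * m2 powr (1 - 1 / p)) = B / (H1 * m1 powr (1 / p))"
      using pos by (simp add: B_def powr_diff field_simps)
    also have "\<dots> \<le> B / a" using a a_le B pos by (intro divide_left_mono) auto
    finally have "ennreal (\<kappa> / (H1 * m1 powr (1 / p) * H2 * m2 powr (1 - 1 / p))) \<le> ennreal (1 / a * B)"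
      by (intro ennreal_leI) simp
    also have "\<dots> = ennreal (1 / a) * ennreal B" using a B by (intro ennreal_mult) auto
    also have "\<dots> \<le> ennreal (1 / a) * Lp_norm p M G" by (intro mult_left_mono LG) simp
    also have "\<dots> = Lp_norm p M (\<lambda>x. (1 / a) *\<^sub>R G x)"
      using a p by (subst Lp_norm_scaleR) auto
    finally show ?thesis .
  qed
  ultimately show ?thesis by (rule order_trans[rotated])
qed

text \<open>For the first inequality the problem is solved with datum \<open>f\<close>: its solution is within \<open>E\<close> of \<open>\<phi>\<close>
  in energy, hence is detected by \<open>h\<close>. For the second it is solved with datum \<open>h\<close>; testing that
  solution against \<open>\<phi>\<close> shows that it is detected by \<open>f\<close>.\<close>

lemma A_const_ge_of_approximate_solution:
  fixes T :: "(real^'n) set"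
  assumes \<Omega>: "open (perforated_domain T \<epsilon> \<eta>)" and p: "1 < p"
    and r: "0 < r" "perforated_domain T \<epsilon> \<eta> \<inter> ball z r = {}"
    and \<phi>: "\<phi> \<in> test_functions (perforated_domain T \<epsilon> \<eta>)"
    and f: "sq_int lborel f" and h: "sq_int lborel h" and E: "0 \<le> E"
    and appr: "\<And>\<psi>. \<psi> \<in> test_functions (perforated_domain T \<epsilon> \<eta>) \<Longrightarrow>
      \<bar>\<integral>x. grad \<psi> x \<bullet> (grad \<phi> x + f x) \<partial>lborel\<bar> \<le> E * norm2 lborel (grad \<psi>)"
    and \<kappa>: "0 < \<kappa>" "\<kappa> + E * norm2 lborel h \<le> \<bar>\<integral>x. h x \<bullet> grad \<phi> x \<partial>lborel\<bar>"
    and fb: "\<And>x. norm (f x) \<le> H1 * indicator S1 x" and hb: "\<And>x. norm (h x) \<le> H2 * indicator S2 x"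
    and S: "S1 \<in> sets borel" "S2 \<in> sets borel"
      "emeasure lborel S1 \<le> ennreal m1" "emeasure lborel S2 \<le> ennreal m2"
    and pos: "0 < H1" "0 < H2" "0 < m1" "0 < m2"
  shows "A_const p T \<epsilon> \<eta> \<ge> ennreal (\<kappa> / (H1 * m1 powr (1 / p) * H2 * m2 powr (1 - 1 / p)))"
    "A_const p T \<epsilon> \<eta> \<ge> ennreal (\<kappa> / (H2 * m2 powr (1 / p) * H1 * m1 powr (1 - 1 / p)))"
proof -
  let ?\<Omega> = "perforated_domain T \<epsilon> \<eta>"
  let ?M = "lebesgue_on ?\<Omega>"
  have fM: "sq_int ?M f" and hM: "sq_int ?M h" using f h sq_int_lebesgue_on[OF \<Omega>] by auto
  have gT: "sq_int ?M (grad \<psi>)" if "\<psi> \<in> test_functions ?\<Omega>" for \<psi>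
    using sq_int_lebesgue_on[OF \<Omega> sq_int_grad_test[OF that]] .
  have tr: "(\<integral>x. k x \<bullet> grad \<psi> x \<partial>lborel) = (\<integral>x. k x \<bullet> grad \<psi> x \<partial>?M)"
    if "\<psi> \<in> test_functions ?\<Omega>" "sq_int lborel k" for \<psi> and k :: "real^'n \<Rightarrow> real^'n"
  proof -
    have [measurable]: "k \<in> borel_measurable borel" "grad \<psi> \<in> borel_measurable borel"
      using that sq_int_grad_test[OF that(1)] by (auto simp: sq_int_def)
    show ?thesis by (rule integral_lebesgue_on_eq(1)[OF \<Omega>, symmetric]) (use test_functionsD(4)[OF that(1)] in auto)
  qed
  have appr': "\<bar>(\<integral>x. grad \<phi> x \<bullet> grad \<psi> x \<partial>?M) + (\<integral>x. f x \<bullet> grad \<psi> x \<partial>?M)\<bar> \<le> E * norm2 ?M (grad \<psi>)"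
    if \<psi>: "\<psi> \<in> test_functions ?\<Omega>" for \<psi>
  proof -
    have "(\<integral>x. grad \<psi> x \<bullet> (grad \<phi> x + f x) \<partial>lborel)
        = (\<integral>x. grad \<phi> x \<bullet> grad \<psi> x \<partial>lborel) + (\<integral>x. f x \<bullet> grad \<psi> x \<partial>lborel)"
      using integrable_inner_sq_int[OF sq_int_grad_test[OF \<phi>] sq_int_grad_test[OF \<psi>]]
        integrable_inner_sq_int[OF f sq_int_grad_test[OF \<psi>]]
      by (simp add: inner_add_right inner_commute)
    then show ?thesis
      using appr[OF \<psi>] by (simp add: tr[OF \<psi> sq_int_grad_test[OF \<phi>]] tr[OF \<psi> f] norm2_grad_test[OF \<Omega> \<psi>])
  qed
  have \<kappa>': "\<kappa> + E * norm2 ?M h \<le> \<bar>\<integral>x. h x \<bullet> grad \<phi> x \<partial>?M\<bar>"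
    using \<kappa>(2) mult_left_mono[OF norm2_lebesgue_on_le[OF \<Omega> h] E] by (simp add: tr[OF \<phi> h])
  \<comment> \<open>By density the weak formulation passes to the limit along \<open>\<psi>\<close>,
    so that the solution may be tested with its own gradient.\<close>
  have energy: "(\<integral>x. G x \<bullet> G x \<partial>?M) = - (\<integral>x. F x \<bullet> G x \<partial>?M)"
    if w: "weak_solution ?\<Omega> F u G" and G: "sq_int ?M G" and F: "sq_int ?M F"
      and \<psi>: "\<And>n::nat. \<psi> n \<in> test_functions ?\<Omega>" "(\<lambda>n. norm2 ?M (\<lambda>x. grad (\<psi> n) x - G x)) \<longlonglongrightarrow> 0"
    for F u G \<psi>
  proof -
    have 1: "(\<lambda>n. \<integral>x. G x \<bullet> grad (\<psi> n) x \<partial>?M) \<longlonglongrightarrow> (\<integral>x. G x \<bullet> G x \<partial>?M)"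
      by (rule tendsto_integral_inner[OF G gT[OF \<psi>(1)] G \<psi>(2)])
    have 2: "(\<lambda>n. - (\<integral>x. F x \<bullet> grad (\<psi> n) x \<partial>?M)) \<longlonglongrightarrow> - (\<integral>x. F x \<bullet> G x \<partial>?M)"
      by (rule tendsto_minus[OF tendsto_integral_inner[OF F gT[OF \<psi>(1)] G \<psi>(2)]])
    have "(\<integral>x. G x \<bullet> grad (\<psi> n) x \<partial>?M) = - (\<integral>x. F x \<bullet> grad (\<psi> n) x \<partial>?M)" for n
      using w \<psi>(1)[of n] by (simp add: weak_solution_def)
    with 1 have "(\<lambda>n. - (\<integral>x. F x \<bullet> grad (\<psi> n) x \<partial>?M)) \<longlonglongrightarrow> (\<integral>x. G x \<bullet> G x \<partial>?M)" by simp
    then show ?thesis using 2 LIMSEQ_unique by blast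
  qed
  show "A_const p T \<epsilon> \<eta> \<ge> ennreal (\<kappa> / (H1 * m1 powr (1 / p) * H2 * m2 powr (1 - 1 / p)))"
  proof -
    obtain u G \<psi> where w: "weak_solution ?\<Omega> f u G" and G: "sq_int ?M G"
      and \<psi>: "\<And>n::nat. \<psi> n \<in> test_functions ?\<Omega>" "(\<lambda>n. norm2 ?M (\<lambda>x. grad (\<psi> n) x - G x)) \<longlonglongrightarrow> 0"
      by (rule weak_solution_exists[OF \<Omega> r fM]) (rule that)
    \<comment> \<open>The defect \<open>?D\<close> is tested with \<phi> - \<psi> n, whose gradient
      converges to it; in the limit its squared norm is at most \<open>E\<close> times its
      norm.\<close>
    let ?D = "\<lambda>x. grad \<phi> x - G x"
    have D: "sq_int ?M ?D" by (rule sq_int_diff[OF gT[OF \<phi>] G])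
    have b: "\<bar>\<integral>x. ?D x \<bullet> grad \<psi>' x \<partial>?M\<bar> \<le> E * norm2 ?M (grad \<psi>')" if \<psi>': "\<psi>' \<in> test_functions ?\<Omega>" for \<psi>'
    proof -
      have "(\<integral>x. G x \<bullet> grad \<psi>' x \<partial>?M) = - (\<integral>x. f x \<bullet> grad \<psi>' x \<partial>?M)"
        using w \<psi>' by (simp add: weak_solution_def)
      moreover have "(\<integral>x. ?D x \<bullet> grad \<psi>' x \<partial>?M) = (\<integral>x. grad \<phi> x \<bullet> grad \<psi>' x \<partial>?M) - (\<integral>x. G x \<bullet> grad \<psi>' x \<partial>?M)"
        using integrable_inner_sq_int[OF gT[OF \<phi>] gT[OF \<psi>']] integrable_inner_sq_int[OF G gT[OF \<psi>']]
        by (simp add: inner_diff_left)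
      ultimately show ?thesis using appr'[OF \<psi>'] by simp
    qed
    have t: "(\<lambda>x. \<phi> x - \<psi> n x) \<in> test_functions ?\<Omega>" for n
      using test_functions_add_scale[OF \<phi> \<psi>(1), of "-1" n] by simp
    have gt: "grad (\<lambda>x. \<phi> x - \<psi> n x) = (\<lambda>x. grad \<phi> x - grad (\<psi> n) x)" for n
      using grad_add_scale[OF test_functionsD(1)[OF \<phi>] test_functionsD(1)[OF \<psi>(1)], of "-1" n]
      by (simp add: fun_eq_iff)
    have lim: "(\<lambda>n. norm2 ?M (\<lambda>x. (grad \<phi> x - grad (\<psi> n) x) - ?D x)) \<longlonglongrightarrow> 0"
      using \<psi>(2) by (simp add: norm2_minus[of _ G])
    have l1: "(\<lambda>n. \<integral>x. ?D x \<bullet> (grad \<phi> x - grad (\<psi> n) x) \<partial>?M) \<longlonglongrightarrow> (\<integral>x. ?D x \<bullet> ?D x \<partial>?M)"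
      by (rule tendsto_integral_inner[OF D sq_int_diff[OF gT[OF \<phi>] gT[OF \<psi>(1)]] D lim])
    have l2: "(\<lambda>n. E * (norm2 ?M ?D + norm2 ?M (\<lambda>x. (grad \<phi> x - grad (\<psi> n) x) - ?D x))) \<longlonglongrightarrow> E * (norm2 ?M ?D + 0)"
      by (intro tendsto_intros lim)
    have "\<exists>N. \<forall>n\<ge>N. (\<integral>x. ?D x \<bullet> (grad \<phi> x - grad (\<psi> n) x) \<partial>?M) \<le> E * (norm2 ?M ?D + norm2 ?M (\<lambda>x. (grad \<phi> x - grad (\<psi> n) x) - ?D x))"
    proof (intro exI allI impI)
      fix n
      have "(\<integral>x. ?D x \<bullet> (grad \<phi> x - grad (\<psi> n) x) \<partial>?M) \<le> E * norm2 ?M (\<lambda>x. grad \<phi> x - grad (\<psi> n) x)"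
        using b[OF t, of n] by (simp add: gt)
      also have "norm2 ?M (\<lambda>x. grad \<phi> x - grad (\<psi> n) x) \<le> norm2 ?M ?D + norm2 ?M (\<lambda>x. (grad \<phi> x - grad (\<psi> n) x) - ?D x)"
        using norm2_triangle[OF D sq_int_diff[OF sq_int_diff[OF gT[OF \<phi>] gT[OF \<psi>(1)]] D], of n] by simp
      finally show "(\<integral>x. ?D x \<bullet> (grad \<phi> x - grad (\<psi> n) x) \<partial>?M) \<le> E * (norm2 ?M ?D + norm2 ?M (\<lambda>x. (grad \<phi> x - grad (\<psi> n) x) - ?D x))"
        using E by (simp add: mult_left_mono)
    qed
    from LIMSEQ_le[OF l1 l2 this] have "norm2 ?M ?D * norm2 ?M ?D \<le> E * norm2 ?M ?D"
      by (simp add: norm2_self)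
    then have D_le: "norm2 ?M ?D \<le> E"
      by (rule mult_self_le_imp_le) (use E in auto)
    have "(\<integral>x. h x \<bullet> ?D x \<partial>?M) = (\<integral>x. h x \<bullet> grad \<phi> x \<partial>?M) - (\<integral>x. h x \<bullet> G x \<partial>?M)"
      using integrable_inner_sq_int[OF hM gT[OF \<phi>]] integrable_inner_sq_int[OF hM G]
      by (simp add: inner_diff_right)
    moreover have "\<bar>\<integral>x. h x \<bullet> ?D x \<partial>?M\<bar> \<le> E * norm2 ?M h"
      using integral_inner_le_norm2[OF hM D] mult_left_mono[OF D_le norm2_nonneg[of ?M h]] by (simp add: mult.commute)
    ultimately have "\<kappa> \<le> \<bar>\<integral>x. h x \<bullet> G x \<partial>?M\<bar>" using \<kappa>' by linarith
    then show ?thesis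
      by (intro A_const_ge_of_solution[OF \<Omega> p w fM G energy[OF w G fM \<psi>] hM \<kappa>(1) _ fb hb S pos])
  qed
  show "A_const p T \<epsilon> \<eta> \<ge> ennreal (\<kappa> / (H2 * m2 powr (1 / p) * H1 * m1 powr (1 - 1 / p)))"
  proof -
    obtain u G \<psi> where w: "weak_solution ?\<Omega> h u G" and G: "sq_int ?M G"
      and \<psi>: "\<And>n::nat. \<psi> n \<in> test_functions ?\<Omega>" "(\<lambda>n. norm2 ?M (\<lambda>x. grad (\<psi> n) x - G x)) \<longlonglongrightarrow> 0"
      by (rule weak_solution_exists[OF \<Omega> r hM]) (rule that)
    have en: "(\<integral>x. G x \<bullet> G x \<partial>?M) = - (\<integral>x. h x \<bullet> G x \<partial>?M)" by (rule energy[OF w G hM \<psi>])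
    have "norm2 ?M G * norm2 ?M G \<le> norm2 ?M h * norm2 ?M G"
      using integral_inner_le_norm2[OF hM G] en by (simp add: norm2_self abs_le_iff)
    then have G_le: "norm2 ?M G \<le> norm2 ?M h"
      by (rule mult_self_le_imp_le) auto
    have l1: "(\<lambda>n. \<bar>(\<integral>x. grad \<phi> x \<bullet> grad (\<psi> n) x \<partial>?M) + (\<integral>x. f x \<bullet> grad (\<psi> n) x \<partial>?M)\<bar>)
        \<longlonglongrightarrow> \<bar>(\<integral>x. grad \<phi> x \<bullet> G x \<partial>?M) + (\<integral>x. f x \<bullet> G x \<partial>?M)\<bar>"
      by (intro tendsto_intros tendsto_integral_inner[OF _ gT[OF \<psi>(1)] G \<psi>(2)] gT[OF \<phi>] fM)
    have l2: "(\<lambda>n. E * (norm2 ?M G + norm2 ?M (\<lambda>x. grad (\<psi> n) x - G x))) \<longlonglongrightarrow> E * (norm2 ?M G + 0)"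
      by (intro tendsto_intros \<psi>(2))
    have "\<exists>N. \<forall>n\<ge>N. \<bar>(\<integral>x. grad \<phi> x \<bullet> grad (\<psi> n) x \<partial>?M) + (\<integral>x. f x \<bullet> grad (\<psi> n) x \<partial>?M)\<bar>
        \<le> E * (norm2 ?M G + norm2 ?M (\<lambda>x. grad (\<psi> n) x - G x))"
    proof (intro exI allI impI)
      fix n
      have "norm2 ?M (grad (\<psi> n)) \<le> norm2 ?M G + norm2 ?M (\<lambda>x. grad (\<psi> n) x - G x)"
        using norm2_triangle[OF G sq_int_diff[OF gT[OF \<psi>(1)] G], of n] by simp
      from order_trans[OF appr'[OF \<psi>(1)] mult_left_mono[OF this E]]
      show "\<bar>(\<integral>x. grad \<phi> x \<bullet> grad (\<psi> n) x \<partial>?M) + (\<integral>x. f x \<bullet> grad (\<psi> n) x \<partial>?M)\<bar>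
        \<le> E * (norm2 ?M G + norm2 ?M (\<lambda>x. grad (\<psi> n) x - G x))" .
    qed
    from LIMSEQ_le[OF l1 l2 this]
    have 1: "\<bar>(\<integral>x. grad \<phi> x \<bullet> G x \<partial>?M) + (\<integral>x. f x \<bullet> G x \<partial>?M)\<bar> \<le> E * norm2 ?M G" by simp
    \<comment> \<open>Here the symmetry of the Dirichlet form exchanges the roles of the two data:
      the pairing of \<open>h\<close> with grad \<phi> turns into that of \<open>f\<close> with
      \<open>G\<close>, up to \<open>E\<close> times the norm of \<open>G\<close>.\<close>
    have "(\<integral>x. G x \<bullet> grad \<phi> x \<partial>?M) = - (\<integral>x. h x \<bullet> grad \<phi> x \<partial>?M)"
      using w \<phi> by (simp add: weak_solution_def)
    then have 2: "(\<integral>x. grad \<phi> x \<bullet> G x \<partial>?M) = - (\<integral>x. h x \<bullet> grad \<phi> x \<partial>?M)" by (simp add: inner_commute)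
    have "\<kappa> \<le> \<bar>\<integral>x. f x \<bullet> G x \<partial>?M\<bar>"
      using 1 2 \<kappa>' mult_left_mono[OF G_le E] by linarith
    then show ?thesis
      by (intro A_const_ge_of_solution[OF \<Omega> p w hM G en fM \<kappa>(1) _ hb fb S(2,1,4,3) pos(2,1,4,3)])
  qed
qed

section \<open>Scaling and the geometry of the hole\<close>

lemma lborel_integral_scale:
  fixes f :: "'a::euclidean_space \<Rightarrow> 'b::{banach, second_countable_topology}"
  assumes [measurable]: "f \<in> borel_measurable borel" and c: "0 < c"
  shows "integral\<^sup>L lborel f = (c ^ DIM('a)) *\<^sub>R (\<integral>x. f (c *\<^sub>R x) \<partial>lborel)"
    "integrable lborel f \<longleftrightarrow> integrable lborel (\<lambda>x. f (c *\<^sub>R x))"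
proof -
  have eq: "lborel = density (distr lborel borel (\<lambda>x::'a. c *\<^sub>R x)) (\<lambda>_. ennreal (c ^ DIM('a)))"
    using lborel_affine[of c "0::'a"] c by simp
  show "integral\<^sup>L lborel f = (c ^ DIM('a)) *\<^sub>R (\<integral>x. f (c *\<^sub>R x) \<partial>lborel)"
    by (subst eq) (use c in \<open>simp add: integral_density integral_distr\<close>)
  show "integrable lborel f \<longleftrightarrow> integrable lborel (\<lambda>x. f (c *\<^sub>R x))"
  proof -
    have "integrable lborel f \<longleftrightarrow> integrable lborel (\<lambda>x. (c ^ DIM('a)) *\<^sub>R f (c *\<^sub>R x))"
      by (subst eq) (use c in \<open>simp add: integrable_density integrable_distr_eq\<close>)
    also have "\<dots> \<longleftrightarrow> integrable lborel (\<lambda>x. f (c *\<^sub>R x))"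
      using integrable_scaleR_right[of "1 / c ^ DIM('a)" lborel "\<lambda>x. (c ^ DIM('a)) *\<^sub>R f (c *\<^sub>R x)"] c by auto
    finally show ?thesis .
  qed
qed

lemma grad_scale:
  fixes f :: "real^'n \<Rightarrow> real"
  assumes "class_C (Suc 0) f" "r \<noteq> 0"
  shows "grad (\<lambda>x. (1 / r) * f (r *\<^sub>R x)) x = grad f (r *\<^sub>R x)"
proof (rule grad_eqI)
  have "((\<lambda>x. f (r *\<^sub>R x)) has_derivative (\<lambda>h. grad f (r *\<^sub>R x) \<bullet> (r *\<^sub>R h))) (at x)"
    using has_derivative_compose[OF bounded_linear_imp_has_derivative[OF bounded_linear_scaleR_right]
          class_C_SucD(1)[OF assms(1)]] .
  then show "((\<lambda>x. (1 / r) * f (r *\<^sub>R x)) has_derivative (\<lambda>h. grad f (r *\<^sub>R x) \<bullet> h)) (at x)"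
    by (auto intro!: derivative_eq_intros simp: assms(2))
qed

lemma test_functions_scale:
  assumes f: "f \<in> test_functions \<Omega>" and r: "r \<noteq> 0"
  shows "(\<lambda>x. c * f (r *\<^sub>R x)) \<in> test_functions {x. r *\<^sub>R x \<in> \<Omega>}"
proof -
  let ?C = "closure {x. f x \<noteq> 0}"
  have C: "compact ?C" "?C \<subseteq> \<Omega>" using f by (auto simp: test_functions_def)
  have eq: "{x. r *\<^sub>R x \<in> ?C} = (\<lambda>y. (1 / r) *\<^sub>R y) ` ?C"
  proof (intro set_eqI iffI)
    fix x assume "x \<in> {x. r *\<^sub>R x \<in> ?C}"
    then show "x \<in> (\<lambda>y. (1 / r) *\<^sub>R y) ` ?C" using r by (intro image_eqI[of _ _ "r *\<^sub>R x"]) auto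
  qed (use r in auto)
  have comp: "compact {x. r *\<^sub>R x \<in> ?C}" unfolding eq by (rule compact_scaling[OF C(1)])
  have "{x. c * f (r *\<^sub>R x) \<noteq> 0} \<subseteq> {x. r *\<^sub>R x \<in> ?C}" using closure_subset[of "{x. f x \<noteq> 0}"] by auto
  then have sub0: "{x. c * f (r *\<^sub>R x) \<noteq> 0} \<subseteq> {x. r *\<^sub>R x \<in> ?C}" .
  then have sub: "closure {x. c * f (r *\<^sub>R x) \<noteq> 0} \<subseteq> {x. r *\<^sub>R x \<in> ?C}"
    by (rule closure_minimal) (rule compact_imp_closed[OF comp])
  have "compact (closure {x. c * f (r *\<^sub>R x) \<noteq> 0})"
    using bounded_subset[OF compact_imp_bounded[OF comp] sub0] by (simp add: compact_closure)
  then show ?thesis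
    using sub C f by (auto simp: test_functions_def intro!: class_C_mult class_C_const class_C_scale)
qed

lemma mem_perforated_domain_scale:
  assumes "0 < \<epsilon>"
  shows "x \<in> perforated_domain T \<epsilon> \<eta> \<longleftrightarrow> (1 / \<epsilon>) *\<^sub>R x \<in> perforated_domain T 1 \<eta>"
proof -
  have "x = \<epsilon> *\<^sub>R y \<longleftrightarrow> (1 / \<epsilon>) *\<^sub>R x = 1 *\<^sub>R y" for y using assms by auto
  then show ?thesis unfolding perforated_domain_def by (simp add: image_iff)
qed

lemma closed_int_lattice: "closed {k::real^'n. \<forall>i. k $ i \<in> \<int>}"
proof -
  have "{k::real^'n. \<forall>i. k $ i \<in> \<int>} = (\<Inter>i. (\<lambda>k. k $ i) -` \<int>)" by auto
  moreover have "closed ((\<lambda>k::real^'n. k $ i) -` \<int>)" for i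
    by (rule continuous_closed_vimage) (auto intro: closed_Ints)
  ultimately show ?thesis by (metis closed_INT)
qed

text \<open>Infinitely many holes are removed, but their union is the sum of the closed integer
  lattice and a compact set, hence closed. General \<open>\<epsilon>\<close> follows by taking a
  preimage.\<close>

lemma open_perforated_domain:
  assumes "compact T" "0 < \<epsilon>"
  shows "open (perforated_domain T \<epsilon> \<eta>)"
proof -
  have "compact ((\<lambda>x. \<eta> *\<^sub>R x) ` T)" by (rule compact_scaling[OF assms(1)])
  then have "closed (\<Union>x\<in>{k. \<forall>i. k $ i \<in> \<int>}. \<Union>y\<in>(\<lambda>x. \<eta> *\<^sub>R x) ` T. {x + y})"
    by (rule closed_compact_sums[OF closed_int_lattice])
  also have "(\<Union>x\<in>{k. \<forall>i. k $ i \<in> \<int>}. \<Union>y\<in>(\<lambda>x. \<eta> *\<^sub>R x) ` T. {x + y}) = - perforated_domain T 1 \<eta>"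
    unfolding perforated_domain_def by auto
  finally have "open (perforated_domain T 1 \<eta>)" by (simp add: closed_def)
  then have "open ((\<lambda>x. (1 / \<epsilon>) *\<^sub>R x) -` perforated_domain T 1 \<eta>)"
    by (rule open_vimage) (intro continuous_intros)
  moreover have "(\<lambda>x. (1 / \<epsilon>) *\<^sub>R x) -` perforated_domain T 1 \<eta> = perforated_domain T \<epsilon> \<eta>"
    by (intro set_eqI) (simp only: vimage_eq mem_perforated_domain_scale[OF assms(2), symmetric])
  ultimately show ?thesis by simp
qed

lemma perforated_domain_avoids_ball:
  fixes T :: "(real^'n) set"
  assumes "ball 0 c0 \<subseteq> T" "0 < \<epsilon>" "0 < \<eta>"
  shows "perforated_domain T \<epsilon> \<eta> \<inter> ball 0 (\<epsilon> * \<eta> * c0) = {}"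
proof -
  have "x \<notin> perforated_domain T \<epsilon> \<eta>" if "x \<in> ball 0 (\<epsilon> * \<eta> * c0)" for x
  proof -
    have "(1 / (\<epsilon> * \<eta>)) *\<^sub>R x \<in> T"
      using that assms by (intro subsetD[OF assms(1)]) (simp add: field_simps)
    then have "\<epsilon> *\<^sub>R (0 + \<eta> *\<^sub>R ((1 / (\<epsilon> * \<eta>)) *\<^sub>R x)) \<in> (\<lambda>x. \<epsilon> *\<^sub>R (0 + \<eta> *\<^sub>R x)) ` T" by (rule imageI)
    moreover have "\<epsilon> *\<^sub>R (0 + \<eta> *\<^sub>R ((1 / (\<epsilon> * \<eta>)) *\<^sub>R x)) = x" using assms by simp
    ultimately have "x \<in> (\<lambda>x. \<epsilon> *\<^sub>R (0 + \<eta> *\<^sub>R x)) ` T" by simp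
    moreover have "(0 :: real^'n) \<in> {k. \<forall>i. k $ i \<in> \<int>}" by simp
    ultimately show ?thesis unfolding perforated_domain_def by blast
  qed
  then show ?thesis by auto
qed

text \<open>Dilation reduces every \<open>\<epsilon>\<close> to 1 without changing the constant.
  Data and gradients are transported unchanged in size, integrals and measures acquire the factor e
  = \<epsilon>^d and L2 norms its square root, so \<open>E\<close> becomes sqrt e * E and \<kappa>
  becomes e * \<kappa>.\<close>

lemma A_const_ge_scaled:
  fixes T :: "(real^'n) set"
  assumes T: "compact T" "ball 0 c0 \<subseteq> T" "0 < c0" and \<eta>: "0 < \<eta>" and \<epsilon>: "0 < \<epsilon>" and p: "1 < p"
    and \<phi>: "\<phi> \<in> test_functions (perforated_domain T 1 \<eta>)"
    and f: "sq_int lborel f" and h: "sq_int lborel h" and E: "0 \<le> E"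
    and appr: "\<And>\<psi>. \<psi> \<in> test_functions (perforated_domain T 1 \<eta>) \<Longrightarrow>
      \<bar>\<integral>x. grad \<psi> x \<bullet> (grad \<phi> x + f x) \<partial>lborel\<bar> \<le> E * norm2 lborel (grad \<psi>)"
    and \<kappa>: "0 < \<kappa>" "\<kappa> + E * norm2 lborel h \<le> \<bar>\<integral>x. h x \<bullet> grad \<phi> x \<partial>lborel\<bar>"
    and fb: "\<And>x. norm (f x) \<le> H1 * indicator S1 x" and hb: "\<And>x. norm (h x) \<le> H2 * indicator S2 x"
    and S: "S1 \<in> sets borel" "S2 \<in> sets borel"
      "emeasure lborel S1 \<le> ennreal m1" "emeasure lborel S2 \<le> ennreal m2"
    and pos: "0 < H1" "0 < H2" "0 < m1" "0 < m2"
  shows "A_const p T \<epsilon> \<eta> \<ge> ennreal (\<kappa> / (H1 * m1 powr (1 / p) * H2 * m2 powr (1 - 1 / p)))"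
    "A_const p T \<epsilon> \<eta> \<ge> ennreal (\<kappa> / (H2 * m2 powr (1 / p) * H1 * m1 powr (1 - 1 / p)))"
proof -
  define e where "e = \<epsilon> ^ CARD('n)"
  have e: "0 < e" using \<epsilon> by (simp add: e_def)
  define \<phi>' where "\<phi>' x = \<epsilon> * \<phi> ((1 / \<epsilon>) *\<^sub>R x)" for x
  define f' where "f' x = f ((1 / \<epsilon>) *\<^sub>R x)" for x
  define h' where "h' x = h ((1 / \<epsilon>) *\<^sub>R x)" for x
  define S1' where "S1' = (\<lambda>x. (1 / \<epsilon>) *\<^sub>R x) -` S1"
  define S2' where "S2' = (\<lambda>x. (1 / \<epsilon>) *\<^sub>R x) -` S2"
  have \<Omega>: "{x. (1 / \<epsilon>) *\<^sub>R x \<in> perforated_domain T 1 \<eta>} = perforated_domain T \<epsilon> \<eta>"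
    by (intro set_eqI) (simp only: mem_Collect_eq mem_perforated_domain_scale[OF \<epsilon>, symmetric])
  have \<Omega>1: "{x. \<epsilon> *\<^sub>R x \<in> perforated_domain T \<epsilon> \<eta>} = perforated_domain T 1 \<eta>"
  proof (intro set_eqI)
    show "x \<in> {x. \<epsilon> *\<^sub>R x \<in> perforated_domain T \<epsilon> \<eta>} \<longleftrightarrow> x \<in> perforated_domain T 1 \<eta>" for x
      using mem_perforated_domain_scale[OF \<epsilon>, of "\<epsilon> *\<^sub>R x" T \<eta>] \<epsilon> by simp
  qed
  have \<phi>': "\<phi>' \<in> test_functions (perforated_domain T \<epsilon> \<eta>)"
    using test_functions_scale[OF \<phi>, of "1 / \<epsilon>" \<epsilon>] \<epsilon> unfolding \<Omega> \<phi>'_def by simp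
  have g\<phi>': "grad \<phi>' x = grad \<phi> ((1 / \<epsilon>) *\<^sub>R x)" for x
    using grad_scale[OF test_functionsD(1)[OF \<phi>], of "1 / \<epsilon>" x] \<epsilon> by (simp add: \<phi>'_def[abs_def])
  have meas: "(\<lambda>x. g ((1 / \<epsilon>) *\<^sub>R x)) \<in> borel_measurable borel" if [measurable]: "g \<in> borel_measurable borel" for g :: "real^'n \<Rightarrow> real^'n"
    by measurable
  have sq: "sq_int lborel (\<lambda>x. g ((1 / \<epsilon>) *\<^sub>R x))" "norm2 lborel (\<lambda>x. g ((1 / \<epsilon>) *\<^sub>R x)) = sqrt e * norm2 lborel g"
    if g: "sq_int lborel g" for g :: "real^'n \<Rightarrow> real^'n"
  proof -
    have [measurable]: "g \<in> borel_measurable borel" using g by (simp add: sq_int_def)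
    have "integrable lborel (\<lambda>x. (norm (g x))\<^sup>2)" using g by (simp add: sq_int_def)
    then have "integrable lborel (\<lambda>x. (norm (g ((1 / \<epsilon>) *\<^sub>R x)))\<^sup>2)"
      using lborel_integral_scale(2)[of "\<lambda>x. (norm (g x))\<^sup>2" "1 / \<epsilon>"] \<epsilon> by simp
    then show "sq_int lborel (\<lambda>x. g ((1 / \<epsilon>) *\<^sub>R x))" using meas[of g] by (simp add: sq_int_def)
    have "(\<integral>x. (norm (g ((1 / \<epsilon>) *\<^sub>R x)))\<^sup>2 \<partial>lborel) = e * (\<integral>x. (norm (g x))\<^sup>2 \<partial>lborel)"
      using lborel_integral_scale(1)[of "\<lambda>x. (norm (g ((1 / \<epsilon>) *\<^sub>R x)))\<^sup>2" \<epsilon>] \<epsilon> by (simp add: e_def)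
    then show "norm2 lborel (\<lambda>x. g ((1 / \<epsilon>) *\<^sub>R x)) = sqrt e * norm2 lborel g" by (simp add: norm2_def real_sqrt_mult)
  qed
  have [measurable]: "f \<in> borel_measurable borel" "h \<in> borel_measurable borel" using f h by (auto simp: sq_int_def)
  have gm[measurable]: "grad \<psi> \<in> borel_measurable borel" if "\<psi> \<in> test_functions \<Omega>'" for \<psi> \<Omega>'
    using sq_int_grad_test[OF that] by (simp add: sq_int_def)
  have [measurable]: "grad \<phi> \<in> borel_measurable borel" by (rule gm[OF \<phi>])
  have meS: "S1' \<in> sets borel" "S2' \<in> sets borel"
  proof -
    have "(\<lambda>x::real^'n. (1 / \<epsilon>) *\<^sub>R x) \<in> borel \<rightarrow>\<^sub>M borel" by measurable
    from measurable_sets[OF this S(1)] measurable_sets[OF this S(2)] show "S1' \<in> sets borel" "S2' \<in> sets borel"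
      by (simp_all add: S1'_def S2'_def)
  qed
  have em: "emeasure lborel ((\<lambda>x. (1 / \<epsilon>) *\<^sub>R x) -` A) = ennreal e * emeasure lborel A"
    if [measurable]: "A \<in> sets borel" and [measurable]: "(\<lambda>x. (1 / \<epsilon>) *\<^sub>R x) -` A \<in> sets borel" for A :: "(real^'n) set"
  proof -
    have "emeasure lborel ((\<lambda>x. (1 / \<epsilon>) *\<^sub>R x) -` A) = (\<integral>\<^sup>+x. indicator ((\<lambda>x. (1 / \<epsilon>) *\<^sub>R x) -` A) x \<partial>lborel)" by simp
    also have "\<dots> = ennreal (\<bar>\<epsilon>\<bar> ^ DIM(real^'n)) * (\<integral>\<^sup>+x. indicator ((\<lambda>x. (1 / \<epsilon>) *\<^sub>R x) -` A) (0 + \<epsilon> *\<^sub>R x) \<partial>lborel)"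
      by (rule nn_integral_lborel_affine) (use \<epsilon> in auto)
    also have "(\<lambda>x::real^'n. indicator ((\<lambda>x. (1 / \<epsilon>) *\<^sub>R x) -` A) (0 + \<epsilon> *\<^sub>R x)) = (indicator A :: _ \<Rightarrow> ennreal)"
      using \<epsilon> by (auto simp: indicator_def fun_eq_iff)
    finally show ?thesis using \<epsilon> by (simp add: e_def)
  qed
  have emS: "emeasure lborel S1' \<le> ennreal (e * m1)" "emeasure lborel S2' \<le> ennreal (e * m2)"
    using em[of S1] em[of S2] S meS e pos unfolding S1'_def S2'_def
    by (auto simp: ennreal_mult intro!: mult_left_mono)
  have pw: "(e * a) powr (1 / p) = e powr (1 / p) * a powr (1 / p)" "(e * a) powr (1 - 1 / p) = e powr (1 - 1 / p) * a powr (1 - 1 / p)"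
    if "0 < a" for a using that e by (auto simp: powr_mult)
  \<comment> \<open>The exponents 1/p and 1 - 1/p add up to one, so the measures of the two supports
    contribute exactly the factor by which \<kappa> grows.\<close>
  have ee: "e powr (1 / p) * e powr (1 - 1 / p) = e" using e by (simp flip: powr_add)
  have c: "(e * \<kappa>) / (a * (e * m) powr (1 / p) * b * (e * n) powr (1 - 1 / p)) = \<kappa> / (a * m powr (1 / p) * b * n powr (1 - 1 / p))"
    if "0 < m" "0 < n" for a b m n
  proof -
    have "a * (e * m) powr (1 / p) * b * (e * n) powr (1 - 1 / p)
      = (e powr (1 / p) * e powr (1 - 1 / p)) * (a * m powr (1 / p) * b * n powr (1 - 1 / p))"
      using that by (simp add: pw mult_ac)
    from this[unfolded ee] show ?thesis using e by (simp only: mult_divide_mult_cancel_left[OF less_imp_neq[OF e, symmetric]])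
  qed
  have A: "0 < \<epsilon> * \<eta> * c0" using T \<eta> \<epsilon> by simp
  have appr': "\<bar>\<integral>x. grad \<psi> x \<bullet> (grad \<phi>' x + f' x) \<partial>lborel\<bar> \<le> (sqrt e * E) * norm2 lborel (grad \<psi>)"
    if \<psi>: "\<psi> \<in> test_functions (perforated_domain T \<epsilon> \<eta>)" for \<psi>
  proof -
    define \<psi>' where "\<psi>' x = (1 / \<epsilon>) * \<psi> (\<epsilon> *\<^sub>R x)" for x
    have \<psi>': "\<psi>' \<in> test_functions (perforated_domain T 1 \<eta>)"
      using test_functions_scale[OF \<psi>, of \<epsilon> "1 / \<epsilon>"] \<epsilon> unfolding \<Omega>1 \<psi>'_def by simp
    have g\<psi>': "grad \<psi>' x = grad \<psi> (\<epsilon> *\<^sub>R x)" for x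
      using grad_scale[OF test_functionsD(1)[OF \<psi>], of \<epsilon> x] \<epsilon> by (simp add: \<psi>'_def[abs_def])
    have [measurable]: "grad \<psi> \<in> borel_measurable borel" "grad \<psi>' \<in> borel_measurable borel"
      by (rule gm[OF \<psi>] gm[OF \<psi>'])+
    have n: "norm2 lborel (grad \<psi>) = sqrt e * norm2 lborel (grad \<psi>')"
      using sq(2)[OF sq_int_grad_test[OF \<psi>']] \<epsilon> by (simp add: g\<psi>')
    have "(\<integral>x. grad \<psi> x \<bullet> (grad \<phi>' x + f' x) \<partial>lborel) = e * (\<integral>x. grad \<psi>' x \<bullet> (grad \<phi> x + f x) \<partial>lborel)"
      using lborel_integral_scale(1)[of "\<lambda>x. grad \<psi> x \<bullet> (grad \<phi> ((1 / \<epsilon>) *\<^sub>R x) + f ((1 / \<epsilon>) *\<^sub>R x))" \<epsilon>] \<epsilon>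
      by (simp add: g\<phi>' f'_def e_def g\<psi>')
    then have "\<bar>\<integral>x. grad \<psi> x \<bullet> (grad \<phi>' x + f' x) \<partial>lborel\<bar> \<le> e * (E * norm2 lborel (grad \<psi>'))"
      using appr[OF \<psi>'] e by (simp add: abs_mult mult_left_mono)
    also have "\<dots> = (sqrt e * sqrt e) * (E * norm2 lborel (grad \<psi>'))" using e by simp
    also have "\<dots> = (sqrt e * E) * norm2 lborel (grad \<psi>)" by (simp only: n mult_ac)
    finally show ?thesis .
  qed
  have \<kappa>': "0 < e * \<kappa>" "e * \<kappa> + (sqrt e * E) * norm2 lborel h' \<le> \<bar>\<integral>x. h' x \<bullet> grad \<phi>' x \<partial>lborel\<bar>"
  proof -
    show "0 < e * \<kappa>" using e \<kappa> by simp
    have "(\<integral>x. h' x \<bullet> grad \<phi>' x \<partial>lborel) = e * (\<integral>x. h x \<bullet> grad \<phi> x \<partial>lborel)"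
      using lborel_integral_scale(1)[of "\<lambda>x. h ((1 / \<epsilon>) *\<^sub>R x) \<bullet> grad \<phi> ((1 / \<epsilon>) *\<^sub>R x)" \<epsilon>] \<epsilon>
      by (simp add: g\<phi>' h'_def e_def)
    then have 1: "\<bar>\<integral>x. h' x \<bullet> grad \<phi>' x \<partial>lborel\<bar> = e * \<bar>\<integral>x. h x \<bullet> grad \<phi> x \<partial>lborel\<bar>"
      using e by (simp add: abs_mult)
    have "norm2 lborel h' = sqrt e * norm2 lborel h" using sq(2)[OF h] by (simp add: h'_def[abs_def])
    then have "(sqrt e * E) * norm2 lborel h' = (sqrt e * sqrt e) * (E * norm2 lborel h)" by (simp only: mult_ac)
    also have "sqrt e * sqrt e = e" using e by simp
    finally have "e * \<kappa> + (sqrt e * E) * norm2 lborel h' = e * (\<kappa> + E * norm2 lborel h)"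
      by (simp add: algebra_simps)
    also have "\<dots> \<le> e * \<bar>\<integral>x. h x \<bullet> grad \<phi> x \<partial>lborel\<bar>" using e \<kappa>(2) by (intro mult_left_mono) auto
    finally show "e * \<kappa> + (sqrt e * E) * norm2 lborel h' \<le> \<bar>\<integral>x. h' x \<bullet> grad \<phi>' x \<partial>lborel\<bar>" using 1 by simp
  qed
  have f': "sq_int lborel f'" and h': "sq_int lborel h'"
    using sq(1)[OF f] sq(1)[OF h] by (simp_all add: f'_def[abs_def] h'_def[abs_def])
  have fb': "norm (f' x) \<le> H1 * indicator S1' x" and hb': "norm (h' x) \<le> H2 * indicator S2' x" for x
    using fb[of "(1 / \<epsilon>) *\<^sub>R x"] hb[of "(1 / \<epsilon>) *\<^sub>R x"] by (simp_all add: f'_def h'_def S1'_def S2'_def indicator_def)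
  have pos': "0 < e * m1" "0 < e * m2" "0 \<le> sqrt e * E" using e pos E by auto
  note main = A_const_ge_of_approximate_solution[OF open_perforated_domain[OF T(1) \<epsilon>] p A
      perforated_domain_avoids_ball[OF T(2) \<epsilon> \<eta>] \<phi>' f' h' pos'(3) appr' \<kappa>' fb' hb' meS emS pos(1,2) pos'(1,2)]
  show "A_const p T \<epsilon> \<eta> \<ge> ennreal (\<kappa> / (H1 * m1 powr (1 / p) * H2 * m2 powr (1 - 1 / p)))"
    using main(1) c[OF pos(3,4), of H1 H2] by simp
  show "A_const p T \<epsilon> \<eta> \<ge> ennreal (\<kappa> / (H2 * m2 powr (1 / p) * H1 * m1 powr (1 - 1 / p)))"
    using main(2) c[OF pos(4,3), of H2 H1] by simp
qed

section \<open>Geometry of the hole in its cell\<close>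

lemma integral_pos_if_continuous:
  fixes g :: "real^'n \<Rightarrow> real"
  assumes i: "integrable lborel g" and c: "continuous_on UNIV g" and nn: "\<And>x. 0 \<le> g x" and x0: "0 < g x0"
  shows "0 < integral\<^sup>L lborel g"
proof -
  have "open {x. g x0 / 2 < g x}" by (rule open_Collect_less) (use c in \<open>auto intro: continuous_intros\<close>)
  moreover have "x0 \<in> {x. g x0 / 2 < g x}" using x0 by simp
  ultimately obtain r where r: "0 < r" "ball x0 r \<subseteq> {x. g x0 / 2 < g x}" by (meson openE)
  have "0 < g x0 / 2 * measure lborel (ball x0 r)" using x0 content_ball_pos[OF r(1), of x0] by simp
  also have "\<dots> = (\<integral>x. g x0 / 2 * indicator (ball x0 r) x \<partial>lborel)" by simp
  also have "\<dots> \<le> integral\<^sup>L lborel g"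
  proof (rule integral_mono[OF _ i])
    show "integrable lborel (\<lambda>x. g x0 / 2 * indicator (ball x0 r) x)"
      using emeasure_lborel_ball_finite[of x0 r] by (intro integrable_mult_right integrable_real_indicator) auto
    show "g x0 / 2 * indicator (ball x0 r) x \<le> g x" for x
      using r(2) nn[of x] by (auto simp: indicator_def)
  qed
  finally show ?thesis .
qed

text \<open>The positive distance between the boundaries of hole and cell keeps \<open>T\<close> in
  the open cube, and compactness turns this into a margin \<rho> that is uniform over points and
  coordinates.\<close>

lemma admissible_holeD:
  fixes T :: "(real^'n) set"
  assumes "admissible_hole T"
  obtains c0 \<rho> where "compact T" "T \<subseteq> unit_cell" "0 < c0" "ball 0 c0 \<subseteq> T"
    "0 < \<rho>" "\<And>t i. t \<in> T \<Longrightarrow> \<bar>t $ i\<bar> \<le> 1/2 - \<rho>"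
proof -
  obtain D c0 where D: "bounded D" "D \<subseteq> unit_cell" "T = closure D" and c0: "0 < c0" "ball 0 c0 \<subseteq> T"
    "c0 \<le> setdist (frontier T) (frontier (unit_cell :: (real^'n) set))"
    using assms unfolding admissible_hole_def by blast
  have T: "compact T" using D by (simp add: compact_closure)
  have TY: "T \<subseteq> unit_cell" unfolding D(3) by (rule closure_minimal[OF D(2)]) (simp add: unit_cell_def closed_cbox)
  have lt: "\<bar>t $ i\<bar> < 1/2" if t: "t \<in> T" for t i
  proof (rule ccontr)
    assume "\<not> \<bar>t $ i\<bar> < 1/2"
    moreover have "\<bar>t $ i\<bar> < 1/2" if "t \<in> interior unit_cell"
    proof -
      have "\<forall>i. - 1/2 < t $ i \<and> t $ i < 1/2"
        using that unfolding unit_cell_def interior_cbox by (simp add: mem_box_cart)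
      from spec[OF this, of i] show ?thesis by linarith
    qed
    ultimately have "t \<notin> interior unit_cell" by blast
    \<comment> \<open>The interior of \<open>T\<close> lies in the interior of the cell, so a point
      of \<open>T\<close> on the boundary of the cell is also on the boundary of \<open>T\<close>.
      The distance would then be zero.\<close>
    then have "t \<in> frontier unit_cell" "t \<in> frontier T"
      using t TY interior_mono[OF TY] closure_subset[of T] closure_subset[of unit_cell] by (auto simp: frontier_def)
    then have "setdist (frontier T) (frontier unit_cell) \<le> dist t t" by (intro setdist_le_dist)
    then show False using c0 by simp
  qed
  have "T \<noteq> {}" using c0 by auto
  have "\<exists>\<rho>>0. \<forall>t\<in>T. \<bar>t $ i\<bar> \<le> 1/2 - \<rho>" for i
  proof -
    have "continuous_on T (\<lambda>t. \<bar>t $ i\<bar>)" by (intro continuous_intros)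
    from continuous_attains_sup[OF T \<open>T \<noteq> {}\<close> this] obtain s where "s \<in> T" "\<forall>t\<in>T. \<bar>t $ i\<bar> \<le> \<bar>s $ i\<bar>" by blast
    then show ?thesis using lt[of s i] by (intro exI[of _ "1/2 - \<bar>s $ i\<bar>"]) auto
  qed
  then obtain \<rho> where \<rho>: "\<And>i. 0 < \<rho> i" "\<And>i t. t \<in> T \<Longrightarrow> \<bar>t $ i\<bar> \<le> 1/2 - \<rho> i" by metis
  show ?thesis
  proof (rule that[OF T TY c0(1,2)])
    show "0 < Min (range \<rho>)" using \<rho>(1) by simp
    show "\<bar>t $ i\<bar> \<le> 1/2 - Min (range \<rho>)" if "t \<in> T" for t i
    proof -
      have "Min (range \<rho>) \<le> \<rho> i" by (rule Min_le) auto
      then show ?thesis using \<rho>(2)[OF that, of i] by linarith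
    qed
  qed
qed

text \<open>Some coordinate suffices: an integer is at distance at least 1/2 from 1/2, while a hole
  reaches at most 1/2 - \<rho> from its centre in that coordinate. For \<eta> \<le> 1 the radius is
  independent of \<eta>.\<close>

lemma corner_ball_in_perforated_domain:
  fixes T :: "(real^'n) set"
  assumes \<rho>: "\<And>t i. t \<in> T \<Longrightarrow> \<bar>t $ i\<bar> \<le> 1/2 - \<rho>" and \<eta>: "0 < \<eta>" "\<eta> \<le> 1" and \<rho>0: "0 < \<rho>"
  shows "ball (\<chi> i. 1/2) \<rho> \<subseteq> perforated_domain T 1 \<eta>"
proof
  fix x :: "real^'n" assume x: "x \<in> ball (\<chi> i. 1/2) \<rho>"
  show "x \<in> perforated_domain T 1 \<eta>"
  proof (rule ccontr)
    assume "x \<notin> perforated_domain T 1 \<eta>"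
    then obtain k t where kt: "\<And>i. k $ i \<in> \<int>" "t \<in> T" "x = k + \<eta> *\<^sub>R t" by (auto simp: perforated_domain_def)
    fix i :: 'n
    obtain m where m: "k $ i = of_int m" using kt(1)[of i] by (auto elim: Ints_cases)
    have "\<bar>\<eta> * t $ i\<bar> \<le> 1 * (1/2 - \<rho>)" unfolding abs_mult using \<eta> \<rho>[OF kt(2), of i] by (intro mult_mono) auto
    moreover have "1/2 \<le> \<bar>k $ i - 1/2\<bar>" unfolding m by (cases "m \<le> 0") auto
    moreover have "\<bar>x $ i - 1/2\<bar> < \<rho>"
      using component_le_norm_cart[of "x - (\<chi> i. 1/2)" i] x by (simp add: dist_norm norm_minus_commute)
    ultimately show False using kt(3) by (simp add: abs_if split: if_splits)
  qed
qed

section \<open>Radial fields and lattice cells\<close>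

lemma continuous_bounded_support_imp_bounded:
  fixes g :: "'a::euclidean_space \<Rightarrow> 'b::real_normed_vector"
  assumes "continuous_on UNIV g" "bounded K" "\<And>x. x \<notin> K \<Longrightarrow> g x = 0"
  obtains B where "0 \<le> B" "\<And>x. norm (g x) \<le> B"
proof -
  have "compact (g ` closure K)"
    using assms by (intro compact_continuous_image) (auto intro: continuous_on_subset simp: compact_closure)
  then obtain B where B: "\<And>y. y \<in> g ` closure K \<Longrightarrow> norm y \<le> B" using compact_imp_bounded bounded_iff by metis
  have "norm (g x) \<le> max B 0" for x
    using B[of "g x"] assms(3)[of x] closure_subset[of K] by (cases "x \<in> K") auto
  then show ?thesis using that[of "max B 0"] by auto
qed

lemma lborel_integral_translate:
  fixes f :: "'a::euclidean_space \<Rightarrow> 'b::{banach, second_countable_topology}"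
  assumes [measurable]: "f \<in> borel_measurable borel"
  shows "(\<integral>x. f (x + t) \<partial>lborel) = integral\<^sup>L lborel f"
proof -
  have "integral\<^sup>L lborel f = integral\<^sup>L (distr lborel borel ((+) t)) f" by (simp add: lborel_distr_plus)
  also have "\<dots> = (\<integral>x. f (t + x) \<partial>lborel)" by (rule integral_distr) auto
  finally show ?thesis by (simp add: add.commute)
qed

text \<open>By translation invariance all difference quotients have integral zero; the mean value
  theorem bounds them by a constant on one fixed ball, and dominated convergence passes to the
  derivative.\<close>

lemma integral_partial_derivative_eq_0:
  fixes F :: "real^'n \<Rightarrow> real"
  assumes F: "class_C (Suc 0) F" and K: "bounded K" "\<And>x. x \<notin> K \<Longrightarrow> F x = 0"
  shows "(\<integral>x. grad F x $ i \<partial>lborel) = 0"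
proof -
  let ?e = "axis i 1 :: real^'n"
  have cF: "continuous_on UNIV F" and cg: "continuous_on UNIV (grad F)"
    using class_C_continuous[OF F] class_C_continuous_grad[OF F] by auto
  have [measurable]: "F \<in> borel_measurable borel" "grad F \<in> borel_measurable borel"
    using cF cg by (auto intro: borel_measurable_continuous_onI)
  obtain r where r: "K \<subseteq> ball 0 r" using bounded_subset_ballD[OF K(1)] by blast
  have g0: "grad F x = 0" if "x \<notin> cball 0 r" for x
    by (rule grad_zero_locally[of "- cball 0 r"]) (use that r K(2) in force)+
  obtain B where B: "0 \<le> B" "\<And>x. norm (grad F x) \<le> B"
    using continuous_bounded_support_imp_bounded[OF cg bounded_cball g0] by blast
  define t where "t n = 1 / real (Suc n)" for n
  have t: "0 < t n" "t n \<le> 1" for n by (auto simp: t_def)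
  define u where "u n x = (F (x + t n *\<^sub>R ?e) - F x) / t n" for n x
  have iF: "integrable lborel F" by (rule integrable_continuous_support[OF cF K])
  have iFt: "integrable lborel (\<lambda>x. F (x + t n *\<^sub>R ?e))" for n
  proof (rule integrable_continuous_support)
    show "continuous_on UNIV (\<lambda>x. F (x + t n *\<^sub>R ?e))"
      by (intro continuous_on_compose2[OF cF] continuous_intros) auto
    show "bounded (ball 0 (r + 1) :: (real^'n) set)" by simp
    show "F (x + t n *\<^sub>R ?e) = 0" if "x \<notin> ball 0 (r + 1)" for x
    proof (rule K(2), rule notI)
      assume "x + t n *\<^sub>R ?e \<in> K"
      then have "norm (x + t n *\<^sub>R ?e) < r" using r by auto
      moreover have "norm (t n *\<^sub>R ?e) \<le> 1" using t[of n] by (simp add: norm_axis_1)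
      ultimately show False using that norm_triangle_ineq4[of "x + t n *\<^sub>R ?e" "t n *\<^sub>R ?e"] by simp
    qed
  qed
  have u0: "(\<integral>x. u n x \<partial>lborel) = 0" for n
  proof -
    have "(\<integral>x. F (x + t n *\<^sub>R ?e) - F x \<partial>lborel) = (\<integral>x. F (x + t n *\<^sub>R ?e) \<partial>lborel) - integral\<^sup>L lborel F"
      by (rule Bochner_Integration.integral_diff[OF iFt iF])
    also have "(\<integral>x. F (x + t n *\<^sub>R ?e) \<partial>lborel) = integral\<^sup>L lborel F" by (rule lborel_integral_translate) measurable
    finally show ?thesis unfolding u_def by simp
  qed
  have bound: "\<bar>F (x + t n *\<^sub>R ?e) - F x\<bar> \<le> B * t n" for x n
  proof -
    have d: "((\<lambda>s. F (x + s *\<^sub>R ?e)) has_real_derivative grad F (x + s *\<^sub>R ?e) \<bullet> ?e) (at s)" for s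
      by (rule has_real_derivative_along_line[OF F])
    obtain z where "F (x + t n *\<^sub>R ?e) - F (x + 0 *\<^sub>R ?e) = (t n - 0) * (grad F (x + z *\<^sub>R ?e) \<bullet> ?e)"
      using MVT2[OF t(1)[of n], of "\<lambda>s. F (x + s *\<^sub>R ?e)" "\<lambda>s. grad F (x + s *\<^sub>R ?e) \<bullet> ?e"] d by blast
    moreover have "\<bar>grad F (x + z *\<^sub>R ?e) \<bullet> ?e\<bar> \<le> B"
      using component_le_norm_cart[of "grad F (x + z *\<^sub>R ?e)" i] B(2)[of "x + z *\<^sub>R ?e"] by (simp add: inner_axis)
    ultimately show ?thesis using t[of n] by (simp add: abs_mult mult.commute)
  qed
  have "(\<lambda>n. \<integral>x. u n x \<partial>lborel) \<longlonglongrightarrow> (\<integral>x. grad F x $ i \<partial>lborel)"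
  proof (rule integral_dominated_convergence[where w="\<lambda>x. B * indicator (ball 0 (r + 1)) x"])
    have "(\<lambda>x. grad F x $ i) \<in> borel_measurable borel"
      by (rule borel_measurable_continuous_onI) (rule class_C_continuous[OF class_C_SucD(2)[OF F]])
    then show "(\<lambda>x. grad F x $ i) \<in> borel_measurable lborel" by simp
    show "u n \<in> borel_measurable lborel" for n unfolding u_def by measurable
    show "integrable lborel (\<lambda>x. B * indicator (ball 0 (r + 1) :: (real^'n) set) x)"
      using emeasure_lborel_ball_finite[of "0::real^'n" "r + 1"]
      by (intro integrable_mult_right integrable_real_indicator) auto
    show "AE x in lborel. (\<lambda>n. u n x) \<longlonglongrightarrow> grad F x $ i"
    proof (rule AE_I2)
      fix x
      have "((\<lambda>s. F (x + s *\<^sub>R ?e)) has_real_derivative grad F (x + 0 *\<^sub>R ?e) \<bullet> ?e) (at 0)"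
        by (rule has_real_derivative_along_line[OF F])
      then have lim: "((\<lambda>h. (F (x + h *\<^sub>R ?e) - F x) / h) \<longlongrightarrow> grad F x $ i) (at 0)"
        by (simp add: DERIV_def inner_axis)
      have "t \<longlonglongrightarrow> 0" unfolding t_def using LIMSEQ_inverse_real_of_nat by (simp add: inverse_eq_divide)
      then have "filterlim t (at 0) sequentially"
        using t(1) by (intro filterlim_atI) (auto simp: less_imp_neq[THEN not_sym])
      from filterlim_compose[OF lim this] show "(\<lambda>n. u n x) \<longlonglongrightarrow> grad F x $ i" by (simp add: u_def)
    qed
    fix n
    show "AE x in lborel. norm (u n x) \<le> B * indicator (ball 0 (r + 1)) x"
    proof (rule AE_I2)
      fix x
      show "norm (u n x) \<le> B * indicator (ball 0 (r + 1)) x"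
      proof (cases "x \<in> ball 0 (r + 1)")
        case True
        then show ?thesis using bound[of x n] t[of n] by (simp add: u_def abs_divide pos_divide_le_eq)
      next
        case False
        have "F x = 0" by (rule K(2)) (use False r in force)
        moreover have "F (x + t n *\<^sub>R ?e) = 0"
        proof (rule K(2), rule notI)
          assume "x + t n *\<^sub>R ?e \<in> K"
          then have "norm (x + t n *\<^sub>R ?e) < r" using r by auto
          moreover have "norm (t n *\<^sub>R ?e) \<le> 1" using t[of n] by (simp add: norm_axis_1)
          ultimately show False using False norm_triangle_ineq4[of "x + t n *\<^sub>R ?e" "t n *\<^sub>R ?e"] by simp
        qed
        ultimately show ?thesis using False by (simp add: u_def)
      qed
    qed
  qed
  then show ?thesis by (simp add: u0 LIMSEQ_const_iff)
qed

text \<open>The expression \<open>d g(s) + 2 s g'(s)\<close>, \<open>s = |x - a|\<^sup>2\<close>, is the divergence of \<open>g(|x - a|\<^sup>2) (x - a)\<close>.\<close>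

lemma integral_radial_divergence:
  fixes \<psi> :: "real^'n \<Rightarrow> real" and a :: "real^'n"
  assumes \<psi>: "class_C (Suc 0) \<psi>" and g: "\<And>s. (g has_real_derivative g' s) (at s)" "continuous_on UNIV g'"
    and K: "bounded K" "\<And>x. x \<notin> K \<Longrightarrow> \<psi> x * g ((norm (x - a))\<^sup>2) = 0"
  shows "(\<integral>x. grad \<psi> x \<bullet> (g ((norm (x - a))\<^sup>2) *\<^sub>R (x - a))
    + \<psi> x * (real CARD('n) * g ((norm (x - a))\<^sup>2) + 2 * (norm (x - a))\<^sup>2 * g' ((norm (x - a))\<^sup>2)) \<partial>lborel) = 0"
proof -
  let ?s = "\<lambda>x. (norm (x - a))\<^sup>2"
  have Ck: "Ck (Suc 0) g" using g by auto
  have G: "class_C (Suc 0) (\<lambda>x. g (?s x))" by (rule class_C_compose[OF class_C_dist_square Ck])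
  \<comment> \<open>The i-th component of the field \<psi> g(|x-a|^2) (x - a). Adding up its partial
    derivatives gives the integrand of the claim.\<close>
  define F where "F i x = \<psi> x * g (?s x) * (x $ i - a $ i)" for i x
  have F: "class_C (Suc 0) (F i)" for i
    unfolding F_def by (intro class_C_mult \<psi> G class_C_coord)
  have F0: "F i x = 0" if "x \<notin> K" for i x using K(2)[OF that] by (auto simp: F_def)
  have gF: "grad (F i) x = (g (?s x) * (x $ i - a $ i)) *\<^sub>R grad \<psi> x
      + (\<psi> x * (x $ i - a $ i) * (2 * g' (?s x))) *\<^sub>R (x - a) + (\<psi> x * g (?s x)) *\<^sub>R axis i 1" for i x
  proof (rule grad_eqI)
    have 1: "((\<lambda>x. x $ i - a $ i) has_derivative (\<lambda>h. h $ i)) (at x)"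
      by (auto intro!: derivative_eq_intros bounded_linear.has_derivative[OF bounded_linear_vec_nth])
    show "(F i has_derivative (\<lambda>h. ((g (?s x) * (x $ i - a $ i)) *\<^sub>R grad \<psi> x
      + (\<psi> x * (x $ i - a $ i) * (2 * g' (?s x))) *\<^sub>R (x - a) + (\<psi> x * g (?s x)) *\<^sub>R axis i 1) \<bullet> h)) (at x)"
      unfolding F_def
      by (rule has_derivative_eq_rhs[OF has_derivative_mult[OF has_derivative_mult[OF class_C_SucD(1)[OF \<psi>] has_derivative_radial[OF g(1)]] 1]])
        (simp add: fun_eq_iff inner_add_left inner_axis' algebra_simps)
  qed
  have cF: "continuous_on UNIV (grad (F i))" for i by (rule class_C_continuous_grad[OF F])
  have zF: "grad (F i) x = 0" if "x \<notin> closure K" for i x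
    by (rule grad_zero_locally[of "- closure K"]) (use that F0 closure_subset[of K] in auto)
  have iF: "integrable lborel (\<lambda>x. grad (F i) x $ i)" for i
    by (rule integrable_continuous_support[of _ "closure K"]) (use K(1) zF cF in \<open>auto intro!: continuous_intros\<close>)
  have "(\<integral>x. (\<Sum>i\<in>UNIV. grad (F i) x $ i) \<partial>lborel) = (\<Sum>i\<in>UNIV. \<integral>x. grad (F i) x $ i \<partial>lborel)"
    by (rule Bochner_Integration.integral_sum) (rule iF)
  also have "\<dots> = 0" using integral_partial_derivative_eq_0[OF F K(1) F0] by simp
  also have "(\<lambda>x. \<Sum>i\<in>UNIV. grad (F i) x $ i) = (\<lambda>x. grad \<psi> x \<bullet> (g (?s x) *\<^sub>R (x - a))
    + \<psi> x * (real CARD('n) * g (?s x) + 2 * ?s x * g' (?s x)))"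
  proof
    fix x
    have "grad (F i) x $ i = grad \<psi> x $ i * (g (?s x) *\<^sub>R (x - a)) $ i
      + (2 * g' (?s x) * \<psi> x) * ((x - a) $ i * (x - a) $ i) + \<psi> x * g (?s x)" for i
      unfolding gF by (simp add: algebra_simps)
    then have "(\<Sum>i\<in>UNIV. grad (F i) x $ i) = (\<Sum>i\<in>UNIV. grad \<psi> x $ i * (g (?s x) *\<^sub>R (x - a)) $ i)
      + (\<Sum>i\<in>UNIV. (2 * g' (?s x) * \<psi> x) * ((x - a) $ i * (x - a) $ i)) + (\<Sum>i\<in>(UNIV::'n set). \<psi> x * g (?s x))"
      by (simp only: sum.distrib)
    also have "(\<Sum>i\<in>UNIV. grad \<psi> x $ i * (g (?s x) *\<^sub>R (x - a)) $ i) = grad \<psi> x \<bullet> (g (?s x) *\<^sub>R (x - a))"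
      by (simp add: inner_vec_def)
    also have "(\<Sum>i\<in>UNIV. (2 * g' (?s x) * \<psi> x) * ((x - a) $ i * (x - a) $ i)) = 2 * g' (?s x) * \<psi> x * ?s x"
      unfolding sum_distrib_left[symmetric] by (simp add: power2_norm_eq_inner inner_vec_def)
    finally show "(\<Sum>i\<in>UNIV. grad (F i) x $ i) = grad \<psi> x \<bullet> (g (?s x) *\<^sub>R (x - a))
      + \<psi> x * (real CARD('n) * g (?s x) + 2 * ?s x * g' (?s x))" by (simp add: algebra_simps)
  qed
  finally show ?thesis .
qed

text \<open>Half-open, so that the cells about the integer points partition the space and not merely
  cover it up to null sets.\<close>

definition lattice_cell :: "real^'n \<Rightarrow> (real^'n) set" where
  "lattice_cell k = {x. \<forall>i. k $ i - 1/2 \<le> x $ i \<and> x $ i < k $ i + 1/2}"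

definition lattice_box :: "nat \<Rightarrow> (real^'n) set" where
  "lattice_box K = {k. \<forall>i. k $ i \<in> real_of_int ` {- int K..int K}}"

lemma card_lattice_box:
  "finite (lattice_box K :: (real^'n) set)" "card (lattice_box K :: (real^'n) set) = (2 * K + 1) ^ CARD('n)"
proof -
  let ?S = "real_of_int ` {- int K..int K}"
  have b: "bij_betw vec_nth (lattice_box K :: (real^'n) set) (PiE UNIV (\<lambda>i::'n. ?S))"
    by (rule bij_betwI[where g=vec_lambda]) (auto simp: lattice_box_def PiE_def Pi_def)
  have "finite (PiE UNIV (\<lambda>i::'n. ?S))" by (intro finite_PiE) auto
  then show "finite (lattice_box K :: (real^'n) set)" using bij_betw_finite[OF b] by simp
  have "card ?S = 2 * K + 1" by (subst card_image) (auto simp: inj_on_def)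
  then show "card (lattice_box K :: (real^'n) set) = (2 * K + 1) ^ CARD('n)"
    using bij_betw_same_card[OF b] by (simp add: card_PiE)
qed

lemma lattice_cell_measure:
  "lattice_cell k \<in> sets borel" "emeasure lborel (lattice_cell k) = 1"
proof -
  have "lattice_cell k = (\<Inter>i. {x. k $ i - 1/2 \<le> x $ i} \<inter> {x. x $ i < k $ i + 1/2})"
    by (auto simp: lattice_cell_def)
  also have "\<dots> \<in> sets borel" by measurable
  finally show m[measurable]: "lattice_cell k \<in> sets borel" .
  let ?a = "\<chi> i. k $ i - 1/2" and ?b = "\<chi> i. k $ i + 1/2"
  have "box ?a ?b \<subseteq> lattice_cell k" "lattice_cell k \<subseteq> cbox ?a ?b"
    by (auto simp: lattice_cell_def mem_box_cart less_imp_le)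
  then have "emeasure lborel (box ?a ?b) \<le> emeasure lborel (lattice_cell k)" "emeasure lborel (lattice_cell k) \<le> emeasure lborel (cbox ?a ?b)"
    by (auto intro!: emeasure_mono)
  moreover have "(\<Prod>b\<in>Basis. (?b - ?a) \<bullet> b) = (\<Prod>b\<in>(Basis::(real^'a) set). 1)"
    by (rule prod.cong) (auto simp: Basis_vec_def inner_axis)
  moreover have "emeasure lborel (box ?a ?b) = ennreal (\<Prod>b\<in>Basis. (?b - ?a) \<bullet> b)"
    "emeasure lborel (cbox ?a ?b) = ennreal (\<Prod>b\<in>Basis. (?b - ?a) \<bullet> b)"
    by (rule emeasure_lborel_box emeasure_lborel_cbox; auto simp: Basis_vec_def inner_axis)+
  ultimately show "emeasure lborel (lattice_cell k) = 1" by (simp add: antisym)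
qed

lemma lattice_cell_props:
  shows "convex (lattice_cell k)" "bounded (lattice_cell k)"
    "x \<in> lattice_cell (k::real^'n) \<Longrightarrow> y \<in> lattice_cell k \<Longrightarrow> norm (x - y) \<le> real CARD('n)"
proof -
  show d: "norm (x - y) \<le> real CARD('n)" if "x \<in> lattice_cell k" "y \<in> lattice_cell k" for x y k :: "real^'n"
  proof -
    have "norm (x - y) \<le> (\<Sum>i\<in>UNIV. \<bar>(x - y) $ i\<bar>)" by (rule norm_le_l1_cart)
    also have "\<dots> \<le> (\<Sum>i\<in>(UNIV::'n set). 1)"
    proof (rule sum_mono)
      fix i
      have "k $ i - 1/2 \<le> x $ i \<and> x $ i < k $ i + 1/2" "k $ i - 1/2 \<le> y $ i \<and> y $ i < k $ i + 1/2"
        using that by (auto simp: lattice_cell_def)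
      then show "\<bar>(x - y) $ i\<bar> \<le> 1" by (simp add: abs_le_iff)
    qed
    finally show ?thesis by simp
  qed
  show "bounded (lattice_cell k)"
    by (rule bounded_subset[OF bounded_cbox[of "\<chi> i. k $ i - 1/2" "\<chi> i. k $ i + 1/2"]])
      (auto simp: lattice_cell_def mem_box_cart less_imp_le)
  have "convex {x::real^'n. c \<le> x $ i}" "convex {x::real^'n. x $ i < c}" for c and i :: 'n
    using convex_halfspace_ge[of c "axis i (1::real)"] convex_halfspace_lt[of "axis i (1::real)" c] by (simp_all add: inner_axis' inner_axis inner_real_def)
  then have "convex (\<Inter>i. {x. k $ i - 1/2 \<le> x $ i} \<inter> {x. x $ i < k $ i + 1/2})" for k :: "real^'n"
    by (intro convex_INT convex_Int)
  moreover have "lattice_cell k = (\<Inter>i. {x. k $ i - 1/2 \<le> x $ i} \<inter> {x. x $ i < k $ i + 1/2})" for k :: "real^'n"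
    by (auto simp: lattice_cell_def)
  ultimately show "convex (lattice_cell k)" by metis
qed

lemma lattice_cell_unique:
  fixes k l :: "real^'n"
  assumes "\<And>i. k $ i \<in> \<int>" "\<And>i. l $ i \<in> \<int>" "x \<in> lattice_cell k" "x \<in> lattice_cell l"
  shows "k = l"
proof (rule vec_eq_iff[THEN iffD2], rule allI)
  fix i
  obtain m n where mn: "k $ i = of_int m" "l $ i = of_int n" using assms(1,2)[of i] by (auto elim!: Ints_cases)
  have "k $ i - 1/2 \<le> x $ i \<and> x $ i < k $ i + 1/2" "l $ i - 1/2 \<le> x $ i \<and> x $ i < l $ i + 1/2"
    using assms(3,4) by (auto simp: lattice_cell_def)
  then have "real_of_int \<bar>m - n\<bar> < 1" unfolding mn by simp
  then have "m = n" by linarith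
  then show "k $ i = l $ i" unfolding mn by simp
qed

lemma mem_lattice_cellI:
  fixes x k :: "real^'n"
  assumes "(norm (x - k))\<^sup>2 < 1/4"
  shows "x \<in> lattice_cell k"
proof -
  have "norm (x - k) < 1/2" using assms power2_less_imp_less[of "norm (x - k)" "1/2"] by (simp add: power2_eq_square)
  then have "k $ i - 1/2 \<le> x $ i \<and> x $ i < k $ i + 1/2" for i
    using component_le_norm_cart[of "x - k" i] by (simp only: vector_minus_component) linarith
  then show ?thesis by (simp add: lattice_cell_def)
qed

text \<open>Every coordinate is rounded to the floor of x_i + 1/2. This fits the half-open
  convention, and a coordinate of modulus at most \<open>K\<close> is rounded to an integer between
  -K and K.\<close>

lemma ex_lattice_cell:
  fixes x :: "real^'n"
  shows "\<exists>k. (\<forall>i. k $ i \<in> \<int>) \<and> x \<in> lattice_cell k \<and> ((\<forall>i. \<bar>x $ i\<bar> \<le> real K) \<longrightarrow> k \<in> lattice_box K)"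
proof (intro exI conjI impI allI)
  let ?k = "\<chi> i. real_of_int \<lfloor>x $ i + 1/2\<rfloor>"
  show "?k $ i \<in> \<int>" for i by simp
  show "x \<in> lattice_cell ?k" unfolding lattice_cell_def by auto linarith+
  assume x: "\<forall>i. \<bar>x $ i\<bar> \<le> real K"
  have "\<lfloor>x $ i + 1/2\<rfloor> \<in> {- int K..int K}" for i
  proof -
    have "- real K \<le> x $ i" "x $ i \<le> real K" using spec[OF x, of i] by auto
    then show ?thesis by (auto simp: le_floor_iff floor_le_iff)
  qed
  then show "?k \<in> lattice_box K" unfolding lattice_box_def by auto
qed

lemma lattice_box_Ints: "k \<in> lattice_box K \<Longrightarrow> k $ i \<in> \<int>"
  by (auto simp: lattice_box_def dest!: spec[of _ i])

section \<open>Bump functions\<close>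

lemma grad_radial:
  fixes a :: "real^'n"
  assumes "(g has_real_derivative g') (at ((norm (x - a))\<^sup>2))"
  shows "grad (\<lambda>x. g ((norm (x - a))\<^sup>2)) x = (2 * g') *\<^sub>R (x - a)"
  by (rule grad_eqI[OF has_derivative_radial[OF assms]])

lemma radial_integration_by_parts:
  fixes \<psi> :: "real^'n \<Rightarrow> real"
  assumes \<psi>: "\<psi> \<in> test_functions \<Omega>"
    and g: "\<And>s. (g has_real_derivative g' s) (at s)" "continuous_on UNIV g'"
  shows "(\<integral>x. grad \<psi> x \<bullet> (g ((norm (x - a))\<^sup>2) *\<^sub>R (x - a)) \<partial>lborel)
    = - (\<integral>x. \<psi> x * (real CARD('n) * g ((norm (x - a))\<^sup>2) + 2 * (norm (x - a))\<^sup>2 * g' ((norm (x - a))\<^sup>2)) \<partial>lborel)"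
proof -
  let ?K = "closure {x. \<psi> x \<noteq> 0}"
  have K: "bounded ?K" "\<And>x. x \<notin> ?K \<Longrightarrow> \<psi> x = 0" "\<And>x. x \<notin> ?K \<Longrightarrow> grad \<psi> x = 0"
    using test_functionsD(6)[OF \<psi>] test_functionsD(5)[OF \<psi>] closure_subset[of "{x. \<psi> x \<noteq> 0}"] by auto
  have c1: "class_C (Suc 0) \<psi>" by (rule test_functionsD(1)[OF \<psi>])
  have cg: "continuous_on UNIV g" by (intro continuous_at_imp_continuous_on ballI) (rule DERIV_isCont[OF g(1)])
  have cg1: "continuous_on UNIV (\<lambda>x. g ((norm (x - a))\<^sup>2))" "continuous_on UNIV (\<lambda>x. g' ((norm (x - a))\<^sup>2))"
    by (rule continuous_on_compose2[OF cg _ subset_UNIV] continuous_on_compose2[OF g(2) _ subset_UNIV], intro continuous_intros)+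
  note c = class_C_continuous[OF c1] class_C_continuous_grad[OF c1] cg1
  have c2: "continuous_on UNIV (\<lambda>x. (norm (x - a))\<^sup>2)" by (intro continuous_intros)
  have 1: "integrable lborel (\<lambda>x. grad \<psi> x \<bullet> (g ((norm (x - a))\<^sup>2) *\<^sub>R (x - a)))"
    by (rule integrable_continuous_support[OF _ K(1)], intro continuous_intros c) (drule K(3), simp)
  have 2: "integrable lborel (\<lambda>x. \<psi> x * (real CARD('n) * g ((norm (x - a))\<^sup>2) + 2 * (norm (x - a))\<^sup>2 * g' ((norm (x - a))\<^sup>2)))"
    by (rule integrable_continuous_support[OF _ K(1)], intro continuous_on_mult continuous_on_add continuous_on_const c c2)
      (drule K(2), simp)
  have "(\<integral>x. grad \<psi> x \<bullet> (g ((norm (x - a))\<^sup>2) *\<^sub>R (x - a))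
    + \<psi> x * (real CARD('n) * g ((norm (x - a))\<^sup>2) + 2 * (norm (x - a))\<^sup>2 * g' ((norm (x - a))\<^sup>2)) \<partial>lborel) = 0"
    by (rule integral_radial_divergence[OF c1 g K(1)]) (drule K(2), simp)
  then show ?thesis using 1 2 by simp
qed

text \<open>The supports of the data are estimated by cubes, not balls, because the volume is then
  an explicit power.\<close>

lemma measure_cube:
  fixes k :: "real^'n"
  assumes "0 \<le> r"
  shows "emeasure lborel (cbox (k - (\<chi> i. r)) (k + (\<chi> i. r))) = ennreal ((2 * r) ^ CARD('n))"
proof -
  have eq: "(\<Prod>b\<in>Basis. ((k + (\<chi> i. r)) - (k - (\<chi> i. r))) \<bullet> b) = (\<Prod>b\<in>(Basis::(real^'n) set). 2 * r)"
    by (rule prod.cong) (auto simp: Basis_vec_def inner_axis)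
  have "emeasure lborel (cbox (k - (\<chi> i. r)) (k + (\<chi> i. r))) = ennreal (\<Prod>b\<in>Basis. ((k + (\<chi> i. r)) - (k - (\<chi> i. r))) \<bullet> b)"
    by (rule emeasure_lborel_cbox) (use assms in \<open>auto simp: Basis_vec_def inner_axis\<close>)
  then show ?thesis unfolding eq by simp
qed

lemma mem_cube:
  fixes x k :: "real^'n"
  assumes "norm (x - k) \<le> r"
  shows "x \<in> cbox (k - (\<chi> i. r)) (k + (\<chi> i. r))"
proof -
  have "k $ i - r \<le> x $ i \<and> x $ i \<le> k $ i + r" for i
    using component_le_norm_cart[of "x - k" i] assms by (simp only: vector_minus_component) linarith
  then show ?thesis by (simp add: mem_box_cart)
qed

section \<open>The radial cutoff and its scaling\<close>

locale smooth_step =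
  fixes st st' st'' :: "real \<Rightarrow> real"
  assumes st: "\<And>s. (st has_real_derivative st' s) (at s)"
    and st': "\<And>s. (st' has_real_derivative st'' s) (at s)"
    and smooth: "smooth1 st" "smooth1 st'" "smooth1 st''"
    and st'_nonneg: "\<And>s. 0 \<le> st' s"
    and st_0: "\<And>s. s \<le> 1 \<Longrightarrow> st s = 0" and st_1: "\<And>s. 2 \<le> s \<Longrightarrow> st s = 1"
    and st'_pos: "\<And>s. 1 < s \<Longrightarrow> s < 2 \<Longrightarrow> 0 < st' s"
    and st'_0: "\<And>s. s \<le> 1 \<or> 2 \<le> s \<Longrightarrow> st' s = 0"
begin

lemma st_range: "0 \<le> st s" "st s \<le> 1"
proof -
  have "st (min s 1) \<le> st s" "st s \<le> st (max s 2)"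
    by (rule deriv_nonneg_imp_le[OF st st'_nonneg]; simp)+
  then show "0 \<le> st s" "st s \<le> 1" using st_0[of "min s 1"] st_1[of "max s 2"] by auto
qed

lemma st''_0:
  assumes "s < 1 \<or> 2 < s"
  shows "st'' s = 0"
proof -
  have ev: "\<forall>\<^sub>F t in nhds s. t < 1 \<or> 2 < t"
    using eventually_nhds_in_open[of "{..<1} \<union> {2<..}" s] assms by (auto simp: open_Un)
  have "\<forall>\<^sub>F t in nhds s. st' t = 0" using ev by eventually_elim (auto intro: st'_0)
  then have "(st' has_real_derivative 0) (at s)" using DERIV_cong_ev[of s s st' "\<lambda>_. 0" 0 0] by simp
  then show ?thesis using st' DERIV_unique by blast
qed

lemma st_bounds_exist: "\<exists>B\<ge>1. \<forall>s. \<bar>st' s\<bar> \<le> B \<and> \<bar>st'' s\<bar> \<le> B"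
proof -
  obtain B1 where B1: "0 \<le> B1" "\<And>s. norm (st' s) \<le> B1"
    by (rule continuous_bounded_support_imp_bounded[OF smooth1_continuous[OF smooth(2)], of "{1..2}"])
      (auto intro: st'_0)
  obtain B2 where B2: "0 \<le> B2" "\<And>s. norm (st'' s) \<le> B2"
    by (rule continuous_bounded_support_imp_bounded[OF smooth1_continuous[OF smooth(3)], of "{1..2}"])
      (auto intro: st''_0)
  have "\<bar>st' s\<bar> \<le> B1 + B2 + 1 \<and> \<bar>st'' s\<bar> \<le> B1 + B2 + 1" for s
    using B1(1) B1(2)[of s] B2(1) B2(2)[of s] by simp
  then show ?thesis using B1(1) B2(1) by (intro exI[of _ "B1 + B2 + 1"]) auto
qed

text \<open>One bound for both derivatives, chosen once for the profile, so that the estimates for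
  all values of \<eta> share it.\<close>

definition SB :: real where "SB = (SOME B. B \<ge> 1 \<and> (\<forall>s. \<bar>st' s\<bar> \<le> B \<and> \<bar>st'' s\<bar> \<le> B))"

lemma SB: "1 \<le> SB" "\<bar>st' s\<bar> \<le> SB" "\<bar>st'' s\<bar> \<le> SB"
proof -
  have "\<exists>B. B \<ge> 1 \<and> (\<forall>s. \<bar>st' s\<bar> \<le> B \<and> \<bar>st'' s\<bar> \<le> B)" using st_bounds_exist by blast
  from someI_ex[OF this] show "1 \<le> SB" "\<bar>st' s\<bar> \<le> SB" "\<bar>st'' s\<bar> \<le> SB" unfolding SB_def by blast+
qed

text \<open>Equal to 1 up to distance \<open>r\<close> from \<open>a\<close> and to 0 from distance
  sqrt 2 * r on; the later radius 2 * r is a convenient upper bound for the latter.\<close>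

definition bump :: "real \<Rightarrow> real^'n \<Rightarrow> real^'n \<Rightarrow> real" where
  "bump r a x = 1 - st ((norm (x - a))\<^sup>2 / r\<^sup>2)"

text \<open>The Laplacian of \<open>bump r a\<close>, as the divergence d g + 2 s g' of the radial
  field with coefficient g(s) = - (2/r^2) st'(s/r^2).\<close>

definition lap_bump :: "real \<Rightarrow> real^'n \<Rightarrow> real^'n \<Rightarrow> real" where
  "lap_bump r a x = real CARD('n) * (- (2 / r\<^sup>2) * st' ((norm (x - a))\<^sup>2 / r\<^sup>2))
    + 2 * (norm (x - a))\<^sup>2 * (- (2 / r\<^sup>2) * (st'' ((norm (x - a))\<^sup>2 / r\<^sup>2) / r\<^sup>2))"

lemma bump_deriv: "((\<lambda>s. 1 - st (s / r\<^sup>2)) has_real_derivative - (st' (s / r\<^sup>2) / r\<^sup>2)) (at s)"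
proof -
  have "((\<lambda>s. st (s / r\<^sup>2)) has_real_derivative st' (s / r\<^sup>2) * (1 / r\<^sup>2)) (at s)"
    by (rule DERIV_chain2[OF st DERIV_cdivide[OF DERIV_ident]])
  then show ?thesis by (auto intro!: derivative_eq_intros)
qed

lemma class_C_bump: "class_C k (bump r a)"
proof -
  have "smooth1 (\<lambda>s. 1 - st ((1 / r\<^sup>2) * s + 0))"
    by (intro smooth1_diff smooth1_const smooth1_affine smooth)
  then have "smooth1 (\<lambda>s. 1 - st (s / r\<^sup>2))" by simp
  from class_C_radial[OF this] show ?thesis by (simp add: bump_def[abs_def])
qed

lemma grad_bump: "grad (bump r a) x = (- (2 / r\<^sup>2) * st' ((norm (x - a))\<^sup>2 / r\<^sup>2)) *\<^sub>R (x - a)"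
  unfolding bump_def[abs_def] by (subst grad_radial[OF bump_deriv]) simp

lemma bump_range: "0 \<le> bump r a x" "bump r a x \<le> 1"
  using st_range[of "(norm (x - a))\<^sup>2 / r\<^sup>2"] by (auto simp: bump_def)

lemma bump_eq_1: "0 < r \<Longrightarrow> (norm (x - a))\<^sup>2 \<le> r\<^sup>2 \<Longrightarrow> bump r a x = 1"
  by (simp add: bump_def st_0)

lemma bump_outside:
  assumes "0 < r" "2 * r\<^sup>2 \<le> (norm (x - a))\<^sup>2"
  shows "bump r a x = 0" "grad (bump r a) x = 0" 
proof -
  have *: "2 \<le> (norm (x - a))\<^sup>2 / r\<^sup>2" using assms by (simp add: pos_le_divide_eq)
  show "bump r a x = 0" using st_1[OF *] by (simp add: bump_def)
  show "grad (bump r a) x = 0" using st'_0[OF disjI2[OF *]] by (simp add: grad_bump)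
qed

lemma lap_bump_outside:
  assumes "0 < r" "2 * r\<^sup>2 < (norm (x - a))\<^sup>2"
  shows "lap_bump r a x = 0" 
proof -
  have *: "2 < (norm (x - a))\<^sup>2 / r\<^sup>2" using assms by (simp add: pos_less_divide_eq)
  show "lap_bump r a x = 0" using st'_0[OF disjI2[OF less_imp_le[OF *]]] st''_0[OF disjI2[OF *]] by (simp add: lap_bump_def)
qed

lemma norm_le_of_sq: "0 < r \<Longrightarrow> (norm y)\<^sup>2 \<le> 2 * r\<^sup>2 \<Longrightarrow> norm y \<le> 2 * r"
proof -
  assume "0 < r" "(norm y)\<^sup>2 \<le> 2 * r\<^sup>2"
  then have "(norm y)\<^sup>2 \<le> (2 * r)\<^sup>2" by (simp add: power_mult_distrib) (use zero_le_power2[of r] in linarith)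
  then show "norm y \<le> 2 * r" by (rule power2_le_imp_le) (use \<open>0 < r\<close> in simp)
qed

lemma norm_grad_bump_le:
  assumes r: "0 < r"
  shows "norm (grad (bump r a) x) \<le> 4 * SB / r"
proof (cases "2 * r\<^sup>2 \<le> (norm (x - a))\<^sup>2")
  case True
  then show ?thesis using bump_outside[OF r True] SB(1) r by simp
next
  case False
  then have n: "norm (x - a) \<le> 2 * r" using norm_le_of_sq[OF r, of "x - a"] by simp
  have "norm (grad (bump r a) x) = 2 / r\<^sup>2 * \<bar>st' ((norm (x - a))\<^sup>2 / r\<^sup>2)\<bar> * norm (x - a)"
    using r by (simp add: grad_bump abs_mult)
  also have "\<dots> \<le> 2 / r\<^sup>2 * SB * (2 * r)" using r n SB by (intro mult_mono) auto
  also have "\<dots> = 4 * SB / r" using r by (simp add: power2_eq_square field_simps)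
  finally show ?thesis .
qed

lemma abs_lap_bump_le:
  fixes x :: "real^'n"
  assumes r: "0 < r"
  shows "\<bar>lap_bump r a x\<bar> \<le> (2 * real CARD('n) + 8) * SB / r\<^sup>2"
proof (cases "2 * r\<^sup>2 < (norm (x - a))\<^sup>2")
  case True
  then show ?thesis using lap_bump_outside[OF r True] SB(1) r by simp
next
  case False
  let ?s = "(norm (x - a))\<^sup>2"
  have "\<bar>lap_bump r a x\<bar> \<le> \<bar>real CARD('n) * (- (2 / r\<^sup>2) * st' (?s / r\<^sup>2))\<bar> + \<bar>2 * ?s * (- (2 / r\<^sup>2) * (st'' (?s / r\<^sup>2) / r\<^sup>2))\<bar>"
    unfolding lap_bump_def by (rule abs_triangle_ineq)
  also have "\<bar>real CARD('n) * (- (2 / r\<^sup>2) * st' (?s / r\<^sup>2))\<bar> = real CARD('n) * (2 / r\<^sup>2) * \<bar>st' (?s / r\<^sup>2)\<bar>"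
    by (simp add: abs_mult)
  also have "\<dots> \<le> real CARD('n) * (2 / r\<^sup>2) * SB" using SB by (intro mult_left_mono) auto
  also have "\<bar>2 * ?s * (- (2 / r\<^sup>2) * (st'' (?s / r\<^sup>2) / r\<^sup>2))\<bar> = (4 / (r\<^sup>2 * r\<^sup>2)) * ?s * \<bar>st'' (?s / r\<^sup>2)\<bar>"
    by (simp add: abs_mult)
  also have "\<dots> \<le> (4 / (r\<^sup>2 * r\<^sup>2)) * (2 * r\<^sup>2) * SB" using SB False by (intro mult_mono) auto
  also have "real CARD('n) * (2 / r\<^sup>2) * SB + (4 / (r\<^sup>2 * r\<^sup>2)) * (2 * r\<^sup>2) * SB = (2 * real CARD('n) + 8) * SB / r\<^sup>2"
    using r by (simp add: field_simps)
  finally show ?thesis by simp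
qed

lemma continuous_lap_bump: "continuous_on UNIV (lap_bump r a)"
proof -
  have c: "continuous_on UNIV (\<lambda>x. f ((norm (x - a))\<^sup>2 / r\<^sup>2))" if "smooth1 f" for f
    unfolding divide_inverse by (intro continuous_on_compose2[OF smooth1_continuous[OF that, of UNIV]] continuous_intros) auto
  show ?thesis unfolding lap_bump_def[abs_def] divide_inverse[of _ "r\<^sup>2"]
    using c[OF smooth(2)] c[OF smooth(3)] unfolding divide_inverse by (intro continuous_intros)
qed

lemma bump_integration_by_parts:
  assumes "\<psi> \<in> test_functions \<Omega>"
  shows "(\<integral>x. grad \<psi> x \<bullet> grad (bump r a) x \<partial>lborel) = - (\<integral>x. \<psi> x * lap_bump r a x \<partial>lborel)"
  unfolding grad_bump lap_bump_def
proof (rule radial_integration_by_parts[OF assms])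
  show "((\<lambda>s. - (2 / r\<^sup>2) * st' (s / r\<^sup>2)) has_real_derivative - (2 / r\<^sup>2) * (st'' (s / r\<^sup>2) / r\<^sup>2)) (at s)" for s
  proof -
    have "((\<lambda>s. st' (s / r\<^sup>2)) has_real_derivative st'' (s / r\<^sup>2) * (1 / r\<^sup>2)) (at s)"
      by (rule DERIV_chain2[OF st' DERIV_cdivide[OF DERIV_ident]])
    from DERIV_cmult[OF this, of "- (2 / r\<^sup>2)"] show ?thesis by simp
  qed
  show "continuous_on UNIV (\<lambda>s. - (2 / r\<^sup>2) * (st'' (s / r\<^sup>2) / r\<^sup>2))"
    unfolding divide_inverse by (intro continuous_intros continuous_on_compose2[OF smooth1_continuous[OF smooth(3), of UNIV]]) auto
qed

text \<open>Under dilation by \<open>r\<close> gradients scale like 1/r and volumes like r^d, whence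
  the energy r^(d-2). Positivity comes from a point with |x|^2 = 3/2, in the middle of the
  transition layer.\<close>

lemma grad_bump_sq_integral:
  shows "0 < (\<integral>x. (norm (grad (bump 1 (0::real^'n)) x))\<^sup>2 \<partial>lborel)"
    "0 < r \<Longrightarrow> sq_int lborel (grad (bump r (a::real^'n)))"
    "0 < r \<Longrightarrow> (\<integral>x. (norm (grad (bump r (0::real^'n)) x))\<^sup>2 \<partial>lborel)
      = r ^ CARD('n) / r\<^sup>2 * (\<integral>x. (norm (grad (bump 1 (0::real^'n)) x))\<^sup>2 \<partial>lborel)"
proof -
  have c: "continuous_on UNIV (grad (bump r a))" for r and a :: "real^'n"
    by (rule class_C_continuous_grad[OF class_C_bump])
  have i: "integrable lborel (\<lambda>x. (norm (grad (bump r a) x))\<^sup>2)" if r: "0 < r" for r and a :: "real^'n"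
  proof (rule integrable_continuous_support[of _ "cball a (2 * r)"])
    show "continuous_on UNIV (\<lambda>x. (norm (grad (bump r a) x))\<^sup>2)" using c by (intro continuous_intros)
    show "(norm (grad (bump r a) x))\<^sup>2 = 0" if "x \<notin> cball a (2 * r)" for x
      using that norm_le_of_sq[OF r, of "x - a"] bump_outside(2)[OF r, of x a] by (force simp: dist_norm norm_minus_commute)
  qed simp
  show "sq_int lborel (grad (bump r a))" if "0 < r" for a :: "real^'n" and r
    using i[OF that] c[of r a] by (auto simp: sq_int_def intro: borel_measurable_continuous_onI)
  show "0 < (\<integral>x. (norm (grad (bump 1 (0::real^'n)) x))\<^sup>2 \<partial>lborel)"
  proof (rule integral_pos_if_continuous[OF i])
    fix j :: 'n
    let ?x = "axis j (sqrt (3/2)) :: real^'n"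
    have n: "(norm ?x)\<^sup>2 = 3/2" by (simp add: power2_norm_eq_inner inner_axis)
    have "0 < st' ((norm ?x)\<^sup>2)" unfolding n by (rule st'_pos) auto
    moreover have "?x \<noteq> 0" using n by auto
    ultimately show "0 < (norm (grad (bump 1 0) ?x))\<^sup>2" by (simp add: grad_bump)
    show "continuous_on UNIV (\<lambda>x. (norm (grad (bump 1 (0::real^'n)) x))\<^sup>2)" using c by (intro continuous_intros)
  qed auto
  assume r: "0 < r"
  have [measurable]: "grad (bump r (0::real^'n)) \<in> borel_measurable borel" by (rule borel_measurable_continuous_onI[OF c])
  have g: "grad (bump r (0::real^'n)) (r *\<^sub>R x) = (1 / r) *\<^sub>R grad (bump 1 0) x" for x
    using r by (simp add: grad_bump power_mult_distrib power2_eq_square)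
  have "(\<integral>x. (norm (grad (bump r (0::real^'n)) x))\<^sup>2 \<partial>lborel) = r ^ CARD('n) * (\<integral>x. (norm (grad (bump r (0::real^'n)) (r *\<^sub>R x)))\<^sup>2 \<partial>lborel)"
    using lborel_integral_scale(1)[of "\<lambda>x. (norm (grad (bump r (0::real^'n)) x))\<^sup>2" r] r by simp
  also have "\<dots> = r ^ CARD('n) / r\<^sup>2 * (\<integral>x. (norm (grad (bump 1 (0::real^'n)) x))\<^sup>2 \<partial>lborel)"
    unfolding g using r by (simp add: power_divide power_mult_distrib)
  finally show "(\<integral>x. (norm (grad (bump r (0::real^'n)) x))\<^sup>2 \<partial>lborel)
      = r ^ CARD('n) / r\<^sup>2 * (\<integral>x. (norm (grad (bump 1 (0::real^'n)) x))\<^sup>2 \<partial>lborel)" .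
qed

end

section \<open>Truncated Newtonian potentials\<close>

context smooth_step
begin

text \<open>In s = |x - k|^2 this is 1 on [a^2, 1/16] and 0 for s \<le> a^2/2 and for s \<ge> 1/8.
  The factor 16 keeps the outer transition strictly inside the cell of \<open>k\<close>.\<close>

definition cut :: "real \<Rightarrow> real \<Rightarrow> real" where
  "cut a s = (1 - st (16 * s)) * st (2 / a\<^sup>2 * s)"

definition cut' :: "real \<Rightarrow> real \<Rightarrow> real" where
  "cut' a s = - 16 * st' (16 * s) * st (2 / a\<^sup>2 * s) + (1 - st (16 * s)) * (2 / a\<^sup>2 * st' (2 / a\<^sup>2 * s))"

text \<open>For \<open>e = - d/2\<close> the field \<open>- pole e a (|x|\<^sup>2) x\<close> is the gradient of the Newtonian potential, truncated
  inside the hole of radius \<open>a\<close> and outside the unit cell.\<close>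

definition pole :: "real \<Rightarrow> real \<Rightarrow> real \<Rightarrow> real" where
  "pole e a s = s powr e * cut a s"

definition pole' :: "real \<Rightarrow> real \<Rightarrow> real \<Rightarrow> real" where
  "pole' e a s = e * (s powr (e - 1) * cut a s) + s powr e * cut' a s"

text \<open>The source created by the outer cutoff: minus the term 2 s^e cut' of the divergence of a
  \<open>pole\<close> of exponent e - 1, outside the hole. The factor 32 is 2 times the 16 of the
  cutoff.\<close>

definition beta :: "real \<Rightarrow> real \<Rightarrow> real" where
  "beta e s = s powr e * (32 * st' (16 * s))"

lemma deriv_st_mult: "((\<lambda>s. st (c * s)) has_real_derivative c * st' (c * s)) (at s)"
proof -
  have "((\<lambda>s. st (c * s)) has_real_derivative st' (c * s) * (c * 1)) (at s)"
    by (rule DERIV_chain2[OF st DERIV_cmult[OF DERIV_ident]])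
  then show ?thesis by (simp add: mult.commute)
qed

lemma deriv_cut: "(cut a has_real_derivative cut' a s) (at s)"
  unfolding cut_def[abs_def] cut'_def
  by (rule DERIV_cong[OF DERIV_mult[OF DERIV_diff[OF DERIV_const deriv_st_mult] deriv_st_mult]]) (simp add: algebra_simps)

lemma smooth1_cut: "smooth1 (cut a)"
  using smooth1_affine[OF smooth(1), of 16 0] smooth1_affine[OF smooth(1), of "2 / a\<^sup>2" 0]
  unfolding cut_def[abs_def] by (intro smooth1_mult smooth1_diff smooth1_const) simp_all

lemma cut_range: "0 \<le> cut a s" "cut a s \<le> 1"
  using st_range[of "16 * s"] st_range[of "2 / a\<^sup>2 * s"] by (auto simp: cut_def intro: mult_le_one)

lemma cut_0:
  assumes "0 < a" "s \<le> a\<^sup>2 / 2 \<or> 1/8 \<le> s"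
  shows "cut a s = 0" "cut' a s = 0"
proof -
  have "(2 / a\<^sup>2 * s \<le> 1) \<or> 2 \<le> 16 * s" using assms by (auto simp: field_simps)
  then show "cut a s = 0" "cut' a s = 0"
    using st_0[of "2 / a\<^sup>2 * s"] st'_0[of "2 / a\<^sup>2 * s"] st_1[of "16 * s"] st'_0[of "16 * s"] by (auto simp: cut_def cut'_def)
qed

lemma cut'_eq: "0 < a \<Longrightarrow> a\<^sup>2 \<le> s \<Longrightarrow> cut' a s = - 16 * st' (16 * s)"
  using st_1[of "2 / a\<^sup>2 * s"] st'_0[of "2 / a\<^sup>2 * s"] by (simp add: cut'_def field_simps)

text \<open>The inner cutoff increases and contributes only positively. This sign is why the radius
  \<open>a\<close> can disappear from a one-sided estimate.\<close>

lemma cut'_ge: "- 16 * st' (16 * s) \<le> cut' a s"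
proof -
  have "st' (16 * s) * st (2 / a\<^sup>2 * s) \<le> st' (16 * s) * 1" by (intro mult_left_mono st_range st'_nonneg)
  moreover have "0 \<le> (1 - st (16 * s)) * (2 / a\<^sup>2 * st' (2 / a\<^sup>2 * s))"
    using st_range[of "16 * s"] st'_nonneg by (intro mult_nonneg_nonneg) auto
  ultimately show ?thesis by (simp add: cut'_def)
qed

lemma smooth1_pole: "0 < a \<Longrightarrow> smooth1 (pole e a)"
  unfolding pole_def[abs_def] by (rule smooth1_powr_mult[OF smooth1_cut, of "a\<^sup>2 / 2"]) (auto intro: cut_0)

lemma deriv_pole:
  assumes a: "0 < a"
  shows "(pole e a has_real_derivative pole' e a s) (at s)"
proof (cases "0 < s")
  case True
  then show ?thesis unfolding pole_def[abs_def] pole'_def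
    by (intro DERIV_cong[OF DERIV_mult[OF _ deriv_cut]]) (auto intro!: derivative_eq_intros simp: algebra_simps)
next
  case False
  have "0 < a\<^sup>2 / 2" using a by simp
  then have lt: "s < a\<^sup>2 / 2" using False by linarith
  then have "\<forall>\<^sub>F t in nhds s. t < a\<^sup>2 / 2" using eventually_nhds_in_open[of "{..<a\<^sup>2 / 2}" s] by simp
  then have "\<forall>\<^sub>F t in nhds s. pole e a t = 0" by eventually_elim (simp add: pole_def cut_0[OF a])
  then have "(pole e a has_real_derivative 0) (at s)" using DERIV_cong_ev[of s s "pole e a" "\<lambda>_. 0" 0 0] by simp
  then show ?thesis using cut_0[OF a, of s] lt by (simp add: pole'_def)
qed

lemma continuous_pole': "0 < a \<Longrightarrow> continuous_on UNIV (pole' e a)"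
proof -
  assume a: "0 < a"
  obtain g' where "\<And>s. (pole e a has_real_derivative g' s) (at s)" "smooth1 g'" using smooth1D[OF smooth1_pole[OF a]] by blast
  then show ?thesis using deriv_pole[OF a] DERIV_unique smooth1_continuous by (metis ext)
qed

text \<open>Two exponents matter. For e = - d/2 the first term vanishes, since the Newtonian field
  is divergence free away from its centre. For e = 1/2 - d/2 the coefficient d + 2 e is 1, so the
  length |x|^(1-d) of that field is itself a divergence up to cutoff terms.\<close>

lemma pole_divergence:
  assumes a: "0 < a" and s: "0 \<le> s"
  shows "d * pole e a s + 2 * s * pole' e a s = (d + 2 * e) * pole e a s + 2 * (s powr (e + 1) * cut' a s)"
proof (cases "s = 0")
  case True
  then show ?thesis using cut_0[OF a, of 0] by (simp add: pole_def pole'_def)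
next
  case False
  then have "s * s powr (e - 1) = s powr e" "s * s powr e = s powr (e + 1)" using s by (simp_all add: powr_diff powr_add)
  then have "s * (s powr (e - 1) * cut a s) = pole e a s" "s * (s powr e * cut' a s) = s powr (e + 1) * cut' a s"
    by (simp_all add: pole_def flip: mult.assoc)
  then have "s * pole' e a s = e * pole e a s + s powr (e + 1) * cut' a s"
    unfolding pole'_def by (simp add: distrib_left mult.left_commute[of s e])
  then show ?thesis by (simp add: algebra_simps)
qed

lemma smooth1_beta: "smooth1 (beta e)"
proof -
  have "smooth1 (\<lambda>s. 32 * st' (16 * s + 0))" by (intro smooth1_mult smooth1_const smooth1_affine smooth)
  then have "smooth1 (\<lambda>s. 32 * st' (16 * s))" by simp
  then show ?thesis unfolding beta_def[abs_def]
    by (rule smooth1_powr_mult[where c="1/16"]) (auto intro!: st'_0)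
qed

lemma beta_props: "0 \<le> beta e s" "1/8 \<le> s \<Longrightarrow> beta e s = 0" "0 < beta e (3/32)"
  using st'_nonneg[of "16 * s"] st'_0[of "16 * s"] st'_pos[of "3/2"] by (auto simp: beta_def)

lemma integrable_radial:
  fixes k :: "real^'n" and g :: "real \<Rightarrow> real"
  assumes "continuous_on UNIV g" "\<And>s. 1/8 \<le> s \<Longrightarrow> g s = 0"
  shows "continuous_on UNIV (\<lambda>x. g ((norm (x - k))\<^sup>2))" "integrable lborel (\<lambda>x. g ((norm (x - k))\<^sup>2))"
proof -
  show c: "continuous_on UNIV (\<lambda>x. g ((norm (x - k))\<^sup>2))"
    by (rule continuous_on_compose2[OF assms(1) _ subset_UNIV]) (intro continuous_intros)
  show "integrable lborel (\<lambda>x. g ((norm (x - k))\<^sup>2))"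
  proof (rule integrable_continuous_support[OF c bounded_cball])
    fix x assume "x \<notin> cball k 1"
    then have "1 \<le> (norm (x - k))\<^sup>2" by (simp add: dist_norm norm_minus_commute)
    then show "g ((norm (x - k))\<^sup>2) = 0" by (intro assms(2)) simp
  qed
qed

lemma integral_beta:
  fixes k :: "real^'n"
  shows "0 < (\<integral>x. beta e ((norm (x::real^'n))\<^sup>2) \<partial>lborel)"
    "(\<integral>x. beta e ((norm (x - k))\<^sup>2) \<partial>lborel) = (\<integral>x. beta e ((norm (x::real^'n))\<^sup>2) \<partial>lborel)"
    "integrable lborel (\<lambda>x. beta e ((norm (x - k))\<^sup>2))"
    "continuous_on UNIV (\<lambda>x. beta e ((norm (x - k))\<^sup>2))"
proof -
  note b = integrable_radial[OF smooth1_continuous[OF smooth1_beta] beta_props(2), where ?'n='n, of e]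
  show "integrable lborel (\<lambda>x. beta e ((norm (x - k))\<^sup>2))" "continuous_on UNIV (\<lambda>x. beta e ((norm (x - k))\<^sup>2))"
    using b by auto
  have m: "(\<lambda>x::real^'n. beta e ((norm x)\<^sup>2)) \<in> borel_measurable borel"
    using borel_measurable_continuous_onI[OF b(1)[of 0]] by simp
  show "(\<integral>x. beta e ((norm (x - k))\<^sup>2) \<partial>lborel) = (\<integral>x. beta e ((norm (x::real^'n))\<^sup>2) \<partial>lborel)"
    using lborel_integral_translate[OF m, of "- k"] by simp
  show "0 < (\<integral>x. beta e ((norm (x::real^'n))\<^sup>2) \<partial>lborel)"
  proof (rule integral_pos_if_continuous)
    fix j :: 'n
    \<comment> \<open>At s = 3/32 the argument 16 s is 3/2, inside the transition interval (1,
      2).\<close>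
    let ?x = "axis j (sqrt (3/32)) :: real^'n"
    have n: "(norm ?x)\<^sup>2 = 3/32" by (simp add: power2_norm_eq_inner inner_axis)
    show "0 < beta e ((norm ?x)\<^sup>2)" unfolding n by (rule beta_props)
  qed (use b[of 0] beta_props(1) in auto)
qed

text \<open>The length of \<open>y\<close> is the power 1/2 of s, so the length of a truncated field
  is again a \<open>pole\<close>. For the Newtonian exponent this is |y|^(1-d), to which the
  integral bound applies.\<close>

lemma norm_pole_scaleR:
  fixes y :: "real^'n"
  assumes "0 < a"
  shows "norm (pole (- e) a ((norm y)\<^sup>2) *\<^sub>R y) = pole (1/2 - e) a ((norm y)\<^sup>2)"
proof (cases "y = 0")
  case True
  then show ?thesis using cut_0(1)[OF assms, of 0] by (simp add: pole_def)
next
  case False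
  have h: "((norm y)\<^sup>2) powr (1/2) = norm y" by (simp add: powr_half_sqrt)
  have "((norm y)\<^sup>2) powr (- e) * ((norm y)\<^sup>2) powr (1/2) = ((norm y)\<^sup>2) powr (1/2 - e)"
    by (subst powr_add[symmetric]) (simp add: algebra_simps)
  then have "((norm y)\<^sup>2) powr (- e) * norm y = ((norm y)\<^sup>2) powr (1/2 - e)" unfolding h .
  moreover have "norm (pole (- e) a ((norm y)\<^sup>2) *\<^sub>R y) = cut a ((norm y)\<^sup>2) * (((norm y)\<^sup>2) powr (- e) * norm y)"
    using cut_range(1)[of a "(norm y)\<^sup>2"] by (simp add: pole_def abs_mult)
  ultimately show ?thesis by (simp add: pole_def mult.commute)
qed

lemma pole_nonneg: "0 \<le> pole e a s"
  using cut_range(1) by (simp add: pole_def)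

lemma pole_0: "0 < a \<Longrightarrow> s \<le> a\<^sup>2 / 2 \<or> 1/8 \<le> s \<Longrightarrow> pole e a s = 0"
  by (simp add: pole_def cut_0)

lemma pole_le:
  assumes a: "0 < a" and e: "e \<le> 0"
  shows "pole e a s \<le> (a\<^sup>2 / 2) powr e"
proof (cases "s \<le> a\<^sup>2 / 2")
  case True
  then show ?thesis using pole_0[OF a] by simp
next
  case False
  have "pole e a s \<le> s powr e * 1" unfolding pole_def using cut_range by (intro mult_left_mono) auto
  also have "\<dots> \<le> (a\<^sup>2 / 2) powr e" using False a e by (simp add: powr_mono2')
  finally show ?thesis .
qed

text \<open>The divergence theorem turns the integral of \<open>|x|\<^sup>1\<^sup>-\<^sup>d\<close> into one over the region where the cutoff
  varies, so that the bound does not depend on the radius \<open>a\<close> of the hole.\<close>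

lemma integral_pole_le:
  fixes k :: "real^'n"
  assumes a: "0 < a"
  shows "(\<integral>x. pole (1/2 - real CARD('n) / 2) a ((norm (x - k))\<^sup>2) \<partial>lborel)
    \<le> (\<integral>x. beta (3/2 - real CARD('n) / 2) ((norm (x::real^'n))\<^sup>2) \<partial>lborel)"
proof -
  define e where "e = 1/2 - real CARD('n) / 2"
  let ?s = "\<lambda>x. (norm (x - k))\<^sup>2"
  define D where "D x = real CARD('n) * pole e a (?s x) + 2 * ?s x * pole' e a (?s x)" for x
  have cp: "continuous_on UNIV (pole e a)" by (rule smooth1_continuous[OF smooth1_pole[OF a]])
  have p: "integrable lborel (\<lambda>x. pole e a (?s x))" by (rule integrable_radial[OF cp]) (rule pole_0[OF a], simp)
  have cD: "continuous_on UNIV (\<lambda>s. real CARD('n) * pole e a s + 2 * s * pole' e a s)"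
    by (intro continuous_intros cp continuous_pole' a)
  have iD: "integrable lborel D" unfolding D_def
    by (rule integrable_radial(2)[OF cD]) (simp add: pole_0[OF a] pole'_def cut_0[OF a])
  have "(\<integral>x. grad (\<lambda>x. 1) x \<bullet> (pole e a (?s x) *\<^sub>R (x - k)) + 1 * (real CARD('n) * pole e a (?s x) + 2 * ?s x * pole' e a (?s x)) \<partial>lborel) = 0"
  proof (rule integral_radial_divergence[OF class_C_const deriv_pole[OF a] continuous_pole'[OF a] bounded_cball])
    fix x assume "x \<notin> cball k 1"
    then have "1 \<le> ?s x" by (simp add: dist_norm norm_minus_commute)
    then show "1 * pole e a (?s x) = 0" using pole_0[OF a] by simp
  qed
  moreover have "grad (\<lambda>x. 1) = (\<lambda>x::real^'n. 0)" by (intro ext grad_eqI) simp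
  ultimately have D0: "integral\<^sup>L lborel D = 0" by (simp add: D_def[abs_def])
  have "(\<integral>x. pole e a (?s x) \<partial>lborel) \<le> (\<integral>x. D x + beta (e + 1) (?s x) \<partial>lborel)"
  proof (rule integral_mono[OF p])
    show "integrable lborel (\<lambda>x. D x + beta (e + 1) (?s x))" using iD integral_beta(3) by (intro Bochner_Integration.integrable_add)
    fix x
    have "D x = pole e a (?s x) + 2 * (?s x powr (e + 1) * cut' a (?s x))"
      unfolding D_def by (subst pole_divergence[OF a]) (simp_all add: e_def)
    moreover have "- (?s x powr (e + 1) * (16 * st' (16 * ?s x))) \<le> ?s x powr (e + 1) * cut' a (?s x)"
      using mult_left_mono[OF cut'_ge[of "?s x" a], of "?s x powr (e + 1)"] by simp
    ultimately show "pole e a (?s x) \<le> D x + beta (e + 1) (?s x)" by (simp add: beta_def)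
  qed
  also have "\<dots> = (\<integral>x. beta (e + 1) ((norm (x::real^'n))\<^sup>2) \<partial>lborel)"
    by (simp add: Bochner_Integration.integral_add[OF iD integral_beta(3)[of "e + 1" k]] D0 integral_beta(2))
  finally show ?thesis by (simp add: e_def)
qed

text \<open>The antiderivative of the truncated field that vanishes beyond 1/8. It decreases, so its
  maximum is the constant value below a^2/2. The truncated field is smaller than the exact one, so
  any exact radial potential \<open>q\<close> with q(1/8) \<ge> 0 dominates this maximum. Stating it
  through \<open>q\<close> treats the power and the logarithm uniformly.\<close>

lemma ex_newtonian_potential:
  assumes a: "0 < a" "a < 1/4"
  obtains n where "smooth1 n" "\<And>s. (n has_real_derivative - pole (- e) a s / 2) (at s)"
    "\<And>s. 1/8 \<le> s \<Longrightarrow> n s = 0" "\<And>s. 0 \<le> n s" "\<And>s. n s \<le> n (a\<^sup>2 / 2)"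
    "\<forall>q. (\<forall>s>0. (q has_real_derivative - (s powr (- e)) / 2) (at s)) \<and> 0 \<le> q (1/8) \<longrightarrow> n (a\<^sup>2 / 2) \<le> q (a\<^sup>2 / 2)"
proof -
  have sp: "smooth1 (\<lambda>s. (- 1/2) * pole (- e) a s)" by (intro smooth1_mult smooth1_const smooth1_pole a)
  then have sp': "smooth1 (\<lambda>s. - pole (- e) a s / 2)" by simp
  obtain n0 where n0: "\<And>s. (n0 has_real_derivative - pole (- e) a s / 2) (at s)"
    using ex_antiderivative[OF smooth1_continuous[OF sp']] by blast
  define n where "n s = n0 s - n0 (1/8)" for s
  have n: "(n has_real_derivative - pole (- e) a s / 2) (at s)" for s
    unfolding n_def using DERIV_diff[OF n0 DERIV_const] by simp
  have mono: "n t \<le> n s" if "s \<le> t" for s t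
  proof -
    have "- n s \<le> - n t"
      by (rule deriv_nonneg_imp_le[OF DERIV_minus[OF n]]) (use that pole_nonneg in auto)
    then show ?thesis by simp
  qed
  have z: "n s = 0" if "1/8 \<le> s" for s
  proof -
    have "n (1/8) = n s" by (rule deriv_zero_imp_eq[OF n]) (use that pole_0[OF a(1)] in auto)
    then show ?thesis by (simp add: n_def)
  qed
  have a8: "a\<^sup>2 / 2 \<le> 1/8" using a power_mono[of a "1/4" 2] by (simp add: power2_eq_square)
  show ?thesis
  proof (rule that[of n])
    show "smooth1 n" by (rule smooth1I_deriv[OF n sp'])
    show "0 \<le> n s" for s using mono[of s "max s (1/8)"] z[of "max s (1/8)"] by simp
    show "n s \<le> n (a\<^sup>2 / 2)" for s
    proof (cases "s \<le> a\<^sup>2 / 2")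
      case True
      have "n s = n (a\<^sup>2 / 2)" by (rule deriv_zero_imp_eq[OF n _ True]) (use pole_0[OF a(1)] in auto)
      then show ?thesis by simp
    next
      case False
      then show ?thesis by (intro mono) simp
    qed
    show "\<forall>q. (\<forall>s>0. (q has_real_derivative - (s powr (- e)) / 2) (at s)) \<and> 0 \<le> q (1/8) \<longrightarrow> n (a\<^sup>2 / 2) \<le> q (a\<^sup>2 / 2)"
    proof (intro allI impI, elim conjE)
      fix q assume q: "\<forall>s>0. (q has_real_derivative - (s powr (- e)) / 2) (at s)" "0 \<le> q (1/8)"
      have "q (1/8) - n (1/8) \<le> q (a\<^sup>2 / 2) - n (a\<^sup>2 / 2)"
      proof (rule DERIV_nonpos_imp_nonincreasing[OF a8])
        fix s assume s: "a\<^sup>2 / 2 \<le> s" "s \<le> 1/8"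
        have "0 < a\<^sup>2 / 2" using a by simp
        then have s0: "0 < s" using s by linarith
        have "pole (- e) a s \<le> s powr (- e)"
          unfolding pole_def using cut_range[of a s] by (intro mult_left_le) auto
        then show "\<exists>y. ((\<lambda>s. q s - n s) has_real_derivative y) (at s) \<and> y \<le> 0"
          by (intro exI[of _ "- (s powr (- e)) / 2 - (- pole (- e) a s / 2)"] conjI DERIV_diff q(1)[rule_format] n s0) simp
      qed
      then show "n (a\<^sup>2 / 2) \<le> q (a\<^sup>2 / 2)" using q(2) z[of "1/8"] by simp
    qed
  qed (use n z in auto)
qed

text \<open>The inner cutoff disturbs the Newtonian field only within distance \<open>a\<close> of
  \<open>k\<close>, where \<psi> vanishes. Such a \<psi> sees only the outer source, with the
  Laplacian of the potential equal to \<open>beta\<close>.\<close>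

lemma newtonian_integration_by_parts:
  fixes \<psi> :: "real^'n \<Rightarrow> real"
  assumes \<psi>: "\<psi> \<in> test_functions \<Omega>" and z: "\<And>x. x \<in> ball k a \<Longrightarrow> \<psi> x = 0" and a: "0 < a"
    and n: "\<And>s. (n has_real_derivative - pole (- (real CARD('n) / 2)) a s / 2) (at s)"
  shows "(\<integral>x. grad \<psi> x \<bullet> grad (\<lambda>x. n ((norm (x - k))\<^sup>2)) x \<partial>lborel)
    = - (\<integral>x. \<psi> x * beta (1 - real CARD('n) / 2) ((norm (x - k))\<^sup>2) \<partial>lborel)"
proof -
  let ?e = "- (real CARD('n) / 2)" and ?s = "\<lambda>x. (norm (x - k))\<^sup>2"
  have g: "grad (\<lambda>x. n (?s x)) x = - (pole ?e a (?s x) *\<^sub>R (x - k))" for x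
    by (subst grad_radial[OF n]) simp
  have "(\<integral>x. grad \<psi> x \<bullet> grad (\<lambda>x. n (?s x)) x \<partial>lborel) = - (\<integral>x. grad \<psi> x \<bullet> (pole ?e a (?s x) *\<^sub>R (x - k)) \<partial>lborel)"
    unfolding g by simp
  also have "\<dots> = (\<integral>x. \<psi> x * (real CARD('n) * pole ?e a (?s x) + 2 * ?s x * pole' ?e a (?s x)) \<partial>lborel)"
    by (subst radial_integration_by_parts[OF \<psi> deriv_pole[OF a] continuous_pole'[OF a]]) simp
  also have "\<dots> = (\<integral>x. - (\<psi> x * beta (1 - real CARD('n) / 2) (?s x)) \<partial>lborel)"
  proof (rule Bochner_Integration.integral_cong[OF refl])
    fix x
    show "\<psi> x * (real CARD('n) * pole ?e a (?s x) + 2 * ?s x * pole' ?e a (?s x)) = - (\<psi> x * beta (1 - real CARD('n) / 2) (?s x))"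
    proof (cases "x \<in> ball k a")
      case False
      then have "a \<le> norm (x - k)" by (simp add: dist_norm norm_minus_commute)
      then have "a\<^sup>2 \<le> ?s x" using a by (intro power_mono) auto
      from cut'_eq[OF a this] have "real CARD('n) * pole ?e a (?s x) + 2 * ?s x * pole' ?e a (?s x) = - beta (1 - real CARD('n) / 2) (?s x)"
        by (subst pole_divergence[OF a]) (simp_all add: beta_def)
      then show ?thesis by simp
    qed (simp add: z)
  qed
  finally show ?thesis by simp
qed

end

section \<open>The approximate solution\<close>

lemma test_functions_UNIV_I:
  assumes "\<And>k. class_C k f" "bounded K" "\<And>x. x \<notin> K \<Longrightarrow> f x = 0"
  shows "f \<in> test_functions UNIV"
proof -
  have "{x. f x \<noteq> 0} \<subseteq> K" using assms(3) by blast
  then have "bounded {x. f x \<noteq> 0}" using assms(2) bounded_subset by blast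
  then show ?thesis using assms(1) by (simp add: test_functions_def compact_closure)
qed

text \<open>The inequality \<eta>^(2-d) \<le> L^2 and the bound Cn * L^2 for the potential say that
  \<open>L\<close> is at least the critical scale, in the form common to all dimensions. The upper
  bound on \<open>\<eta>\<close> makes R = d \<eta> at most 1/8, so the neighbourhoods of the holes
  stay well inside their cells.\<close>

locale construction = smooth_step st st' st'' for st st' st'' +
  fixes T :: "(real^'n) set" and c0 \<eta> L Cn b0 Bb :: real and n :: "real \<Rightarrow> real"
  assumes T: "T \<subseteq> unit_cell" "0 < c0"
    and \<eta>: "0 < \<eta>" "\<eta> \<le> 1 / (8 * real CARD('n))"
    and L: "1 \<le> L" "\<eta> powr (2 - real CARD('n)) \<le> L\<^sup>2"
    and n: "smooth1 n" "\<And>s. (n has_real_derivative - pole (- (real CARD('n) / 2)) (c0 * \<eta>) s / 2) (at s)"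
      "\<And>s. 1/8 \<le> s \<Longrightarrow> n s = 0" "\<And>s. 0 \<le> n s" "\<And>s. n s \<le> Cn * L\<^sup>2"
    and b0: "b0 = (\<integral>x. beta (1 - real CARD('n) / 2) ((norm (x::real^'n))\<^sup>2) \<partial>lborel)"
    and Bb: "\<And>s. beta (1 - real CARD('n) / 2) s \<le> Bb"
begin

text \<open>The weight \<open>w k\<close> makes the Laplacian of \<open>W\<close>, computed off the holes, have mean zero on each lattice cell.
  Near the hole at \<open>k\<close> one has \<open>W = q k\<close>, so \<open>\<phi> = W - Q\<close> vanishes there, at the price of the
  datum \<open>grad Q\<close>, which lives on balls of radius comparable to \<open>\<eta>\<close>.\<close>

definition R :: real where "R = real CARD('n) * \<eta>"
text \<open>The bump vanishes from distance sqrt 2 * L on, hence outside the cube of half side 2 *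
  L; lattice points with coordinates up to \<open>K\<close> account for all cells it meets.\<close>

definition K :: nat where "K = nat \<lceil>2 * L\<rceil>"
definition \<Lambda> :: "(real^'n) set" where "\<Lambda> = lattice_box K"
definition \<Phi> :: "real^'n \<Rightarrow> real" where "\<Phi> = bump L 0"
definition lap\<Phi> :: "real^'n \<Rightarrow> real" where "lap\<Phi> = lap_bump L 0"
definition N :: "real^'n \<Rightarrow> real^'n \<Rightarrow> real" where "N k x = n ((norm (x - k))\<^sup>2)"
definition w :: "real^'n \<Rightarrow> real" where "w k = (\<integral>x. lap\<Phi> x * indicator (lattice_cell k) x \<partial>lborel) / b0"
definition W :: "real^'n \<Rightarrow> real" where "W x = \<Phi> x - (\<Sum>k\<in>\<Lambda>. w k * N k x)"
definition q :: "real^'n \<Rightarrow> real^'n \<Rightarrow> real" where "q k x = bump R k x * (\<Phi> x - w k * N k x)"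
definition Q :: "real^'n \<Rightarrow> real" where "Q x = (\<Sum>k\<in>\<Lambda>. q k x)"
definition \<phi> :: "real^'n \<Rightarrow> real" where "\<phi> x = W x - Q x"
text \<open>\<open>CL\<close> divided by L^2 bounds the Laplacian of \<open>\<Phi>\<close>, and
  \<open>H\<close> divided by \<eta> will bound the gradient of \<open>Q\<close>. Neither formula
  contains \<eta> or \<open>L\<close>, on which the final constant must not depend.\<close>

definition CL :: real where "CL = (2 * real CARD('n) + 8) * SB"
definition H :: real where
  "H = 4 * SB + CL / b0 * (c0\<^sup>2 / 2) powr (1/2 - real CARD('n) / 2) + (1 + CL * Cn / b0) * (4 * SB)"
text \<open>A cube of half side 2 * R contains the ball of radius sqrt 2 * R outside which
  \<open>bump R k\<close> vanishes.\<close>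

definition S1 :: "(real^'n) set" where "S1 = (\<Union>k\<in>\<Lambda>. cbox (k - (\<chi> i. 2 * R)) (k + (\<chi> i. 2 * R)))"

lemma d1: "1 \<le> real CARD('n)" by (simp add: Suc_leI)

lemma R: "0 < R" "R \<le> 1/8"
proof -
  show "0 < R" using \<eta> d1 by (simp add: R_def)
  have "\<eta> * (8 * real CARD('n)) \<le> 1" using \<eta>(2) d1 by (simp add: pos_le_divide_eq)
  then show "R \<le> 1/8" by (simp add: R_def mult.commute)
qed

lemma \<eta>1: "\<eta> \<le> 1" 
proof -
  have "\<eta> \<le> R" using d1 \<eta> by (simp add: R_def)
  then show ?thesis using R(2) by simp
qed

lemma b0_pos: "0 < b0" unfolding b0 by (rule integral_beta)

lemma Cn: "0 \<le> Cn"
proof -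
  have "0 \<le> Cn * L\<^sup>2" using n(4)[of 0] n(5)[of 0] by linarith
  then show ?thesis using L by (simp add: zero_le_mult_iff)
qed

lemma CL: "0 < CL" using SB(1) d1 by (simp add: CL_def)

text \<open>The rounding gives 2 K + 1 \<le> 4 L + 3, and L \<ge> 1 absorbs the 3. This is the
  origin of the factors 7 below.\<close>

lemma K: "2 * L \<le> real K" "2 * real K + 1 \<le> 7 * L"
  using L by (auto simp: K_def of_nat_nat) linarith

lemma \<Lambda>: "finite \<Lambda>" "real (card \<Lambda>) \<le> (7 * L) ^ CARD('n)" "k \<in> \<Lambda> \<Longrightarrow> k $ i \<in> \<int>"
proof -
  show "finite \<Lambda>" "k \<in> \<Lambda> \<Longrightarrow> k $ i \<in> \<int>" by (auto simp: \<Lambda>_def card_lattice_box lattice_box_Ints)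
  have "real (card \<Lambda>) = (2 * real K + 1) ^ CARD('n)" by (simp add: \<Lambda>_def card_lattice_box add.commute)
  also have "\<dots> \<le> (7 * L) ^ CARD('n)" using K by (intro power_mono) auto
  finally show "real (card \<Lambda>) \<le> (7 * L) ^ CARD('n)" .
qed

lemma \<Phi>_test: "\<Phi> \<in> test_functions UNIV"
proof (rule test_functions_UNIV_I)
  show "class_C k \<Phi>" for k unfolding \<Phi>_def by (rule class_C_bump)
  show "\<Phi> x = 0" if "x \<notin> cball 0 (2 * L)" for x
    using that norm_le_of_sq[of L x] bump_outside(1)[of L x 0] L by (force simp: \<Phi>_def)
qed simp

lemma N_test: "N k \<in> test_functions UNIV"
proof (rule test_functions_UNIV_I)
  show "class_C j (N k)" for j unfolding N_def[abs_def] by (rule class_C_radial[OF n(1)])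
  fix x assume "x \<notin> cball k 1"
  then have "1 \<le> (norm (x - k))\<^sup>2" by (simp add: dist_norm norm_minus_commute)
  then show "N k x = 0" unfolding N_def by (intro n) simp
qed simp

lemma class_C_pieces: "class_C j \<Phi>" "class_C j (N k)" "class_C j (q k)" "class_C j W" "class_C j Q" "class_C j \<phi>"
proof -
  show 1: "class_C j \<Phi>" "class_C j (N k)" for k using test_functionsD(1) \<Phi>_test N_test by auto
  show 2: "class_C j (q k)" for k unfolding q_def[abs_def]
    by (intro class_C_mult class_C_diff class_C_bump class_C_const 1)
  show 3: "class_C j W" unfolding W_def[abs_def] by (intro class_C_diff class_C_sum class_C_mult class_C_const 1)
  show 4: "class_C j Q" unfolding Q_def[abs_def] by (intro class_C_sum 2)
  show "class_C j \<phi>" unfolding \<phi>_def[abs_def] by (intro class_C_diff 3 4)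
qed

lemma grad_N: "grad (N k) x = - (pole (- (real CARD('n) / 2)) (c0 * \<eta>) ((norm (x - k))\<^sup>2) *\<^sub>R (x - k))"
  unfolding N_def[abs_def] by (subst grad_radial[OF n(2)]) simp

lemma norm_grad_N: "norm (grad (N k) x) = pole (1/2 - real CARD('n) / 2) (c0 * \<eta>) ((norm (x - k))\<^sup>2)"
  unfolding grad_N norm_minus_cancel by (rule norm_pole_scaleR) (use T \<eta> in simp)

lemma has_derivative_pieces:
  "(\<Phi> has_derivative (\<lambda>h. grad \<Phi> x \<bullet> h)) (at x)" "(N k has_derivative (\<lambda>h. grad (N k) x \<bullet> h)) (at x)"
  "(q k has_derivative (\<lambda>h. grad (q k) x \<bullet> h)) (at x)" "(bump R k has_derivative (\<lambda>h. grad (bump R k) x \<bullet> h)) (at x)"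
  "(W has_derivative (\<lambda>h. grad W x \<bullet> h)) (at x)" "(Q has_derivative (\<lambda>h. grad Q x \<bullet> h)) (at x)"
  by (rule class_C_SucD(1)[OF class_C_pieces(1)] class_C_SucD(1)[OF class_C_pieces(2)] class_C_SucD(1)[OF class_C_pieces(3)]
      class_C_SucD(1)[OF class_C_bump] class_C_SucD(1)[OF class_C_pieces(4)] class_C_SucD(1)[OF class_C_pieces(5)])+

lemma grad_W: "grad W x = grad \<Phi> x - (\<Sum>k\<in>\<Lambda>. w k *\<^sub>R grad (N k) x)"
proof (rule grad_eqI)
  show "(W has_derivative (\<lambda>h. (grad \<Phi> x - (\<Sum>k\<in>\<Lambda>. w k *\<^sub>R grad (N k) x)) \<bullet> h)) (at x)"
    unfolding W_def[abs_def]
    by (auto intro!: derivative_eq_intros has_derivative_pieces simp: inner_diff_left inner_sum_left)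
qed

lemma grad_Q: "grad Q x = (\<Sum>k\<in>\<Lambda>. grad (q k) x)"
proof (rule grad_eqI)
  show "(Q has_derivative (\<lambda>h. (\<Sum>k\<in>\<Lambda>. grad (q k) x) \<bullet> h)) (at x)"
    unfolding Q_def[abs_def] by (auto intro!: derivative_eq_intros has_derivative_pieces simp: inner_sum_left)
qed

lemma grad_\<phi>: "grad \<phi> x = grad W x - grad Q x"
proof (rule grad_eqI)
  show "(\<phi> has_derivative (\<lambda>h. (grad W x - grad Q x) \<bullet> h)) (at x)"
    unfolding \<phi>_def[abs_def] by (auto intro!: derivative_eq_intros has_derivative_pieces simp: inner_diff_left)
qed

lemma grad_q: "grad (q k) x = bump R k x *\<^sub>R (grad \<Phi> x - w k *\<^sub>R grad (N k) x) + (\<Phi> x - w k * N k x) *\<^sub>R grad (bump R k) x"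
proof (rule grad_eqI)
  show "(q k has_derivative (\<lambda>h. (bump R k x *\<^sub>R (grad \<Phi> x - w k *\<^sub>R grad (N k) x)
    + (\<Phi> x - w k * N k x) *\<^sub>R grad (bump R k) x) \<bullet> h)) (at x)"
    unfolding q_def[abs_def]
    by (auto intro!: derivative_eq_intros has_derivative_pieces simp: inner_diff_left inner_add_left)
qed

text \<open>The open ball of radius 1/2 about a lattice point lies in its own cell. All local pieces
  live where the squared distance is below 1/8, so they do not meet other cells.\<close>

lemma far_from_other_cells:
  assumes "\<And>i. k $ i \<in> \<int>" "\<And>i. j $ i \<in> \<int>" "x \<in> lattice_cell k" "j \<noteq> k"
  shows "1/4 \<le> (norm (x - j))\<^sup>2"
  using lattice_cell_unique[of j k x] mem_lattice_cellI[of x j] assms by (meson not_less)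

lemma outside_piece:
  assumes "1/8 \<le> (norm (x - j))\<^sup>2"
  shows "N j x = 0" "q j x = 0" "grad (N j) x = 0" "grad (q j) x = 0"
proof -
  have "R\<^sup>2 \<le> (1/8)\<^sup>2" using R by (intro power_mono) auto
  then have *: "2 * R\<^sup>2 \<le> (norm (x - j))\<^sup>2" using assms by (simp add: power2_eq_square)
  show "N j x = 0" unfolding N_def by (rule n(3)[OF assms])
  show "q j x = 0" using bump_outside(1)[OF R(1) *] by (simp add: q_def)
  show "grad (N j) x = 0" unfolding grad_N using pole_0[of "c0 * \<eta>"] T \<eta> assms by simp
  show "grad (q j) x = 0" unfolding grad_q using bump_outside[OF R(1) *] by simp
qed

text \<open>At any point at most one summand survives. Pointwise bounds for a single piece thus pass
  to the whole sum with no loss in the number of holes.\<close>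

lemma sum_piece:
  fixes g :: "real^'n \<Rightarrow> 'b::real_vector"
  assumes k: "\<And>i. k $ i \<in> \<int>" "x \<in> lattice_cell k" and g: "\<And>j. 1/8 \<le> (norm (x - j))\<^sup>2 \<Longrightarrow> g j = 0"
  shows "(\<Sum>j\<in>\<Lambda>. g j) = (if k \<in> \<Lambda> then g k else 0)"
proof -
  have z: "g j = 0" if "j \<in> \<Lambda>" "j \<noteq> k" for j
    using far_from_other_cells[OF k(1) \<Lambda>(3)[OF that(1)] k(2) that(2)] by (intro g) simp
  have "(\<Sum>j\<in>\<Lambda>. g j) = (\<Sum>j\<in>\<Lambda>. if k = j then g j else 0)" by (rule sum.cong) (auto dest: z)
  then show ?thesis using \<Lambda>(1) by (simp add: sum.delta)
qed

lemma \<Phi>_cell: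
  assumes k: "\<And>i. k $ i \<in> \<int>" "x \<in> lattice_cell k" and "k \<notin> \<Lambda>"
  shows "2 * L\<^sup>2 < (norm x)\<^sup>2"
proof -
  obtain k' where k': "\<And>i. k' $ i \<in> \<int>" "x \<in> lattice_cell k'" "(\<And>i. \<bar>x $ i\<bar> \<le> real K) \<Longrightarrow> k' \<in> lattice_box K"
    using ex_lattice_cell[of x K] by blast
  have "k' = k" using lattice_cell_unique[OF k'(1) k(1) k'(2) k(2)] .
  then have "\<not> (\<forall>i. \<bar>x $ i\<bar> \<le> real K)" using k'(3) assms(3) by (auto simp: \<Lambda>_def)
  then obtain i where "real K < \<bar>x $ i\<bar>" by (auto simp: not_le)
  then have "2 * L < norm x" using K(1) component_le_norm_cart[of x i] by linarith
  then have "(2 * L)\<^sup>2 < (norm x)\<^sup>2" using L by (intro power_strict_mono) auto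
  then have "4 * L\<^sup>2 < (norm x)\<^sup>2" by (simp add: power_mult_distrib)
  then show ?thesis using zero_le_power2[of L] by linarith
qed

text \<open>Within distance \<open>R\<close> of a lattice point of \<open>\<Lambda>\<close> the
  cutoff is 1, so \<open>q k\<close> equals \<open>W\<close>. In cells outside
  \<open>\<Lambda>\<close> neither \<open>\<Phi>\<close> nor any local piece is present.\<close>

lemma \<phi>_zero:
  assumes k: "\<And>i. k $ i \<in> \<int>" "x \<in> lattice_cell k" and x: "k \<notin> \<Lambda> \<or> x \<in> ball k R"
  shows "\<phi> x = 0"
proof -
  have s: "(\<Sum>j\<in>\<Lambda>. w j * N j x) = (if k \<in> \<Lambda> then w k * N k x else 0)" "(\<Sum>j\<in>\<Lambda>. q j x) = (if k \<in> \<Lambda> then q k x else 0)"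
    by (rule sum_piece[OF k]; simp add: outside_piece)+
  show ?thesis
  proof (cases "k \<in> \<Lambda>")
    case True
    then have "norm (x - k) < R" using x by (simp add: dist_norm norm_minus_commute)
    then have "(norm (x - k))\<^sup>2 \<le> R\<^sup>2" by (intro power_mono) auto
    then have "bump R k x = 1" by (rule bump_eq_1[OF R(1)])
    then show ?thesis using True s by (simp add: \<phi>_def W_def Q_def q_def)
  next
    case False
    then have "\<Phi> x = 0" using \<Phi>_cell[OF k] bump_outside(1)[of L x 0] L by (simp add: \<Phi>_def)
    then show ?thesis using False s by (simp add: \<phi>_def W_def Q_def)
  qed
qed

lemma \<phi>_test: "\<phi> \<in> test_functions (perforated_domain T 1 \<eta>)"
proof -
  have "{x. \<phi> x \<noteq> 0} \<subseteq> (\<Union>k\<in>\<Lambda>. lattice_cell k)"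
  proof
    fix x assume x: "x \<in> {x. \<phi> x \<noteq> 0}"
    obtain k where "\<And>i. k $ i \<in> \<int>" "x \<in> lattice_cell k" using ex_lattice_cell[of x 0] by blast
    then show "x \<in> (\<Union>k\<in>\<Lambda>. lattice_cell k)" using \<phi>_zero[of k x] x by auto
  qed
  moreover have "bounded (\<Union>k\<in>\<Lambda>. lattice_cell k)" using \<Lambda>(1) lattice_cell_props(2) by (intro bounded_UN) auto
  ultimately have b: "bounded {x. \<phi> x \<noteq> 0}" using bounded_subset by blast
  have "x \<in> perforated_domain T 1 \<eta>" if x: "x \<in> closure {x. \<phi> x \<noteq> 0}" for x
  proof (rule ccontr)
    assume "x \<notin> perforated_domain T 1 \<eta>"
    then obtain k t where kt: "\<And>i. k $ i \<in> \<int>" "t \<in> T" "x = k + \<eta> *\<^sub>R t" by (auto simp: perforated_domain_def)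
    \<comment> \<open>Points of the cell have norm at most d/2 < d. This crude bound is the reason
      for R = d \<eta>: the open ball of radius \<open>R\<close> contains the hole, and so even the
      closure of the set where \<phi> is nonzero avoids it.\<close>
    have "norm t \<le> (\<Sum>i\<in>UNIV. \<bar>t $ i\<bar>)" by (rule norm_le_l1_cart)
    also have "\<dots> \<le> (\<Sum>i\<in>(UNIV::'n set). 1/2)"
    proof (rule sum_mono)
      fix i
      have "t \<in> unit_cell" using T kt by auto
      then have "- 1/2 \<le> t $ i \<and> t $ i \<le> 1/2" by (simp add: unit_cell_def mem_box_cart)
      then show "\<bar>t $ i\<bar> \<le> 1/2" by linarith
    qed
    also have "\<dots> < real CARD('n)" using d1 by simp
    finally have "x \<in> ball k R" using \<eta> kt(3) by (simp add: dist_norm R_def mult.commute)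
    moreover have "{x. \<phi> x \<noteq> 0} \<inter> ball k R = {}"
    proof -
      have "\<phi> y = 0" if y: "y \<in> ball k R" for y
      proof (rule \<phi>_zero[OF kt(1)])
        have "(norm (y - k))\<^sup>2 < R\<^sup>2" using y by (intro power_strict_mono) (auto simp: dist_norm norm_minus_commute)
        also have "R\<^sup>2 \<le> (1/8)\<^sup>2" using R by (intro power_mono) auto
        finally show "y \<in> lattice_cell k" by (intro mem_lattice_cellI) (simp add: power2_eq_square)
      qed (use y in blast)
      then show ?thesis by blast
    qed
    ultimately show False using x open_Int_closure_eq_empty[of "ball k R" "{x. \<phi> x \<noteq> 0}"] by (auto simp: Int_commute)
  qed
  then show ?thesis using b class_C_pieces(6) by (auto simp: test_functions_def compact_closure)
qed

lemma abs_lap\<Phi>_le: "\<bar>lap\<Phi> x\<bar> \<le> CL / L\<^sup>2"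
  using abs_lap_bump_le[of L 0 x] L by (simp add: lap\<Phi>_def CL_def)

lemma cell_fin: "emeasure lborel (lattice_cell (k::real^'n)) < \<infinity>" "measure lborel (lattice_cell k) = 1"
  using lattice_cell_measure(2)[of k] by (simp_all add: measure_def)

lemma lap\<Phi>_cell_integrable: "integrable lborel (\<lambda>x. lap\<Phi> x * indicator (lattice_cell k) x)"
proof (rule Bochner_Integration.integrable_bound[of lborel "\<lambda>x. CL / L\<^sup>2 * indicator (lattice_cell k) x"])
  have [measurable]: "lap\<Phi> \<in> borel_measurable borel" "lattice_cell k \<in> sets borel"
    unfolding lap\<Phi>_def by (auto intro: borel_measurable_continuous_onI continuous_lap_bump lattice_cell_measure)
  show "(\<lambda>x. lap\<Phi> x * indicator (lattice_cell k) x) \<in> borel_measurable lborel" by measurable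
  show "integrable lborel (\<lambda>x. CL / L\<^sup>2 * indicator (lattice_cell k) x)"
    by (intro integrable_mult_right integrable_real_indicator) (use lattice_cell_measure cell_fin in auto)
  show "AE x in lborel. norm (lap\<Phi> x * indicator (lattice_cell k) x) \<le> norm (CL / L\<^sup>2 * indicator (lattice_cell k) x)"
    using abs_lap\<Phi>_le CL by (auto simp: indicator_def)
qed

text \<open>The cell has measure 1, so the sup bound on the Laplacian is also a bound on its
  integral.\<close>

lemma abs_w_le: "\<bar>w k\<bar> \<le> CL / (L\<^sup>2 * b0)"
proof -
  have "\<bar>\<integral>x. lap\<Phi> x * indicator (lattice_cell k) x \<partial>lborel\<bar> \<le> (\<integral>x. \<bar>lap\<Phi> x * indicator (lattice_cell k) x\<bar> \<partial>lborel)"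
    by (rule integral_abs_bound)
  also have "\<dots> \<le> (\<integral>x. CL / L\<^sup>2 * indicator (lattice_cell k) x \<partial>lborel)"
  proof (rule integral_mono)
    show "integrable lborel (\<lambda>x. \<bar>lap\<Phi> x * indicator (lattice_cell k) x\<bar>)" using lap\<Phi>_cell_integrable by (rule integrable_abs)
    show "integrable lborel (\<lambda>x. CL / L\<^sup>2 * indicator (lattice_cell k) x)"
      by (intro integrable_mult_right integrable_real_indicator) (use lattice_cell_measure cell_fin in auto)
    show "\<bar>lap\<Phi> x * indicator (lattice_cell k) x\<bar> \<le> CL / L\<^sup>2 * indicator (lattice_cell k) x" for x
      using abs_lap\<Phi>_le by (auto simp: indicator_def)
  qed
  also have "\<dots> = CL / L\<^sup>2" using cell_fin by simp
  finally have "\<bar>\<integral>x. lap\<Phi> x * indicator (lattice_cell k) x \<partial>lborel\<bar> / b0 \<le> CL / L\<^sup>2 / b0"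
    using b0_pos by (intro divide_right_mono) auto
  then show ?thesis using b0_pos by (simp add: w_def abs_divide)
qed

lemma norm_grad_\<Phi>_le: "norm (grad \<Phi> x) \<le> 4 * SB / L"
  unfolding \<Phi>_def by (rule norm_grad_bump_le) (use L in simp)

text \<open>Three contributions, each O(1/\<eta>): the gradient of \<open>\<Phi>\<close> is O(1/L);
  the weighted field of the potential uses the critical scale; and the gradient of the cutoff,
  O(1/\<eta>), multiplies a function that is O(1) because the weight O(L^-2) meets a potential of
  size at most Cn L^2.\<close>

lemma norm_grad_q_le: "norm (grad (q k) x) \<le> H / \<eta>"
proof -
  have p: "norm (w k *\<^sub>R grad (N k) x) \<le> CL / b0 * (c0\<^sup>2 / 2) powr (1/2 - real CARD('n) / 2) / \<eta>"
  proof -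
    have "norm (w k *\<^sub>R grad (N k) x) = \<bar>w k\<bar> * pole (1/2 - real CARD('n) / 2) (c0 * \<eta>) ((norm (x - k))\<^sup>2)"
      by (simp add: norm_grad_N)
    also have "\<dots> \<le> CL / (L\<^sup>2 * b0) * ((c0 * \<eta>)\<^sup>2 / 2) powr (1/2 - real CARD('n) / 2)"
      using T \<eta> d1 abs_w_le CL b0_pos L by (intro mult_mono pole_le pole_nonneg) auto
    also have "((c0 * \<eta>)\<^sup>2 / 2) powr (1/2 - real CARD('n) / 2) = (c0\<^sup>2 / 2) powr (1/2 - real CARD('n) / 2) * (\<eta>\<^sup>2) powr (1/2 - real CARD('n) / 2)"
      using T \<eta> by (subst powr_mult[symmetric]) (auto simp: power_mult_distrib)
    also have "(\<eta>\<^sup>2) powr (1/2 - real CARD('n) / 2) = \<eta> powr (2 - real CARD('n)) / \<eta>"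
    proof -
      have "(\<eta>\<^sup>2) powr (1/2 - real CARD('n) / 2) = \<eta> powr (2 * (1/2 - real CARD('n) / 2))"
        using \<eta> by (subst powr_powr[symmetric]) simp
      also have "2 * (1/2 - real CARD('n) / 2) = (2 - real CARD('n)) - 1" by simp
      also have "\<eta> powr ((2 - real CARD('n)) - 1) = \<eta> powr (2 - real CARD('n)) / \<eta>"
        by (subst powr_diff) (use \<eta> in simp)
      finally show ?thesis .
    qed
    \<comment> \<open>The field at distance comparable to \<eta> has size \<eta>^(1-d) =
      \<eta>^(2-d) / \<eta>; the hypothesis on \<open>L\<close> lets the weight L^-2 cancel the
      first factor.\<close>
    also have "CL / (L\<^sup>2 * b0) * ((c0\<^sup>2 / 2) powr (1/2 - real CARD('n) / 2) * (\<eta> powr (2 - real CARD('n)) / \<eta>))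
      \<le> CL / (L\<^sup>2 * b0) * ((c0\<^sup>2 / 2) powr (1/2 - real CARD('n) / 2) * (L\<^sup>2 / \<eta>))"
      using CL b0_pos L \<eta> by (intro mult_left_mono divide_right_mono) auto
    also have "\<dots> = CL / b0 * (c0\<^sup>2 / 2) powr (1/2 - real CARD('n) / 2) / \<eta>" using L \<eta> b0_pos by (simp add: field_simps)
    finally show ?thesis .
  qed
  have v: "\<bar>\<Phi> x - w k * N k x\<bar> \<le> 1 + CL * Cn / b0"
  proof -
    have "\<bar>w k * N k x\<bar> \<le> CL / (L\<^sup>2 * b0) * (Cn * L\<^sup>2)"
      unfolding abs_mult using abs_w_le n(4,5) by (intro mult_mono) (auto simp: N_def intro: order_trans[OF abs_ge_zero])
    also have "\<dots> = CL * Cn / b0" using L b0_pos by (simp add: field_simps)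
    finally show ?thesis using bump_range[of L 0 x] unfolding \<Phi>_def by linarith
  qed
  have g: "norm (grad (bump R k) x) \<le> 4 * SB / \<eta>"
  proof -
    have "\<eta> \<le> R" using d1 \<eta> by (simp add: R_def)
    then have "4 * SB / R \<le> 4 * SB / \<eta>" using SB(1) \<eta> by (intro divide_left_mono) auto
    then show ?thesis using norm_grad_bump_le[OF R(1), of k x] by simp
  qed
  have "4 * SB / L \<le> 4 * SB / \<eta>" using L \<eta>1 \<eta> SB(1) by (intro divide_left_mono) auto
  then have ph: "norm (grad \<Phi> x) \<le> 4 * SB / \<eta>" using norm_grad_\<Phi>_le[of x] by simp
  have 1: "norm (grad (q k) x) \<le> norm (bump R k x *\<^sub>R (grad \<Phi> x - w k *\<^sub>R grad (N k) x)) + norm ((\<Phi> x - w k * N k x) *\<^sub>R grad (bump R k) x)"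
    unfolding grad_q by (rule norm_triangle_ineq)
  have 2: "norm (bump R k x *\<^sub>R (grad \<Phi> x - w k *\<^sub>R grad (N k) x)) \<le> 1 * (norm (grad \<Phi> x) + norm (w k *\<^sub>R grad (N k) x))"
    unfolding norm_scaleR[of "bump R k x"] using bump_range[of R k x] norm_triangle_ineq4[of "grad \<Phi> x" "w k *\<^sub>R grad (N k) x"]
    by (intro mult_mono) auto
  have 3: "norm ((\<Phi> x - w k * N k x) *\<^sub>R grad (bump R k) x) \<le> (1 + CL * Cn / b0) * (4 * SB / \<eta>)"
    unfolding norm_scaleR using v g Cn CL b0_pos by (intro mult_mono) auto
  have "norm (grad (q k) x) \<le> 4 * SB / \<eta> + CL / b0 * (c0\<^sup>2 / 2) powr (1/2 - real CARD('n) / 2) / \<eta> + (1 + CL * Cn / b0) * (4 * SB / \<eta>)"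
  proof (rule order_trans[OF 1 add_mono[OF _ 3]])
    show "norm (bump R k x *\<^sub>R (grad \<Phi> x - w k *\<^sub>R grad (N k) x)) \<le> 4 * SB / \<eta> + CL / b0 * (c0\<^sup>2 / 2) powr (1/2 - real CARD('n) / 2) / \<eta>"
      using order_trans[OF 2[unfolded mult_1] add_mono[OF ph p]] .
  qed
  also have "\<dots> = H / \<eta>" by (simp add: H_def add_divide_distrib)
  finally show ?thesis .
qed

lemma H: "0 < H"
proof -
  have "0 < 4 * SB" "0 \<le> CL / b0 * (c0\<^sup>2 / 2) powr (1/2 - real CARD('n) / 2)" "0 \<le> (1 + CL * Cn / b0) * (4 * SB)"
    using SB(1) CL b0_pos Cn by auto
  then show ?thesis unfolding H_def by linarith
qed

lemma norm_grad_Q_le: "norm (grad Q x) \<le> H / \<eta> * indicator S1 x"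
proof -
  obtain k where k: "\<And>i. k $ i \<in> \<int>" "x \<in> lattice_cell k" using ex_lattice_cell[of x 0] by blast
  have s: "grad Q x = (if k \<in> \<Lambda> then grad (q k) x else 0)"
    unfolding grad_Q by (rule sum_piece[OF k]) (rule outside_piece)
  show ?thesis
  proof (cases "k \<in> \<Lambda> \<and> (norm (x - k))\<^sup>2 \<le> 2 * R\<^sup>2")
    case True
    then have "x \<in> cbox (k - (\<chi> i. 2 * R)) (k + (\<chi> i. 2 * R))" using norm_le_of_sq[OF R(1)] by (intro mem_cube) auto
    then have "x \<in> S1" unfolding S1_def using True by blast
    then show ?thesis using s norm_grad_q_le[of k x] True by simp
  next
    case False
    have "grad Q x = 0"
    proof (cases "k \<in> \<Lambda>")
      case True
      then have "2 * R\<^sup>2 \<le> (norm (x - k))\<^sup>2" using False by simp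
      then show ?thesis using s True bump_outside[OF R(1), of x k] by (simp add: grad_q)
    qed (use s in simp)
    then show ?thesis using H \<eta> by simp
  qed
qed

text \<open>At most (7 L)^d lattice points, each with a cube of side 4 R = 4 d \<eta>.\<close>

lemma S1: "S1 \<in> sets borel" "emeasure lborel S1 \<le> ennreal ((28 * real CARD('n) * (L * \<eta>)) ^ CARD('n))"
proof -
  show "S1 \<in> sets borel" unfolding S1_def using \<Lambda>(1) by (intro sets.finite_UN) auto
  have "emeasure lborel S1 \<le> (\<Sum>k\<in>\<Lambda>. emeasure lborel (cbox (k - (\<chi> i. 2 * R)) (k + (\<chi> i. 2 * R))))"
    unfolding S1_def by (rule emeasure_subadditive_finite) (use \<Lambda> in auto)
  also have "\<dots> = (\<Sum>k\<in>\<Lambda>. ennreal ((4 * R) ^ CARD('n)))"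
  proof (rule sum.cong[OF refl])
    show "emeasure lborel (cbox (k - (\<chi> i. 2 * R)) (k + (\<chi> i. 2 * R))) = ennreal ((4 * R) ^ CARD('n))" for k :: "real^'n"
      using measure_cube[of "2 * R" k] R by simp
  qed
  also have "\<dots> = ennreal (real (card \<Lambda>) * (4 * R) ^ CARD('n))"
    using R by (simp add: ennreal_mult ennreal_of_nat_eq_real_of_nat)
  also have "\<dots> \<le> ennreal ((7 * L) ^ CARD('n) * (4 * R) ^ CARD('n))"
    using \<Lambda>(2) R by (intro ennreal_leI mult_right_mono) auto
  also have "(7 * L) ^ CARD('n) * (4 * R) ^ CARD('n) = ((7 * L) * (4 * R)) ^ CARD('n)"
    by (rule power_mult_distrib[symmetric])
  also have "(7 * L) * (4 * R) = 28 * real CARD('n) * (L * \<eta>)" by (simp add: R_def)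
  finally show "emeasure lborel S1 \<le> ennreal ((28 * real CARD('n) * (L * \<eta>)) ^ CARD('n))" .
qed

end

section \<open>The approximate equation and the energy pairing\<close>

context construction
begin

text \<open>The Laplacian of \<open>W\<close> on the cell of \<open>k\<close>, as seen by functions
  that vanish on the holes. The weight \<open>w k\<close> was chosen to make its integral
  zero.\<close>

definition \<rho> :: "real^'n \<Rightarrow> real^'n \<Rightarrow> real" where
  "\<rho> k x = lap\<Phi> x * indicator (lattice_cell k) x - w k * beta (1 - real CARD('n) / 2) ((norm (x - k))\<^sup>2)"

definition Cr :: real where "Cr = CL + CL / b0 * Bb"

lemma Bb_nonneg: "0 \<le> Bb"
  using Bb[of 0] beta_props(1)[of "1 - real CARD('n) / 2" 0] by linarith

lemma Cr: "0 < Cr"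
  using CL b0_pos Bb_nonneg by (simp add: Cr_def add_pos_nonneg)

lemma \<rho>:
  "\<rho> k \<in> borel_measurable borel" "integrable lborel (\<rho> k)" "(\<integral>x. \<rho> k x \<partial>lborel) = 0"
  "\<bar>\<rho> k x\<bar> \<le> Cr / L\<^sup>2 * indicator (lattice_cell k) x"
proof -
  have i: "integrable lborel (\<lambda>x. lap\<Phi> x * indicator (lattice_cell k) x)"
    "integrable lborel (\<lambda>x. w k * beta (1 - real CARD('n) / 2) ((norm (x - k))\<^sup>2))"
    by (rule lap\<Phi>_cell_integrable, rule integrable_mult_right, rule integral_beta)
  then show j: "integrable lborel (\<rho> k)" unfolding \<rho>_def[abs_def] by (rule Bochner_Integration.integrable_diff)
  then show "\<rho> k \<in> borel_measurable borel" using borel_measurable_integrable by fastforce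
  have "(\<integral>x. \<rho> k x \<partial>lborel) = (\<integral>x. lap\<Phi> x * indicator (lattice_cell k) x \<partial>lborel) - w k * b0"
    unfolding \<rho>_def using Bochner_Integration.integral_diff[OF i] by (simp add: integral_beta(2) b0[symmetric])
  then show "(\<integral>x. \<rho> k x \<partial>lborel) = 0" using b0_pos by (simp add: w_def)
  have b: "\<bar>w k * beta (1 - real CARD('n) / 2) ((norm (x - k))\<^sup>2)\<bar> \<le> CL / b0 * Bb / L\<^sup>2"
  proof -
    have "\<bar>w k * beta (1 - real CARD('n) / 2) ((norm (x - k))\<^sup>2)\<bar> \<le> CL / (L\<^sup>2 * b0) * Bb"
      unfolding abs_mult using abs_w_le Bb beta_props(1) CL b0_pos by (intro mult_mono) auto
    then show ?thesis by (simp add: field_simps)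
  qed
  show "\<bar>\<rho> k x\<bar> \<le> Cr / L\<^sup>2 * indicator (lattice_cell k) x"
  proof (cases "x \<in> lattice_cell k")
    case True
    then have "\<bar>\<rho> k x\<bar> \<le> \<bar>lap\<Phi> x\<bar> + \<bar>w k * beta (1 - real CARD('n) / 2) ((norm (x - k))\<^sup>2)\<bar>"
      unfolding \<rho>_def by simp
    also have "\<dots> \<le> CL / L\<^sup>2 + CL / b0 * Bb / L\<^sup>2" by (intro add_mono abs_lap\<Phi>_le b)
    finally show ?thesis using True by (simp add: Cr_def add_divide_distrib)
  next
    case False
    then have "1/4 \<le> (norm (x - k))\<^sup>2" using mem_lattice_cellI[of x k] by force
    then have "beta (1 - real CARD('n) / 2) ((norm (x - k))\<^sup>2) = 0" by (intro beta_props) simp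
    then show ?thesis using False by (simp add: \<rho>_def)
  qed
qed

lemma sum_lap\<Phi>_cells: "(\<Sum>k\<in>\<Lambda>. lap\<Phi> x * indicator (lattice_cell k) x) = lap\<Phi> x"
proof -
  obtain k where k: "\<And>i. k $ i \<in> \<int>" "x \<in> lattice_cell k" using ex_lattice_cell[of x 0] by blast
  have "(\<Sum>j\<in>\<Lambda>. lap\<Phi> x * indicator (lattice_cell j) x) = (\<Sum>j\<in>\<Lambda>. if k = j then lap\<Phi> x else 0)"
  proof (rule sum.cong[OF refl])
    fix j assume "j \<in> \<Lambda>"
    then have "x \<in> lattice_cell j \<longleftrightarrow> k = j" using lattice_cell_unique[OF k(1) \<Lambda>(3) k(2)] k(2) by blast
    then show "lap\<Phi> x * indicator (lattice_cell j) x = (if k = j then lap\<Phi> x else 0)" by simp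
  qed
  also have "\<dots> = (if k \<in> \<Lambda> then lap\<Phi> x else 0)" using \<Lambda>(1) by (simp add: sum.delta)
  also have "\<dots> = lap\<Phi> x"
  proof (cases "k \<in> \<Lambda>")
    case False
    then show ?thesis using \<Phi>_cell[OF k False] lap_bump_outside[of L x 0] L by (simp add: lap\<Phi>_def)
  qed simp
  finally show ?thesis .
qed

text \<open>As grad \<phi> + grad Q = grad W, integration by parts leaves minus the sum of the
  integrals of \<psi> against the mean-zero residuals. The Poincare inequality costs only the
  constant residual size O(L^-2) per cell, and Cauchy-Schwarz over a union of cells of measure at
  most (7 L)^d gives the total order L^(d/2-2).\<close>

lemma approximate_equation:
  assumes T0: "ball 0 c0 \<subseteq> T" and \<psi>: "\<psi> \<in> test_functions (perforated_domain T 1 \<eta>)"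
  shows "\<bar>\<integral>x. grad \<psi> x \<bullet> (grad \<phi> x + grad Q x) \<partial>lborel\<bar>
    \<le> (Cr / L\<^sup>2 * 2 ^ CARD('n) * real CARD('n) * sqrt ((7 * L) ^ CARD('n))) * norm2 lborel (grad \<psi>)"
proof -
  have c1: "class_C (Suc 0) \<psi>" by (rule test_functionsD(1)[OF \<psi>])
  have g\<psi>: "sq_int lborel (grad \<psi>)" by (rule sq_int_grad_test[OF \<psi>])
  have a: "0 < c0 * \<eta>" using T \<eta> by simp
  have z: "\<psi> x = 0" if k: "k \<in> \<Lambda>" and x: "x \<in> ball k (c0 * \<eta>)" for k x
  proof (rule test_functionsD(3)[OF \<psi>])
    have "norm (x - k) < c0 * \<eta>" using x by (simp add: dist_norm norm_minus_commute)
    moreover have "norm ((1 / \<eta>) *\<^sub>R (x - k)) = norm (x - k) / \<eta>" using \<eta> by (subst norm_scaleR) simp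
    ultimately have "norm ((1 / \<eta>) *\<^sub>R (x - k)) < c0" using \<eta> by (simp only: pos_divide_less_eq)
    then have "(1 / \<eta>) *\<^sub>R (x - k) \<in> T" by (intro subsetD[OF T0]) (simp only: mem_ball_0)
    then have "1 *\<^sub>R (k + \<eta> *\<^sub>R ((1 / \<eta>) *\<^sub>R (x - k))) \<in> (\<lambda>x. 1 *\<^sub>R (k + \<eta> *\<^sub>R x)) ` T" by (rule imageI)
    then have "x \<in> (\<lambda>x. 1 *\<^sub>R (k + \<eta> *\<^sub>R x)) ` T" using \<eta> by simp
    moreover have "k \<in> {k. \<forall>i. k $ i \<in> \<int>}" using \<Lambda>(3)[OF k] by simp
    ultimately show "x \<notin> perforated_domain T 1 \<eta>" unfolding perforated_domain_def by blast
  qed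
  have ip: "integrable lborel (\<lambda>x. \<psi> x * g x)" if "continuous_on UNIV g" for g :: "real^'n \<Rightarrow> real"
    by (rule integrable_continuous_support[OF _ test_functionsD(2)[OF \<psi>]])
      (intro continuous_on_mult class_C_continuous[OF c1] that, simp)
  have cl: "continuous_on UNIV lap\<Phi>" unfolding lap\<Phi>_def by (rule continuous_lap_bump)
  have eq: "grad \<psi> x \<bullet> (grad \<phi> x + grad Q x) = grad \<psi> x \<bullet> grad \<Phi> x - (\<Sum>k\<in>\<Lambda>. w k * (grad \<psi> x \<bullet> grad (N k) x))" for x
    unfolding grad_\<phi> by (simp add: grad_W inner_diff_right inner_sum_right)
  have i\<Phi>: "integrable lborel (\<lambda>x. grad \<psi> x \<bullet> grad \<Phi> x)" and iN: "integrable lborel (\<lambda>x. grad \<psi> x \<bullet> grad (N k) x)" for k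
    by (rule integrable_inner_sq_int[OF g\<psi> sq_int_grad_test[OF \<Phi>_test]] integrable_inner_sq_int[OF g\<psi> sq_int_grad_test[OF N_test]])+
  let ?\<beta> = "\<lambda>k x. beta (1 - real CARD('n) / 2) ((norm (x - k))\<^sup>2)"
  have "(\<integral>x. grad \<psi> x \<bullet> (grad \<phi> x + grad Q x) \<partial>lborel)
      = (\<integral>x. grad \<psi> x \<bullet> grad \<Phi> x \<partial>lborel) - (\<Sum>k\<in>\<Lambda>. w k * (\<integral>x. grad \<psi> x \<bullet> grad (N k) x \<partial>lborel))"
    unfolding eq using i\<Phi> iN by simp
  also have "(\<integral>x. grad \<psi> x \<bullet> grad \<Phi> x \<partial>lborel) = - (\<integral>x. \<psi> x * lap\<Phi> x \<partial>lborel)"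
    unfolding \<Phi>_def lap\<Phi>_def by (rule bump_integration_by_parts[OF \<psi>])
  also have "(\<Sum>k\<in>\<Lambda>. w k * (\<integral>x. grad \<psi> x \<bullet> grad (N k) x \<partial>lborel)) = (\<Sum>k\<in>\<Lambda>. w k * - (\<integral>x. \<psi> x * ?\<beta> k x \<partial>lborel))"
  proof (rule sum.cong[OF refl])
    fix k assume k: "k \<in> \<Lambda>"
    have "(\<integral>x. grad \<psi> x \<bullet> grad (N k) x \<partial>lborel) = - (\<integral>x. \<psi> x * ?\<beta> k x \<partial>lborel)"
      unfolding N_def[abs_def] by (rule newtonian_integration_by_parts[OF \<psi> z[OF k] a n(2)])
    then show "w k * (\<integral>x. grad \<psi> x \<bullet> grad (N k) x \<partial>lborel) = w k * - (\<integral>x. \<psi> x * ?\<beta> k x \<partial>lborel)" by simp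
  qed
  also have "- (\<integral>x. \<psi> x * lap\<Phi> x \<partial>lborel) - (\<Sum>k\<in>\<Lambda>. w k * - (\<integral>x. \<psi> x * ?\<beta> k x \<partial>lborel))
      = - (\<integral>x. \<psi> x * lap\<Phi> x - (\<Sum>k\<in>\<Lambda>. w k * (\<psi> x * ?\<beta> k x)) \<partial>lborel)"
    using ip[OF cl] ip[OF integral_beta(4)] by (simp add: sum_negf)
  \<comment> \<open>The cells of \<open>\<Lambda>\<close> are disjoint and carry all of
    \<open>lap\<Phi>\<close>, so the Laplacian splits into its restrictions, each joined with the
    source at the centre of the same cell.\<close>
  also have "(\<lambda>x. \<psi> x * lap\<Phi> x - (\<Sum>k\<in>\<Lambda>. w k * (\<psi> x * ?\<beta> k x))) = (\<lambda>x. \<Sum>k\<in>\<Lambda>. \<psi> x * \<rho> k x)"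
  proof
    fix x
    have "(\<Sum>k\<in>\<Lambda>. \<psi> x * \<rho> k x) = \<psi> x * (\<Sum>k\<in>\<Lambda>. lap\<Phi> x * indicator (lattice_cell k) x) - (\<Sum>k\<in>\<Lambda>. w k * (\<psi> x * ?\<beta> k x))"
      by (simp add: \<rho>_def right_diff_distrib sum_subtractf sum_distrib_left mult_ac)
    then show "\<psi> x * lap\<Phi> x - (\<Sum>k\<in>\<Lambda>. w k * (\<psi> x * ?\<beta> k x)) = (\<Sum>k\<in>\<Lambda>. \<psi> x * \<rho> k x)"
      by (simp add: sum_lap\<Phi>_cells)
  qed
  also have "- (\<integral>x. (\<Sum>k\<in>\<Lambda>. \<psi> x * \<rho> k x) \<partial>lborel) = - (\<Sum>k\<in>\<Lambda>. \<integral>x. \<psi> x * \<rho> k x \<partial>lborel)"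
  proof -
    have "integrable lborel (\<lambda>x. \<psi> x * \<rho> k x)" for k
    proof (rule Bochner_Integration.integrable_bound[OF ip[OF continuous_on_const[of _ "Cr / L\<^sup>2"]]])
      have [measurable]: "\<psi> \<in> borel_measurable borel" "\<rho> k \<in> borel_measurable borel"
        using \<rho>(1) class_C_continuous[OF c1] by (auto intro: borel_measurable_continuous_onI)
      show "(\<lambda>x. \<psi> x * \<rho> k x) \<in> borel_measurable lborel" by measurable
      have "\<bar>\<rho> k x\<bar> \<le> Cr / L\<^sup>2" for x using order_trans[OF \<rho>(4)[of k x]] Cr by (simp add: indicator_def)
      then have "\<bar>\<psi> x\<bar> * \<bar>\<rho> k x\<bar> \<le> \<bar>\<psi> x\<bar> * (Cr / L\<^sup>2)" for x by (intro mult_left_mono) auto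
      then show "AE x in lborel. norm (\<psi> x * \<rho> k x) \<le> norm (\<psi> x * (Cr / L\<^sup>2))" using Cr by (simp add: abs_mult)
    qed
    then show ?thesis by simp
  qed
  finally have "\<bar>\<integral>x. grad \<psi> x \<bullet> (grad \<phi> x + grad Q x) \<partial>lborel\<bar> = \<bar>\<Sum>k\<in>\<Lambda>. \<integral>x. \<psi> x * \<rho> k x \<partial>lborel\<bar>" by simp
  also have "\<dots> \<le> (\<Sum>k\<in>\<Lambda>. \<bar>\<integral>x. \<psi> x * \<rho> k x \<partial>lborel\<bar>)" by (rule sum_abs)
  also have "\<dots> \<le> (\<Sum>k\<in>\<Lambda>. Cr / L\<^sup>2 * 2 ^ CARD('n) * real CARD('n) * (\<integral>x. norm (grad \<psi> x) * indicator (lattice_cell k) x \<partial>lborel))"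
    by (intro sum_mono poincare_mean_zero[OF c1 lattice_cell_props(1,2) lattice_cell_measure(1) lattice_cell_props(3) of_nat_0_le_iff
          lattice_cell_measure(2) \<rho>(1,4,3)])
  also have "\<dots> = Cr / L\<^sup>2 * 2 ^ CARD('n) * real CARD('n) * (\<Sum>k\<in>\<Lambda>. \<integral>x. norm (grad \<psi> x) * indicator (lattice_cell k) x \<partial>lborel)"
    by (simp add: sum_distrib_left)
  also have "\<dots> \<le> Cr / L\<^sup>2 * 2 ^ CARD('n) * real CARD('n) * (norm2 lborel (grad \<psi>) * sqrt ((7 * L) ^ CARD('n)))"
  proof (rule mult_left_mono)
    let ?U = "\<Union>k\<in>\<Lambda>. lattice_cell k"
    have U: "?U \<in> sets borel" using \<Lambda>(1) lattice_cell_measure(1) by (intro sets.finite_UN) auto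
    have "emeasure lborel ?U \<le> (\<Sum>k\<in>\<Lambda>. emeasure lborel (lattice_cell k))"
      by (rule emeasure_subadditive_finite) (use \<Lambda>(1) lattice_cell_measure(1) in auto)
    also have "\<dots> = ennreal (real (card \<Lambda>))" by (simp add: lattice_cell_measure(2) ennreal_of_nat_eq_real_of_nat)
    finally have eU: "emeasure lborel ?U \<le> ennreal (real (card \<Lambda>))" .
    then have Uf: "emeasure lborel ?U < \<infinity>" by (auto simp: le_less_trans)
    have mU: "measure lborel ?U \<le> (7 * L) ^ CARD('n)"
    proof -
      have "measure lborel ?U \<le> real (card \<Lambda>)" unfolding measure_def using eU by (intro enn2real_leI) auto
      then show ?thesis using \<Lambda>(2) by linarith
    qed
    have fin: "emeasure lborel (lattice_cell (k::real^'n)) < \<infinity>" for k by (simp add: lattice_cell_measure(2))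
    have "(\<Sum>k\<in>\<Lambda>. \<integral>x. norm (grad \<psi> x) * indicator (lattice_cell k) x \<partial>lborel)
        = (\<integral>x. (\<Sum>k\<in>\<Lambda>. norm (grad \<psi> x) * indicator (lattice_cell k) x) \<partial>lborel)"
      by (rule Bochner_Integration.integral_sum[symmetric]) (rule integral_norm_indicator_le(1)[OF g\<psi> lattice_cell_measure(1) fin])
    also have "(\<lambda>x. \<Sum>k\<in>\<Lambda>. norm (grad \<psi> x) * indicator (lattice_cell k) x) = (\<lambda>x. norm (grad \<psi> x) * indicator ?U x)"
    proof
      fix x :: "real^'n"
      obtain k where k: "\<And>i. k $ i \<in> \<int>" "x \<in> lattice_cell k" using ex_lattice_cell[of x 0] by blast
      have u: "x \<in> lattice_cell j \<longleftrightarrow> k = j" if "j \<in> \<Lambda>" for j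
        using lattice_cell_unique[OF k(1) \<Lambda>(3)[OF that] k(2)] k(2) by blast
      have "(\<Sum>j\<in>\<Lambda>. norm (grad \<psi> x) * indicator (lattice_cell j) x) = (\<Sum>j\<in>\<Lambda>. if k = j then norm (grad \<psi> x) else 0)"
        by (rule sum.cong[OF refl]) (simp add: indicator_def u)
      also have "\<dots> = (if k \<in> \<Lambda> then norm (grad \<psi> x) else 0)" using \<Lambda>(1) by (simp add: sum.delta)
      also have "\<dots> = norm (grad \<psi> x) * indicator ?U x" using u k(2) by (auto simp: indicator_def)
      finally show "(\<Sum>j\<in>\<Lambda>. norm (grad \<psi> x) * indicator (lattice_cell j) x) = norm (grad \<psi> x) * indicator ?U x" .
    qed
    also have "(\<integral>x. norm (grad \<psi> x) * indicator ?U x \<partial>lborel) \<le> norm2 lborel (grad \<psi>) * sqrt (measure lborel ?U)"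
      by (rule integral_norm_indicator_le(2)[OF g\<psi> U Uf])
    also have "\<dots> \<le> norm2 lborel (grad \<psi>) * sqrt ((7 * L) ^ CARD('n))" using mU by (intro mult_left_mono) auto
    finally show "(\<Sum>k\<in>\<Lambda>. \<integral>x. norm (grad \<psi> x) * indicator (lattice_cell k) x \<partial>lborel) \<le> norm2 lborel (grad \<psi>) * sqrt ((7 * L) ^ CARD('n))" .
    show "0 \<le> Cr / L\<^sup>2 * 2 ^ CARD('n) * real CARD('n)" using Cr by simp
  qed
  finally show ?thesis by (simp only: mult_ac)
qed

lemma \<Phi>_energy: "(\<integral>x. (norm (grad \<Phi> x))\<^sup>2 \<partial>lborel) = L ^ CARD('n) / L\<^sup>2 * (\<integral>x. (norm (grad (bump 1 (0::real^'n)) x))\<^sup>2 \<partial>lborel)"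
  unfolding \<Phi>_def by (rule grad_bump_sq_integral(3)) (use L in simp)

lemma Q_sq_int: "sq_int lborel (grad Q)"
proof -
  have "bounded S1" unfolding S1_def using \<Lambda>(1) by (intro bounded_UN) auto
  then have "integrable lborel (\<lambda>x. (norm (grad Q x))\<^sup>2)"
  proof (rule integrable_continuous_support[rotated])
    show "continuous_on UNIV (\<lambda>x. (norm (grad Q x))\<^sup>2)"
      by (intro continuous_intros class_C_continuous_grad[OF class_C_pieces(5)])
    show "(norm (grad Q x))\<^sup>2 = 0" if "x \<notin> S1" for x using norm_grad_Q_le[of x] that by simp
  qed
  then show ?thesis
    using borel_measurable_continuous_onI[OF class_C_continuous_grad[OF class_C_pieces(5)]] by (simp add: sq_int_def)
qed

text \<open>The main term is the energy of \<open>\<Phi>\<close>, of order L^(d-2). Each of the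
  O(L^d) potentials has weight O(L^-2), and its field has an integral bounded independently of
  \<eta>, so together they pair with a gradient O(1/L) to order L^(d-3). The gradient of
  \<open>Q\<close> contributes L^-1 \<eta>^-1 (L \<eta>)^d.\<close>

lemma energy_lower_bound:
  fixes I1 Cg :: real
  assumes I1: "I1 = (\<integral>x. (norm (grad (bump 1 (0::real^'n)) x))\<^sup>2 \<partial>lborel)"
    and Cg: "Cg = (\<integral>x. beta (3/2 - real CARD('n) / 2) ((norm (x::real^'n))\<^sup>2) \<partial>lborel)"
  shows "L ^ CARD('n) / L\<^sup>2 * I1
    - (7 * L) ^ CARD('n) * (CL / (L\<^sup>2 * b0) * (4 * SB / L * Cg))
    - 4 * SB / L * (H / \<eta>) * (28 * real CARD('n) * (L * \<eta>)) ^ CARD('n)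
    \<le> \<bar>\<integral>x. grad \<Phi> x \<bullet> grad \<phi> x \<partial>lborel\<bar>"
proof -
  note g\<Phi> = sq_int_grad_test[OF \<Phi>_test] and gN = sq_int_grad_test[OF N_test]
  have eq: "grad \<Phi> x \<bullet> grad \<phi> x = (norm (grad \<Phi> x))\<^sup>2 - (\<Sum>k\<in>\<Lambda>. w k * (grad \<Phi> x \<bullet> grad (N k) x)) - grad \<Phi> x \<bullet> grad Q x" for x
    unfolding grad_\<phi> by (simp add: grad_W inner_diff_right inner_sum_right power2_norm_eq_inner)
  have i: "integrable lborel (\<lambda>x. (norm (grad \<Phi> x))\<^sup>2)" "\<And>k. integrable lborel (\<lambda>x. grad \<Phi> x \<bullet> grad (N k) x)"
    "integrable lborel (\<lambda>x. grad \<Phi> x \<bullet> grad Q x)"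
    using g\<Phi> integrable_inner_sq_int[OF g\<Phi> gN] integrable_inner_sq_int[OF g\<Phi> Q_sq_int] by (auto simp: sq_int_def)
  have main: "(\<integral>x. grad \<Phi> x \<bullet> grad \<phi> x \<partial>lborel) = (\<integral>x. (norm (grad \<Phi> x))\<^sup>2 \<partial>lborel)
      - (\<Sum>k\<in>\<Lambda>. w k * (\<integral>x. grad \<Phi> x \<bullet> grad (N k) x \<partial>lborel)) - (\<integral>x. grad \<Phi> x \<bullet> grad Q x \<partial>lborel)"
    unfolding eq using i by simp
  have SBL: "0 \<le> 4 * SB / L" using SB(1) L by simp
  have Cg0: "0 \<le> Cg" unfolding Cg by (rule less_imp_le[OF integral_beta(1)])
  have bN: "\<bar>\<integral>x. grad \<Phi> x \<bullet> grad (N k) x \<partial>lborel\<bar> \<le> 4 * SB / L * Cg" for k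
  proof -
    have a: "0 < c0 * \<eta>" using T \<eta> by simp
    have ip: "integrable lborel (\<lambda>x. pole (1/2 - real CARD('n) / 2) (c0 * \<eta>) ((norm (x - k))\<^sup>2))"
      by (rule integrable_radial(2)[OF smooth1_continuous[OF smooth1_pole[OF a]]]) (rule pole_0[OF a], simp)
    have "\<bar>\<integral>x. grad \<Phi> x \<bullet> grad (N k) x \<partial>lborel\<bar> \<le> (\<integral>x. \<bar>grad \<Phi> x \<bullet> grad (N k) x\<bar> \<partial>lborel)" by (rule integral_abs_bound)
    also have "\<dots> \<le> (\<integral>x. 4 * SB / L * pole (1/2 - real CARD('n) / 2) (c0 * \<eta>) ((norm (x - k))\<^sup>2) \<partial>lborel)"
    proof (rule integral_mono)
      fix x
      have "\<bar>grad \<Phi> x \<bullet> grad (N k) x\<bar> \<le> norm (grad \<Phi> x) * norm (grad (N k) x)" by (rule Cauchy_Schwarz_ineq2)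
      also have "\<dots> \<le> 4 * SB / L * norm (grad (N k) x)" by (intro mult_right_mono norm_grad_\<Phi>_le) simp
      finally show "\<bar>grad \<Phi> x \<bullet> grad (N k) x\<bar> \<le> 4 * SB / L * pole (1/2 - real CARD('n) / 2) (c0 * \<eta>) ((norm (x - k))\<^sup>2)"
        by (simp add: norm_grad_N)
    qed (use i ip in auto)
    also have "\<dots> = 4 * SB / L * (\<integral>x. pole (1/2 - real CARD('n) / 2) (c0 * \<eta>) ((norm (x - k))\<^sup>2) \<partial>lborel)" by simp
    also have "\<dots> \<le> 4 * SB / L * Cg" unfolding Cg by (intro mult_left_mono integral_pole_le a SBL)
    finally show ?thesis .
  qed
  have b1: "\<bar>\<Sum>k\<in>\<Lambda>. w k * (\<integral>x. grad \<Phi> x \<bullet> grad (N k) x \<partial>lborel)\<bar> \<le> (7 * L) ^ CARD('n) * (CL / (L\<^sup>2 * b0) * (4 * SB / L * Cg))"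
  proof -
    have "\<bar>\<Sum>k\<in>\<Lambda>. w k * (\<integral>x. grad \<Phi> x \<bullet> grad (N k) x \<partial>lborel)\<bar> \<le> (\<Sum>k\<in>\<Lambda>. \<bar>w k * (\<integral>x. grad \<Phi> x \<bullet> grad (N k) x \<partial>lborel)\<bar>)" by (rule sum_abs)
    also have "\<dots> \<le> (\<Sum>k\<in>\<Lambda>. CL / (L\<^sup>2 * b0) * (4 * SB / L * Cg))"
      unfolding abs_mult using CL b0_pos by (intro sum_mono mult_mono abs_w_le bN) auto
    also have "\<dots> = real (card \<Lambda>) * (CL / (L\<^sup>2 * b0) * (4 * SB / L * Cg))" by simp
    also have "\<dots> \<le> (7 * L) ^ CARD('n) * (CL / (L\<^sup>2 * b0) * (4 * SB / L * Cg))"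
      using \<Lambda>(2) CL b0_pos SBL Cg0 by (intro mult_right_mono mult_nonneg_nonneg) auto
    finally show ?thesis .
  qed
  have b2: "\<bar>\<integral>x. grad \<Phi> x \<bullet> grad Q x \<partial>lborel\<bar> \<le> 4 * SB / L * (H / \<eta>) * (28 * real CARD('n) * (L * \<eta>)) ^ CARD('n)"
  proof -
    have fin: "emeasure lborel S1 < \<infinity>" using S1(2) by (auto simp: le_less_trans)
    have H0: "0 \<le> H / \<eta>" using H \<eta> by simp
    have "\<bar>\<integral>x. grad \<Phi> x \<bullet> grad Q x \<partial>lborel\<bar> \<le> (\<integral>x. \<bar>grad \<Phi> x \<bullet> grad Q x\<bar> \<partial>lborel)" by (rule integral_abs_bound)
    also have "\<dots> \<le> (\<integral>x. 4 * SB / L * (H / \<eta>) * indicator S1 x \<partial>lborel)"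
    proof (rule integral_mono)
      fix x
      have "\<bar>grad \<Phi> x \<bullet> grad Q x\<bar> \<le> norm (grad \<Phi> x) * norm (grad Q x)" by (rule Cauchy_Schwarz_ineq2)
      also have "\<dots> \<le> 4 * SB / L * (H / \<eta> * indicator S1 x)"
        using SBL by (intro mult_mono norm_grad_\<Phi>_le norm_grad_Q_le) auto
      finally show "\<bar>grad \<Phi> x \<bullet> grad Q x\<bar> \<le> 4 * SB / L * (H / \<eta>) * indicator S1 x" by (simp only: mult.assoc)
      show "integrable lborel (\<lambda>x. 4 * SB / L * (H / \<eta>) * indicator S1 x)"
        by (intro integrable_mult_right integrable_real_indicator) (use fin S1(1) in auto)
    qed (use i in auto)
    also have "\<dots> = 4 * SB / L * (H / \<eta>) * measure lborel S1" by simp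
    also have "\<dots> \<le> 4 * SB / L * (H / \<eta>) * (28 * real CARD('n) * (L * \<eta>)) ^ CARD('n)"
    proof (rule mult_left_mono)
      show "measure lborel S1 \<le> (28 * real CARD('n) * (L * \<eta>)) ^ CARD('n)"
        unfolding measure_def using S1(2) L \<eta> by (intro enn2real_leI) auto
    qed (use SBL H0 in \<open>intro mult_nonneg_nonneg\<close>)
    finally show ?thesis .
  qed
  show ?thesis unfolding main \<Phi>_energy I1[symmetric] using b1 b2 by linarith
qed

end

section \<open>The lower bound\<close>

text \<open>The exponents \<alpha> and 1 - \<alpha> of the two support measures add up to one, so
  \<open>L\<close> enters the denominator as L^(m-1) whatever \<alpha> is. Against L^(m-2) only 1/L
  remains.\<close>

lemma bound_simplify:
  fixes I H S c L \<eta> \<alpha> :: real and m :: nat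
  assumes "0 < L" "0 < \<eta>" "0 < c" "0 < H" "0 < S"
  shows "(I / 2 * (L ^ m / L\<^sup>2)) / (H / \<eta> * ((c * (L * \<eta>)) ^ m) powr \<alpha> * (S / L) * ((4 * L) ^ m) powr (1 - \<alpha>))
    = I / (2 * H * S * c powr (m * \<alpha>) * 4 powr (m * (1 - \<alpha>))) * (1 / L * \<eta> powr (1 - m * \<alpha>))"
proof -
  have pw: "(x ^ m) powr b = x powr (m * b)" if "0 < x" for x b :: real
    using that by (simp add: powr_realpow[symmetric] powr_powr)
  have 1: "((c * (L * \<eta>)) ^ m) powr \<alpha> = c powr (m * \<alpha>) * L powr (m * \<alpha>) * \<eta> powr (m * \<alpha>)"
    using assms by (simp add: pw powr_mult)
  have 2: "((4 * L) ^ m) powr (1 - \<alpha>) = 4 powr (m * (1 - \<alpha>)) * L powr (m * (1 - \<alpha>))"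
    using assms by (simp add: pw powr_mult)
  have 3: "L powr (m * \<alpha>) * L powr (m * (1 - \<alpha>)) = L ^ m"
    using assms by (simp add: powr_add[symmetric] powr_realpow[symmetric] algebra_simps)
  have 4: "\<eta> powr (1 - m * \<alpha>) = \<eta> / \<eta> powr (m * \<alpha>)" using assms by (simp add: powr_diff)
  have "H / \<eta> * ((c * (L * \<eta>)) ^ m) powr \<alpha> * (S / L) * ((4 * L) ^ m) powr (1 - \<alpha>)
      = (H * S * c powr (m * \<alpha>) * 4 powr (m * (1 - \<alpha>))) * (L powr (m * \<alpha>) * L powr (m * (1 - \<alpha>))) * \<eta> powr (m * \<alpha>) / (\<eta> * L)"
    unfolding 1 2 by simp
  also have "\<dots> = (H * S * c powr (m * \<alpha>) * 4 powr (m * (1 - \<alpha>))) * L ^ m * \<eta> powr (m * \<alpha>) / (\<eta> * L)" by (simp only: 3)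
  finally have den: "H / \<eta> * ((c * (L * \<eta>)) ^ m) powr \<alpha> * (S / L) * ((4 * L) ^ m) powr (1 - \<alpha>)
      = (H * S * c powr (m * \<alpha>) * 4 powr (m * (1 - \<alpha>))) * L ^ m * \<eta> powr (m * \<alpha>) / (\<eta> * L)" .
  have gen: "(I / 2 * (A / L\<^sup>2)) / (D * A * E / (\<eta> * L)) = I / (2 * D) * (1 / L * (\<eta> / E))"
    if "0 < A" "0 < D" "0 < E" for A D E
    using that assms by (simp add: field_simps power2_eq_square)
  have "0 < H * S * c powr (m * \<alpha>) * 4 powr (m * (1 - \<alpha>))" "0 < L ^ m" "0 < \<eta> powr (m * \<alpha>)" using assms by auto
  from gen[OF this(2,1,3)] show ?thesis unfolding den 4 by (simp only: mult.assoc)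
qed

context construction
begin

text \<open>The two admissible values of \<alpha> correspond to the two data: for 1/p the equation
  is solved with grad Q, for 1 - 1/p with grad \<Phi>. Condition \<open>c1\<close> collects the
  errors of relative size 1/L, and \<open>c2\<close> the one of relative size L
  \<eta>^(d-1).\<close>

lemma A_const_lower_bound:
  fixes I1 Cg :: real
  assumes I1: "I1 = (\<integral>x. (norm (grad (bump 1 (0::real^'n)) x))\<^sup>2 \<partial>lborel)"
    and Cg: "Cg = (\<integral>x. beta (3/2 - real CARD('n) / 2) ((norm (x::real^'n))\<^sup>2) \<partial>lborel)"
    and T': "compact T" "ball 0 c0 \<subseteq> T" and p: "1 < p" and \<epsilon>: "0 < \<epsilon>"
    and c1: "(7 ^ CARD('n) * (CL / b0 * (4 * SB * Cg)) + Cr * 2 ^ CARD('n) * real CARD('n) * sqrt (7 ^ CARD('n)) * sqrt I1) / L \<le> I1 / 4"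
    and c2: "4 * SB * H * (28 * real CARD('n)) ^ CARD('n) * (L * (\<eta> ^ CARD('n) / \<eta>)) \<le> I1 / 4"
    and \<alpha>: "\<alpha> = 1 / p \<or> \<alpha> = 1 - 1 / p"
  shows "A_const p T \<epsilon> \<eta> \<ge> ennreal (I1 / (2 * H * (4 * SB) * (28 * real CARD('n)) powr (real CARD('n) * \<alpha>) * 4 powr (real CARD('n) * (1 - \<alpha>)))
    * (1 / L * \<eta> powr (1 - real CARD('n) * \<alpha>)))"
proof -
  have L0: "0 < L" using L by simp
  have I1p: "0 < I1" unfolding I1 by (rule grad_bump_sq_integral(1))
  let ?E = "Cr / L\<^sup>2 * 2 ^ CARD('n) * real CARD('n) * sqrt ((7 * L) ^ CARD('n))"
  let ?\<kappa> = "I1 / 2 * (L ^ CARD('n) / L\<^sup>2)"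
  define l where "l = L ^ CARD('n) / L\<^sup>2"
  have l: "0 < l" using L0 by (simp add: l_def)
  have n2: "norm2 lborel (grad \<Phi>) = sqrt (L ^ CARD('n)) / L * sqrt I1"
    using L0 by (simp add: norm2_def \<Phi>_energy I1 real_sqrt_mult real_sqrt_divide)
  have EN: "?E * norm2 lborel (grad \<Phi>) = l * (Cr * 2 ^ CARD('n) * real CARD('n) * sqrt (7 ^ CARD('n)) * sqrt I1 / L)"
  proof -
    have "sqrt ((7 * L) ^ CARD('n)) * sqrt (L ^ CARD('n)) = sqrt (7 ^ CARD('n)) * L ^ CARD('n)"
      using L0 by (simp add: power_mult_distrib real_sqrt_mult)
    moreover have "(u * x) * (y / L * v) = u * (x * y) * (v / L)" for u x y v :: real by simp
    ultimately have "?E * norm2 lborel (grad \<Phi>) = (Cr / L\<^sup>2 * 2 ^ CARD('n) * real CARD('n)) * (sqrt (7 ^ CARD('n)) * L ^ CARD('n)) * (sqrt I1 / L)"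
      unfolding n2 by simp
    then show ?thesis by (simp add: l_def)
  qed
  have b1: "(7 * L) ^ CARD('n) * (CL / (L\<^sup>2 * b0) * (4 * SB / L * Cg)) = l * (7 ^ CARD('n) * (CL / b0 * (4 * SB * Cg)) / L)"
    by (simp add: l_def power_mult_distrib mult_ac)
  have b2: "4 * SB / L * (H / \<eta>) * (28 * real CARD('n) * (L * \<eta>)) ^ CARD('n)
      = l * (4 * SB * H * (28 * real CARD('n)) ^ CARD('n) * (L * (\<eta> ^ CARD('n) / \<eta>)))"
    using L0 by (simp add: l_def power_mult_distrib power2_eq_square)
  \<comment> \<open>One quarter of the energy pays for the two errors of order 1/L, one quarter for
    the pairing with grad Q, and one half remains for \<kappa>.\<close>
  have gen: "t / 2 + A2 \<le> X" if "A1 + A2 \<le> t / 4" "A3 \<le> t / 4" "t - A1 - A3 \<le> X" for t A1 A2 A3 X :: real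
    using that by linarith
  have "(l * I1) / 2 + ?E * norm2 lborel (grad \<Phi>) \<le> \<bar>\<integral>x. grad \<Phi> x \<bullet> grad \<phi> x \<partial>lborel\<bar>"
    unfolding EN
  proof (rule gen[OF _ _ energy_lower_bound[OF I1 Cg, unfolded b1 b2, folded l_def]])
    show "l * (7 ^ CARD('n) * (CL / b0 * (4 * SB * Cg)) / L) + l * (Cr * 2 ^ CARD('n) * real CARD('n) * sqrt (7 ^ CARD('n)) * sqrt I1 / L) \<le> l * I1 / 4"
      using mult_left_mono[OF c1 less_imp_le[OF l]] by (simp only: add_divide_distrib distrib_left times_divide_eq_right)
    show "l * (4 * SB * H * (28 * real CARD('n)) ^ CARD('n) * (L * (\<eta> ^ CARD('n) / \<eta>))) \<le> l * I1 / 4"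
      using mult_left_mono[OF c2 less_imp_le[OF l]] by (simp only: times_divide_eq_right)
  qed
  moreover have "?\<kappa> = (l * I1) / 2" by (simp add: l_def mult.commute)
  ultimately have \<kappa>2: "?\<kappa> + ?E * norm2 lborel (grad \<Phi>) \<le> \<bar>\<integral>x. grad \<Phi> x \<bullet> grad \<phi> x \<partial>lborel\<bar>" by simp
  have \<kappa>1: "0 < ?\<kappa>" using I1p L0 by simp
  let ?S2 = "cbox (0 - (\<chi> i. 2 * L)) (0 + (\<chi> i. 2 * L)) :: (real^'n) set"
  have S2: "?S2 \<in> sets borel" "emeasure lborel ?S2 \<le> ennreal ((4 * L) ^ CARD('n))"
    using measure_cube[of "2 * L" "0::real^'n"] L0 by simp_all
  have hb: "norm (grad \<Phi> x) \<le> 4 * SB / L * indicator ?S2 x" for x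
  proof (cases "x \<in> ?S2")
    case True
    then show ?thesis using norm_grad_\<Phi>_le[of x] by simp
  next
    case False
    then have "\<not> norm (x - 0) \<le> 2 * L" using mem_cube[of x 0 "2 * L"] by blast
    then have "\<not> (norm (x - 0))\<^sup>2 \<le> 2 * L\<^sup>2" using norm_le_of_sq[OF L0, of "x - 0"] by blast
    then have "grad \<Phi> x = 0" unfolding \<Phi>_def by (intro bump_outside(2)[OF L0]) simp
    then show ?thesis using SB(1) L0 by simp
  qed
  have pos: "0 < H / \<eta>" "0 < 4 * SB / L" "0 < (28 * real CARD('n) * (L * \<eta>)) ^ CARD('n)" "0 < (4 * L) ^ CARD('n)"
    using H \<eta> SB(1) L0 by auto
  have E0: "0 \<le> ?E" using Cr L0 by simp
  note main = A_const_ge_scaled[OF T'(1) T'(2) T(2) \<eta>(1) \<epsilon> p \<phi>_test Q_sq_int sq_int_grad_test[OF \<Phi>_test] E0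
      approximate_equation[OF T'(2)] \<kappa>1 \<kappa>2 norm_grad_Q_le hb S1(1) S2(1) S1(2) S2(2) pos]
  have SB0: "0 < 4 * SB" "0 < 28 * real CARD('n)" using SB(1) by auto
  note simpl = bound_simplify[OF L0 \<eta>(1) SB0(2) H SB0(1), of I1 "CARD('n)"]
  from \<alpha> show ?thesis
  proof
    assume "\<alpha> = 1 / p"
    then show ?thesis using main(1) simpl[of \<alpha>] by simp
  next
    assume a: "\<alpha> = 1 - 1 / p"
    have e: "4 * SB / L * ((4 * L) ^ CARD('n)) powr (1 / p) * (H / \<eta>) * ((28 * real CARD('n) * (L * \<eta>)) ^ CARD('n)) powr (1 - 1 / p)
      = H / \<eta> * ((28 * real CARD('n) * (L * \<eta>)) ^ CARD('n)) powr \<alpha> * (4 * SB / L) * ((4 * L) ^ CARD('n)) powr (1 - \<alpha>)"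
      unfolding a by (simp only: mult_ac) simp
    show ?thesis using main(2) unfolding e simpl .
  qed
qed

end

context smooth_step
begin

text \<open>\<open>l\<close> is the critical scale as a function of \<eta> and \<open>q\<close> the
  exact radial potential; both dimension ranges become instances. \<open>l2\<close> and
  \<open>l3\<close> make the errors of order 1/L and L \<eta>^(d-1) vanish in the limit, while
  \<open>l1\<close> and \<open>l4\<close> say that the scale is large enough.\<close>

lemma A_const_lower_bound_small:
  fixes T :: "(real^'n) set" and l :: "real \<Rightarrow> real"
  assumes T: "compact T" "T \<subseteq> unit_cell" "0 < c0" "ball 0 c0 \<subseteq> T" and p: "1 < p"
    and \<alpha>: "\<alpha> = 1 / p \<or> \<alpha> = 1 - 1 / p"
    and l1: "\<forall>\<^sub>F \<eta> in at_right 0. \<eta> powr (2 - real CARD('n)) \<le> (l \<eta>)\<^sup>2"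
    and l2: "filterlim l at_top (at_right 0)"
    and l3: "((\<lambda>\<eta>. l \<eta> * (\<eta> ^ CARD('n) / \<eta>)) \<longlongrightarrow> 0) (at_right 0)"
    and q: "\<And>s. 0 < s \<Longrightarrow> (q has_real_derivative - (s powr (- (real CARD('n) / 2))) / 2) (at s)" "0 \<le> q (1/8)"
    and l4: "\<forall>\<^sub>F \<eta> in at_right 0. q ((c0 * \<eta>)\<^sup>2 / 2) \<le> Cn * (l \<eta>)\<^sup>2"
  shows "\<exists>c>0. \<forall>\<^sub>F \<eta> in at_right 0. \<forall>\<epsilon>>0. A_const p T \<epsilon> \<eta> \<ge> ennreal (c * (1 / l \<eta> * \<eta> powr (1 - real CARD('n) * \<alpha>)))"
proof -
  define b0 where "b0 = (\<integral>x. beta (1 - real CARD('n) / 2) ((norm (x::real^'n))\<^sup>2) \<partial>lborel)"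
  define I1 where "I1 = (\<integral>x. (norm (grad (bump 1 (0::real^'n)) x))\<^sup>2 \<partial>lborel)"
  define Cg where "Cg = (\<integral>x. beta (3/2 - real CARD('n) / 2) ((norm (x::real^'n))\<^sup>2) \<partial>lborel)"
  have b0: "0 < b0" unfolding b0_def by (rule integral_beta)
  have I1: "0 < I1" unfolding I1_def by (rule grad_bump_sq_integral)
  obtain Bb where Bb: "\<And>s. norm (beta (1 - real CARD('n) / 2) s) \<le> Bb"
  proof (rule continuous_bounded_support_imp_bounded[OF smooth1_continuous[OF smooth1_beta], of "{0..1/8}"])
    show "beta (1 - real CARD('n) / 2) s = 0" if "s \<notin> {0..1/8}" for s
    proof (cases "s < 0")
      case True
      then show ?thesis by (simp add: beta_def st'_0)
    qed (use that beta_props(2) in auto)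
  qed auto
  \<comment> \<open>These repeat the constants of the construction before any \<eta> is fixed, so
    that \<open>c\<close> is visibly independent of \<eta> and \<epsilon>. The absolute value of
    \<open>Cn\<close> ensures positivity of \<open>H'\<close>.\<close>
  define CL' where "CL' = (2 * real CARD('n) + 8) * SB"
  define H' where "H' = 4 * SB + CL' / b0 * (c0\<^sup>2 / 2) powr (1/2 - real CARD('n) / 2) + (1 + CL' * \<bar>Cn\<bar> / b0) * (4 * SB)"
  define Cr' where "Cr' = CL' + CL' / b0 * Bb"
  have CL': "0 < CL'" using SB(1) by (simp add: CL'_def add_nonneg_pos)
  have H': "0 < H'"
  proof -
    have "0 < 4 * SB" "0 \<le> CL' / b0 * (c0\<^sup>2 / 2) powr (1/2 - real CARD('n) / 2)" "0 \<le> (1 + CL' * \<bar>Cn\<bar> / b0) * (4 * SB)"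
      using SB(1) CL' b0 by auto
    then show ?thesis unfolding H'_def by linarith
  qed
  let ?k1 = "7 ^ CARD('n) * (CL' / b0 * (4 * SB * Cg)) + Cr' * 2 ^ CARD('n) * real CARD('n) * sqrt (7 ^ CARD('n)) * sqrt I1"
  let ?k2 = "4 * SB * H' * (28 * real CARD('n)) ^ CARD('n)"
  define c where "c = I1 / (2 * H' * (4 * SB) * (28 * real CARD('n)) powr (real CARD('n) * \<alpha>) * 4 powr (real CARD('n) * (1 - \<alpha>)))"
  have c: "0 < c" using I1 H' SB(1) by (simp add: c_def)
  have "((\<lambda>\<eta>. ?k1 / l \<eta>) \<longlongrightarrow> 0) (at_right 0)"
    by (rule real_tendsto_divide_at_top[OF tendsto_const l2])
  then have e1: "\<forall>\<^sub>F \<eta> in at_right 0. ?k1 / l \<eta> < I1 / 4" using I1 by (intro order_tendstoD) auto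
  have "((\<lambda>\<eta>. ?k2 * (l \<eta> * (\<eta> ^ CARD('n) / \<eta>))) \<longlongrightarrow> ?k2 * 0) (at_right 0)"
    by (intro tendsto_mult tendsto_const l3)
  then have e2: "\<forall>\<^sub>F \<eta> in at_right 0. ?k2 * (l \<eta> * (\<eta> ^ CARD('n) / \<eta>)) < I1 / 4" using I1 by (intro order_tendstoD) auto
  have e3: "\<forall>\<^sub>F \<eta> in at_right 0. 1 \<le> l \<eta>" using l2 by (simp add: filterlim_at_top)
  \<comment> \<open>The first bound gives R \<le> 1/8, the second gives c0 * \<eta> < 1/4 as the
    truncated potential requires.\<close>
  define \<eta>1 where "\<eta>1 = min (1 / (8 * real CARD('n))) (1 / (8 * c0))"
  have "0 < \<eta>1" using T(3) by (simp add: \<eta>1_def)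
  then have e4: "\<forall>\<^sub>F \<eta> in at_right 0. 0 < \<eta> \<and> \<eta> < \<eta>1" by (simp add: eventually_at_right_less eventually_conj eventually_at_right_field exI[of _ \<eta>1])
  have "\<forall>\<^sub>F \<eta> in at_right 0. \<forall>\<epsilon>>0. A_const p T \<epsilon> \<eta> \<ge> ennreal (c * (1 / l \<eta> * \<eta> powr (1 - real CARD('n) * \<alpha>)))"
    using l1 l4 e1 e2 e3 e4
  proof eventually_elim
    case (elim \<eta>)
    have \<eta>: "0 < \<eta>" "\<eta> \<le> 1 / (8 * real CARD('n))" "\<eta> < 1 / (8 * c0)" using elim by (auto simp: \<eta>1_def)
    have a: "0 < c0 * \<eta>" "c0 * \<eta> < 1/4" using \<eta> T(3) by (auto simp: field_simps)
    obtain n where n: "smooth1 n" "\<And>s. (n has_real_derivative - pole (- (real CARD('n) / 2)) (c0 * \<eta>) s / 2) (at s)"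
      "\<And>s. 1/8 \<le> s \<Longrightarrow> n s = 0" "\<And>s. 0 \<le> n s" "\<And>s. n s \<le> n ((c0 * \<eta>)\<^sup>2 / 2)"
      "\<forall>q. (\<forall>s>0. (q has_real_derivative - (s powr (- (real CARD('n) / 2))) / 2) (at s)) \<and> 0 \<le> q (1/8) \<longrightarrow> n ((c0 * \<eta>)\<^sup>2 / 2) \<le> q ((c0 * \<eta>)\<^sup>2 / 2)"
      by (rule ex_newtonian_potential[OF a]) (rule that)
    have nb: "n s \<le> \<bar>Cn\<bar> * (l \<eta>)\<^sup>2" for s
    proof -
      have "n s \<le> q ((c0 * \<eta>)\<^sup>2 / 2)" using n(5)[of s] n(6)[rule_format, of q] q by fastforce
      also have "\<dots> \<le> Cn * (l \<eta>)\<^sup>2" using elim by simp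
      also have "\<dots> \<le> \<bar>Cn\<bar> * (l \<eta>)\<^sup>2" by (intro mult_right_mono) auto
      finally show ?thesis .
    qed
    interpret c: construction st st' st'' T c0 \<eta> "l \<eta>" "\<bar>Cn\<bar>" b0 Bb n
    proof unfold_locales
      show "beta (1 - real CARD('n) / 2) s \<le> Bb" for s using Bb[of s] by simp
    qed (use T \<eta> a elim n nb in \<open>auto simp: b0_def\<close>)
    have eq: "c.CL = CL'" "c.H = H'" "c.Cr = Cr'"
      by (simp_all add: c.CL_def c.H_def c.Cr_def CL'_def H'_def Cr'_def)
    show ?case
    proof (intro allI impI)
      fix \<epsilon> :: real assume "0 < \<epsilon>"
      show "A_const p T \<epsilon> \<eta> \<ge> ennreal (c * (1 / l \<eta> * \<eta> powr (1 - real CARD('n) * \<alpha>)))"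
        unfolding c_def
        by (rule c.A_const_lower_bound[OF I1_def Cg_def T(1,4) p \<open>0 < \<epsilon>\<close> _ _ \<alpha>, unfolded eq])
          (use elim in simp_all)
    qed
  qed
  then show ?thesis using c by blast
qed

text \<open>A bump at the corner of the cell is a test function for every \<eta> \<le> 1 and solves
  the equation exactly with datum minus its own gradient. The approximation error is then 0, and
  neither the bump nor its bound depends on \<eta>.\<close>

lemma A_const_lower_bound_uniform:
  fixes T :: "(real^'n) set"
  assumes T: "compact T" "0 < c0" "ball 0 c0 \<subseteq> T" and p: "1 < p"
    and \<rho>: "0 < \<rho>" "\<And>t i. t \<in> T \<Longrightarrow> \<bar>t $ i\<bar> \<le> 1/2 - \<rho>"
  shows "\<exists>c>0. \<forall>\<epsilon> \<eta>. 0 < \<epsilon> \<and> 0 < \<eta> \<and> \<eta> \<le> 1 \<longrightarrow> A_const p T \<epsilon> \<eta> \<ge> ennreal c"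
proof -
  \<comment> \<open>The bump lives within distance 2 * r = \<rho> / 2 of the corner, strictly inside
    the ball of radius \<rho> free of holes.\<close>
  define r where "r = \<rho> / 4"
  define z :: "real^'n" where "z = (\<chi> i. 1/2)"
  let ?f = "bump r (z :: real^'n)"
  have r: "0 < r" using \<rho> by (simp add: r_def)
  have z0: "?f x = 0" if "x \<notin> cball z (2 * r)" for x
  proof (rule bump_outside(1)[OF r])
    have "\<not> (norm (x - z))\<^sup>2 \<le> 2 * r\<^sup>2" using norm_le_of_sq[OF r, of "x - z"] that by (auto simp: dist_norm norm_minus_commute)
    then show "2 * r\<^sup>2 \<le> (norm (x - z))\<^sup>2" by simp
  qed
  then have s0: "{x. ?f x \<noteq> 0} \<subseteq> cball z (2 * r)" by blast
  then have sub: "closure {x. ?f x \<noteq> 0} \<subseteq> cball z (2 * r)" by (rule closure_minimal) simp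
  have "bounded {x. ?f x \<noteq> 0}" by (rule bounded_subset[OF bounded_cball s0])
  then have t: "?f \<in> test_functions (perforated_domain T 1 \<eta>)" if "0 < \<eta>" "\<eta> \<le> 1" for \<eta>
  proof -
    have "cball z (2 * r) \<subseteq> ball z \<rho>" using \<rho>(1) by (auto simp: r_def)
    moreover have "ball z \<rho> \<subseteq> perforated_domain T 1 \<eta>"
      unfolding z_def by (rule corner_ball_in_perforated_domain) (use \<rho> that in auto)
    ultimately have "cball z (2 * r) \<subseteq> perforated_domain T 1 \<eta>" by blast
    then show ?thesis using sub \<open>bounded _\<close> class_C_bump by (auto simp: test_functions_def compact_closure)
  qed
  have sq: "sq_int lborel (grad ?f)" by (rule grad_bump_sq_integral(2)[OF r])
  define I where "I = (\<integral>x. (norm (grad ?f x))\<^sup>2 \<partial>lborel)"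
  have I: "0 < I"
    unfolding I_def
  proof (rule integral_pos_if_continuous)
    show "integrable lborel (\<lambda>x. (norm (grad ?f x))\<^sup>2)" using sq by (simp add: sq_int_def)
    show "continuous_on UNIV (\<lambda>x. (norm (grad ?f x))\<^sup>2)"
      by (intro continuous_intros class_C_continuous_grad[OF class_C_bump])
    fix j :: 'n
    let ?x = "z + axis j (sqrt (3/2 * r\<^sup>2))"
    have n: "(norm (?x - z))\<^sup>2 = 3/2 * r\<^sup>2" by (simp add: power2_norm_eq_inner inner_axis)
    have "0 < st' ((norm (?x - z))\<^sup>2 / r\<^sup>2)" unfolding n using r by (simp add: st'_pos)
    moreover have "?x - z \<noteq> 0" using n r by auto
    ultimately show "0 < (norm (grad ?f ?x))\<^sup>2" using r by (simp add: grad_bump)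
  qed auto
  let ?S = "cbox (z - (\<chi> i. 2 * r)) (z + (\<chi> i. 2 * r)) :: (real^'n) set"
  let ?m = "(2 * (2 * r)) ^ CARD('n)" and ?H = "4 * SB / r"
  have S: "?S \<in> sets borel" "emeasure lborel ?S \<le> ennreal ?m" using measure_cube[of "2 * r" z] r by simp_all
  have b: "norm (grad ?f x) \<le> ?H * indicator ?S x" for x
  proof (cases "x \<in> ?S")
    case True
    then show ?thesis using norm_grad_bump_le[OF r, of z x] by simp
  next
    case False
    then have "\<not> (norm (x - z))\<^sup>2 \<le> 2 * r\<^sup>2" using norm_le_of_sq[OF r, of "x - z"] mem_cube[of x z "2 * r"] by blast
    then have "grad ?f x = 0" by (intro bump_outside(2)[OF r]) simp
    then show ?thesis using SB(1) r by simp
  qed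
  have bm: "norm (- grad ?f x) \<le> ?H * indicator ?S x" for x using b[of x] by simp
  have sqm: "sq_int lborel (\<lambda>x. - grad ?f x)" using sq_int_scaleR[OF sq, of "-1"] by simp
  have pos: "0 < ?H" "0 < ?m" using SB(1) r by auto
  define c where "c = I / (?H * ?m powr (1 / p) * ?H * ?m powr (1 - 1 / p))"
  have "A_const p T \<epsilon> \<eta> \<ge> ennreal c" if "0 < \<epsilon>" "0 < \<eta>" "\<eta> \<le> 1" for \<epsilon> \<eta>
    unfolding c_def
  proof (rule A_const_ge_scaled(1)[OF T(1,3,2) that(2,1) p t[OF that(2,3)] sqm sq order_refl _ I _ bm b S(1) S(1) S(2) S(2) pos(1,1,2,2)])
    show "I + 0 * norm2 lborel (grad ?f) \<le> \<bar>\<integral>x. grad ?f x \<bullet> grad ?f x \<partial>lborel\<bar>"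
      by (simp add: I_def power2_norm_eq_inner)
  qed simp
  moreover have "0 < c"
  proof -
    have "0 < i / (h * m powr s * h * m powr t)" if "0 < i" "0 < h" "0 < m" for i h m s t :: real using that by simp
    from this[OF I pos] show ?thesis by (simp only: c_def)
  qed
  ultimately show ?thesis by blast
qed

end

text \<open>Away from 0 the function \<open>g\<close> is bounded, so the uniform bound dominates a
  small multiple of it. The cutoff \<open>\<eta>0\<close> comes from the limit statement and does
  not depend on \<open>\<epsilon>\<close>, hence neither does the constant.\<close>

lemma lower_bound_combine:
  fixes A :: "real \<Rightarrow> real \<Rightarrow> ennreal" and g :: "real \<Rightarrow> real"
  assumes "\<exists>c>0. \<forall>\<^sub>F \<eta> in at_right 0. \<forall>\<epsilon>>0. A \<epsilon> \<eta> \<ge> ennreal (c * g \<eta>)"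
    and "\<exists>c>0. \<forall>\<epsilon> \<eta>. 0 < \<epsilon> \<and> 0 < \<eta> \<and> \<eta> \<le> 1 \<longrightarrow> A \<epsilon> \<eta> \<ge> ennreal c"
    and g: "\<And>\<eta>. 0 < \<eta> \<Longrightarrow> 0 \<le> g \<eta>"
    and bd: "\<And>\<eta>0. 0 < \<eta>0 \<Longrightarrow> \<exists>B. \<forall>\<eta>. \<eta>0 \<le> \<eta> \<and> \<eta> \<le> 1 \<longrightarrow> g \<eta> \<le> B"
  shows "\<exists>c>0. \<forall>\<epsilon> \<eta>. 0 < \<epsilon> \<and> \<epsilon> \<le> 1 \<and> 0 < \<eta> \<and> \<eta> \<le> 1 \<longrightarrow> A \<epsilon> \<eta> \<ge> ennreal (c * g \<eta>)"
proof -
  obtain c1 where c1: "0 < c1" "\<forall>\<^sub>F \<eta> in at_right 0. \<forall>\<epsilon>>0. A \<epsilon> \<eta> \<ge> ennreal (c1 * g \<eta>)" using assms(1) by blast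
  obtain c2 where c2: "0 < c2" "\<And>\<epsilon> \<eta>. 0 < \<epsilon> \<Longrightarrow> 0 < \<eta> \<Longrightarrow> \<eta> \<le> 1 \<Longrightarrow> A \<epsilon> \<eta> \<ge> ennreal c2" using assms(2) by blast
  obtain \<eta>0 where \<eta>0: "0 < \<eta>0" "\<And>\<eta> \<epsilon>. 0 < \<eta> \<Longrightarrow> \<eta> < \<eta>0 \<Longrightarrow> 0 < \<epsilon> \<Longrightarrow> A \<epsilon> \<eta> \<ge> ennreal (c1 * g \<eta>)"
    using c1(2) unfolding eventually_at_right_field by blast
  obtain B where B: "\<And>\<eta>. \<eta>0 \<le> \<eta> \<Longrightarrow> \<eta> \<le> 1 \<Longrightarrow> g \<eta> \<le> B" using bd[OF \<eta>0(1)] by blast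
  define c where "c = min c1 (c2 / (\<bar>B\<bar> + 1))"
  have c: "0 < c" "c \<le> c1" "c * (\<bar>B\<bar> + 1) \<le> c2" using c1 c2 by (auto simp: c_def pos_le_divide_eq[symmetric])
  have "A \<epsilon> \<eta> \<ge> ennreal (c * g \<eta>)" if "0 < \<epsilon>" "0 < \<eta>" "\<eta> \<le> 1" for \<epsilon> \<eta>
  proof (cases "\<eta> < \<eta>0")
    case True
    have "ennreal (c * g \<eta>) \<le> ennreal (c1 * g \<eta>)" using c g[OF that(2)] by (intro ennreal_leI mult_right_mono) auto
    then show ?thesis using \<eta>0(2)[OF that(2) True that(1)] by (rule order_trans)
  next
    case False
    have "c * g \<eta> \<le> c * (\<bar>B\<bar> + 1)" using B[of \<eta>] False that c by (intro mult_left_mono) auto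
    then have "ennreal (c * g \<eta>) \<le> ennreal c2" using c(3) by (intro ennreal_leI) linarith
    then show ?thesis using c2(2)[OF that] by (rule order_trans)
  qed
  then show ?thesis using c by blast
qed

theorem theorem5p4:
  fixes p :: real and T :: "(real^'n) set"
  assumes "CARD('n) \<ge> 2" and "1 < p" and "admissible_hole T"
  shows "(CARD('n) \<ge> 3 \<longrightarrow>
           (\<exists>c>0. \<forall>\<epsilon> \<eta>. 0 < \<epsilon> \<and> \<epsilon> \<le> 1 \<and> 0 < \<eta> \<and> \<eta> \<le> 1 \<longrightarrow>
              A_const p T \<epsilon> \<eta> \<ge> ennreal (c * \<eta> powr (- real CARD('n) * \<bar>1/2 - 1/p\<bar>)))) \<and>
         (CARD('n) = 2 \<longrightarrow>
           (\<exists>c>0. \<forall>\<epsilon> \<eta>. 0 < \<epsilon> \<and> \<epsilon> \<le> 1 \<and> 0 < \<eta> \<and> \<eta> \<le> 1 \<longrightarrow>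
              A_const p T \<epsilon> \<eta> \<ge>
                ennreal (c * \<bar>ln (\<eta> / 2)\<bar> powr (- 1/2) * \<eta> powr (- 2 * \<bar>1/2 - 1/p\<bar>))))"
proof -
  obtain c0 \<rho> where T: "compact T" "T \<subseteq> unit_cell" "0 < c0" "ball 0 c0 \<subseteq> T"
    and \<rho>: "0 < \<rho>" "\<And>t i. t \<in> T \<Longrightarrow> \<bar>t $ i\<bar> \<le> 1/2 - \<rho>"
    using admissible_holeD[OF assms(3)] by blast
  obtain st st' where st: "\<And>s. (st has_real_derivative st' s) (at s)" "smooth1 st'" "smooth1 st" "\<And>s. 0 \<le> st' s"
    "\<And>s. s \<le> 1 \<Longrightarrow> st s = 0" "\<And>s. 2 \<le> s \<Longrightarrow> st s = 1"
    "\<And>s. 1 < s \<Longrightarrow> s < 2 \<Longrightarrow> 0 < st' s" "\<And>s. s \<le> 1 \<or> 2 \<le> s \<Longrightarrow> st' s = 0"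
    by (rule smooth_step_exists) (rule that)
  obtain st'' where st'': "\<And>s. (st' has_real_derivative st'' s) (at s)" "smooth1 st''"
    by (rule smooth1D[OF st(2)]) (rule that)
  interpret smooth_step st st' st'' by unfold_locales (rule st st''; assumption?)+
  define \<delta> where "\<delta> = \<bar>1/2 - 1/p\<bar>"
  \<comment> \<open>The larger of 1/p and 1 - 1/p; it selects the better of the two data for the
    given \<open>p\<close>.\<close>
  define \<alpha> where "\<alpha> = 1/2 + \<delta>"
  have \<delta>: "0 \<le> \<delta>" by (simp add: \<delta>_def)
  have \<alpha>: "\<alpha> = 1 / p \<or> \<alpha> = 1 - 1 / p" by (auto simp: \<alpha>_def \<delta>_def abs_if)
  have unif: "\<exists>c>0. \<forall>\<epsilon> \<eta>. 0 < \<epsilon> \<and> 0 < \<eta> \<and> \<eta> \<le> 1 \<longrightarrow> A_const p T \<epsilon> \<eta> \<ge> ennreal c"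
    by (rule A_const_lower_bound_uniform[OF T(1,3,4) assms(2) \<rho>])
  have pos_ev: "\<forall>\<^sub>F \<eta> in at_right 0. (0::real) < \<eta>" by (rule eventually_at_right_less)
  show ?thesis
  proof (intro conjI impI)
    assume d3: "3 \<le> CARD('n)"
    define d where "d = real CARD('n)"
    have d: "3 \<le> d" using d3 by (simp add: d_def)
    \<comment> \<open>The critical scale for d \<ge> 3, with equality in L^2 = \<eta>^(2-d).\<close>
    define l where "l \<eta> = \<eta> powr (1 - d / 2)" for \<eta> :: real
    have lsq: "(l \<eta>)\<^sup>2 = \<eta> powr (2 - d)" if "0 < \<eta>" for \<eta>
      unfolding l_def power2_eq_square using that by (simp flip: powr_add)
    \<comment> \<open>The Newtonian potential |x|^(2-d) / (d-2) in the variable s = |x|^2. It is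
      homogeneous, so its value at the hole is an exact multiple of l^2.\<close>
    define q where "q s = s powr (1 - d / 2) / (d - 2)" for s
    have "\<exists>c>0. \<forall>\<^sub>F \<eta> in at_right 0. \<forall>\<epsilon>>0. A_const p T \<epsilon> \<eta> \<ge> ennreal (c * (1 / l \<eta> * \<eta> powr (1 - real CARD('n) * \<alpha>)))"
    proof (rule A_const_lower_bound_small[OF T assms(2) \<alpha>, where q=q and Cn="(c0\<^sup>2 / 2) powr (1 - d / 2) / (d - 2)"])
      show "\<forall>\<^sub>F \<eta> in at_right 0. \<eta> powr (2 - real CARD('n)) \<le> (l \<eta>)\<^sup>2"
        using pos_ev by eventually_elim (simp add: lsq d_def)
      show "filterlim l at_top (at_right 0)" unfolding l_def using d by real_asymp
      have "((\<lambda>\<eta>. \<eta> powr (d / 2)) \<longlongrightarrow> 0) (at_right 0)" using d by real_asymp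
      moreover have "\<forall>\<^sub>F \<eta> in at_right 0. \<eta> powr (d / 2) = l \<eta> * (\<eta> ^ CARD('n) / \<eta>)"
        using pos_ev
      proof eventually_elim
        case (elim \<eta>)
        have "\<eta> ^ CARD('n) / \<eta> = \<eta> powr (d - 1)" using elim by (simp add: d_def powr_diff powr_realpow)
        moreover have "(1 - d / 2) + (d - 1) = d / 2" by simp
        ultimately show ?case unfolding l_def by (simp flip: powr_add)
      qed
      ultimately show "((\<lambda>\<eta>. l \<eta> * (\<eta> ^ CARD('n) / \<eta>)) \<longlongrightarrow> 0) (at_right 0)" by (rule Lim_transform_eventually)
      show "(q has_real_derivative - (s powr (- (real CARD('n) / 2))) / 2) (at s)" if "0 < s" for s
      proof -
        have "(q has_real_derivative (1 - d / 2) * s powr (1 - d / 2 - 1) / (d - 2)) (at s)"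
          unfolding q_def using that d by (auto intro!: derivative_eq_intros)
        moreover have "(1 - d / 2) * s powr (1 - d / 2 - 1) / (d - 2) = - (s powr (- (real CARD('n) / 2))) / 2"
          using d by (simp add: d_def[symmetric] field_simps)
        ultimately show ?thesis by simp
      qed
      show "0 \<le> q (1/8)" using d by (simp add: q_def)
      show "\<forall>\<^sub>F \<eta> in at_right 0. q ((c0 * \<eta>)\<^sup>2 / 2) \<le> (c0\<^sup>2 / 2) powr (1 - d / 2) / (d - 2) * (l \<eta>)\<^sup>2"
        using pos_ev
      proof eventually_elim
        case (elim \<eta>)
        have "((c0 * \<eta>)\<^sup>2 / 2) powr (1 - d / 2) = (c0\<^sup>2 / 2 * \<eta>\<^sup>2) powr (1 - d / 2)" by (simp add: power_mult_distrib)
        also have "\<dots> = (c0\<^sup>2 / 2) powr (1 - d / 2) * (\<eta>\<^sup>2) powr (1 - d / 2)" by (rule powr_mult) 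
        also have "(\<eta>\<^sup>2) powr (1 - d / 2) = (l \<eta>)\<^sup>2"
          using elim by (simp add: l_def power2_eq_square powr_mult)
        finally show ?case by (simp add: q_def)
      qed
    qed
    moreover have "1 / l \<eta> * \<eta> powr (1 - real CARD('n) * \<alpha>) = \<eta> powr (- real CARD('n) * \<bar>1/2 - 1/p\<bar>)" if "0 < \<eta>" for \<eta>
    proof -
      have "1 / l \<eta> * \<eta> powr (1 - real CARD('n) * \<alpha>) = \<eta> powr ((1 - d * \<alpha>) - (1 - d / 2))"
        using that by (simp add: l_def d_def powr_diff)
      \<comment> \<open>The terms independent of \<open>p\<close> cancel: the loss 1/L at the
        critical scale removes exactly \<eta>^(1-d/2).\<close>
      also have "(1 - d * \<alpha>) - (1 - d / 2) = - d * \<delta>" by (simp add: \<alpha>_def algebra_simps)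
      finally show ?thesis by (simp add: d_def \<delta>_def)
    qed
    ultimately have small: "\<exists>c>0. \<forall>\<^sub>F \<eta> in at_right 0. \<forall>\<epsilon>>0. A_const p T \<epsilon> \<eta> \<ge> ennreal (c * \<eta> powr (- real CARD('n) * \<bar>1/2 - 1/p\<bar>))"
    proof (elim exE conjE)
      fix c assume c: "0 < c" "\<forall>\<^sub>F \<eta> in at_right 0. \<forall>\<epsilon>>0. A_const p T \<epsilon> \<eta> \<ge> ennreal (c * (1 / l \<eta> * \<eta> powr (1 - real CARD('n) * \<alpha>)))"
        and eq: "\<And>\<eta>. 0 < \<eta> \<Longrightarrow> 1 / l \<eta> * \<eta> powr (1 - real CARD('n) * \<alpha>) = \<eta> powr (- real CARD('n) * \<bar>1/2 - 1/p\<bar>)"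
      have "\<forall>\<^sub>F \<eta> in at_right 0. \<forall>\<epsilon>>0. A_const p T \<epsilon> \<eta> \<ge> ennreal (c * \<eta> powr (- real CARD('n) * \<bar>1/2 - 1/p\<bar>))"
        using pos_ev c(2) by eventually_elim (simp only: eq)
      then show ?thesis using c(1) by blast
    qed
    show "\<exists>c>0. \<forall>\<epsilon> \<eta>. 0 < \<epsilon> \<and> \<epsilon> \<le> 1 \<and> 0 < \<eta> \<and> \<eta> \<le> 1 \<longrightarrow>
              A_const p T \<epsilon> \<eta> \<ge> ennreal (c * \<eta> powr (- real CARD('n) * \<bar>1/2 - 1/p\<bar>))"
    proof (rule lower_bound_combine[OF small unif])
      fix \<eta>0 :: real assume "0 < \<eta>0"
      then show "\<exists>B. \<forall>\<eta>. \<eta>0 \<le> \<eta> \<and> \<eta> \<le> 1 \<longrightarrow> \<eta> powr (- real CARD('n) * \<bar>1/2 - 1/p\<bar>) \<le> B"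
        by (intro exI[of _ "\<eta>0 powr (- real CARD('n) * \<bar>1/2 - 1/p\<bar>)"] allI impI powr_mono2') (auto intro: mult_nonneg_nonneg)
    qed simp
  next
    assume d2: "CARD('n) = 2"
    define l where "l \<eta> = sqrt \<bar>ln (\<eta> / 2)\<bar>" for \<eta> :: real
    \<comment> \<open>The planar potential - ln |x| in the variable s = |x|^2, nonnegative at s =
      1/8.\<close>
    define q where "q s = - ln s / 2" for s :: real
    have small_ev: "\<forall>\<^sub>F \<eta> in at_right 0. (0::real) < \<eta> \<and> \<eta> < 1/2"
      unfolding eventually_at_right_field by (rule exI[of _ "1/2"]) auto
    have one: "1 \<le> \<bar>ln (\<eta> / 2)\<bar>" "\<bar>ln (\<eta> / 2)\<bar> = ln 2 - ln \<eta>" if "0 < \<eta>" "\<eta> < 1/2" for \<eta> :: real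
    proof -
      have l2: "ln (\<eta> / 2) = ln \<eta> - ln 2" using that by (simp add: ln_div)
      \<comment> \<open>For \<eta> < 1/2 the number 2/\<eta> exceeds 4 > e, so the logarithm is at
        least 1. This gives \<eta>^(2-d) = 1 \<le> l^2 in the plane and lets l^2 absorb additive
        constants.\<close>
      have "exp 1 \<le> (4::real)" using exp_le by simp
      moreover have "(4::real) \<le> 2 / \<eta>" using that by (simp add: field_simps)
      ultimately have "exp 1 \<le> 2 / \<eta>" by linarith
      then have "ln (exp 1) \<le> ln (2 / \<eta>)" using that by (subst ln_le_cancel_iff) auto
      then have "1 \<le> ln 2 - ln \<eta>" using that by (simp add: ln_div)
      then show "1 \<le> \<bar>ln (\<eta> / 2)\<bar>" "\<bar>ln (\<eta> / 2)\<bar> = ln 2 - ln \<eta>" using l2 by auto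
    qed
    have "\<exists>c>0. \<forall>\<^sub>F \<eta> in at_right 0. \<forall>\<epsilon>>0. A_const p T \<epsilon> \<eta> \<ge> ennreal (c * (1 / l \<eta> * \<eta> powr (1 - real CARD('n) * \<alpha>)))"
    proof (rule A_const_lower_bound_small[OF T assms(2) \<alpha>, where q=q and Cn="1 + \<bar>ln (c0\<^sup>2 / 2) / 2\<bar>"])
      show "\<forall>\<^sub>F \<eta> in at_right 0. \<eta> powr (2 - real CARD('n)) \<le> (l \<eta>)\<^sup>2"
        using small_ev
      proof eventually_elim
        case (elim \<eta>)
        have "\<eta> powr (2 - real CARD('n)) = 1" "(l \<eta>)\<^sup>2 = \<bar>ln (\<eta> / 2)\<bar>" using elim by (simp_all add: d2 l_def)
        then show ?case using one(1)[of \<eta>] elim by simp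
      qed
      show "filterlim l at_top (at_right 0)" unfolding l_def by real_asymp
      show "((\<lambda>\<eta>. l \<eta> * (\<eta> ^ CARD('n) / \<eta>)) \<longlongrightarrow> 0) (at_right 0)" unfolding l_def d2 by real_asymp
      show "(q has_real_derivative - (s powr (- (real CARD('n) / 2))) / 2) (at s)" if "0 < s" for s
      proof -
        have "((\<lambda>s. - ln s / 2) has_real_derivative - (1 / s) / 2) (at s)"
          by (rule DERIV_cdivide[OF DERIV_minus[OF DERIV_ln_divide[OF that]]])
        moreover have "s powr (- (real CARD('n) / 2)) = 1 / s" using that by (simp add: d2 powr_minus_divide)
        ultimately show ?thesis unfolding q_def[abs_def] by simp
      qed
      show "0 \<le> q (1/8)" by (simp add: q_def ln_div)
      show "\<forall>\<^sub>F \<eta> in at_right 0. q ((c0 * \<eta>)\<^sup>2 / 2) \<le> (1 + \<bar>ln (c0\<^sup>2 / 2) / 2\<bar>) * (l \<eta>)\<^sup>2"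
        using small_ev
      proof eventually_elim
        case (elim \<eta>)
        have \<eta>: "0 < \<eta>" "\<eta> < 1/2" using elim by auto
        have "(c0 * \<eta>)\<^sup>2 / 2 = c0\<^sup>2 / 2 * \<eta>\<^sup>2" by (simp add: power_mult_distrib)
        then have "ln ((c0 * \<eta>)\<^sup>2 / 2) = ln (c0\<^sup>2 / 2 * \<eta>\<^sup>2)" by (rule arg_cong)
        also have "\<dots> = ln (c0\<^sup>2 / 2) + ln (\<eta>\<^sup>2)" using T(3) \<eta> by (subst ln_mult) auto
        also have "ln (\<eta>\<^sup>2) = 2 * ln \<eta>" using \<eta> by (simp add: ln_realpow)
        finally have "q ((c0 * \<eta>)\<^sup>2 / 2) = - ln (c0\<^sup>2 / 2) / 2 - ln \<eta>" by (simp add: q_def field_simps)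
        \<comment> \<open>The logarithm of the radius \<open>c0\<close> is only an additive
          constant; being multiplied by |ln (\<eta>/2)| \<ge> 1 it is absorbed into
          \<open>Cn\<close>.\<close>
        also have "\<dots> \<le> \<bar>ln (c0\<^sup>2 / 2) / 2\<bar> * 1 + (ln 2 - ln \<eta>)" by (simp add: abs_if)
        also have "\<dots> \<le> \<bar>ln (c0\<^sup>2 / 2) / 2\<bar> * \<bar>ln (\<eta> / 2)\<bar> + \<bar>ln (\<eta> / 2)\<bar>"
          using one[OF \<eta>] by (intro add_mono mult_left_mono) auto
        also have "\<dots> = (1 + \<bar>ln (c0\<^sup>2 / 2) / 2\<bar>) * (l \<eta>)\<^sup>2" by (simp add: l_def algebra_simps)
        finally show ?case .
      qed
    qed
    moreover have "1 / l \<eta> * \<eta> powr (1 - real CARD('n) * \<alpha>) = \<bar>ln (\<eta> / 2)\<bar> powr (- 1/2) * \<eta> powr (- 2 * \<bar>1/2 - 1/p\<bar>)" for \<eta>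
    proof -
      have "1 - real CARD('n) * \<alpha> = - 2 * \<bar>1/2 - 1/p\<bar>" by (simp add: d2 \<alpha>_def \<delta>_def)
      moreover have "1 / l \<eta> = \<bar>ln (\<eta> / 2)\<bar> powr (- 1/2)"
        by (simp add: l_def powr_minus powr_half_sqrt inverse_eq_divide)
      ultimately show ?thesis by simp
    qed
    ultimately have small: "\<exists>c>0. \<forall>\<^sub>F \<eta> in at_right 0. \<forall>\<epsilon>>0. A_const p T \<epsilon> \<eta> \<ge> ennreal (c * (\<bar>ln (\<eta> / 2)\<bar> powr (- 1/2) * \<eta> powr (- 2 * \<bar>1/2 - 1/p\<bar>)))"
      by (simp only:)
    have "\<exists>c>0. \<forall>\<epsilon> \<eta>. 0 < \<epsilon> \<and> \<epsilon> \<le> 1 \<and> 0 < \<eta> \<and> \<eta> \<le> 1 \<longrightarrow>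
              A_const p T \<epsilon> \<eta> \<ge> ennreal (c * (\<bar>ln (\<eta> / 2)\<bar> powr (- 1/2) * \<eta> powr (- 2 * \<bar>1/2 - 1/p\<bar>)))"
    proof (rule lower_bound_combine[OF small unif])
      fix \<eta>0 :: real assume \<eta>0: "0 < \<eta>0"
      show "\<exists>B. \<forall>\<eta>. \<eta>0 \<le> \<eta> \<and> \<eta> \<le> 1 \<longrightarrow> \<bar>ln (\<eta> / 2)\<bar> powr (- 1/2) * \<eta> powr (- 2 * \<bar>1/2 - 1/p\<bar>) \<le> B"
      proof (intro exI allI impI)
        fix \<eta> assume \<eta>: "\<eta>0 \<le> \<eta> \<and> \<eta> \<le> 1"
        have "ln \<eta> \<le> 0" using \<eta> \<eta>0 by simp
        \<comment> \<open>Dividing \<eta> by 2 keeps the logarithm away from zero up to \<eta> = 1,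
          so its negative power stays bounded there.\<close>
        then have "ln 2 \<le> \<bar>ln (\<eta> / 2)\<bar>" using \<eta> \<eta>0 by (simp add: ln_div)
        then have "\<bar>ln (\<eta> / 2)\<bar> powr (- 1/2) \<le> ln 2 powr (- 1/2)" by (intro powr_mono2') auto
        moreover have "\<eta> powr (- 2 * \<bar>1/2 - 1/p\<bar>) \<le> \<eta>0 powr (- 2 * \<bar>1/2 - 1/p\<bar>)"
          using \<eta> \<eta>0 by (intro powr_mono2') auto
        ultimately show "\<bar>ln (\<eta> / 2)\<bar> powr (- 1/2) * \<eta> powr (- 2 * \<bar>1/2 - 1/p\<bar>) \<le> ln 2 powr (- 1/2) * \<eta>0 powr (- 2 * \<bar>1/2 - 1/p\<bar>)"
          by (intro mult_mono) auto
      qed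
    qed simp
    then show "\<exists>c>0. \<forall>\<epsilon> \<eta>. 0 < \<epsilon> \<and> \<epsilon> \<le> 1 \<and> 0 < \<eta> \<and> \<eta> \<le> 1 \<longrightarrow>
              A_const p T \<epsilon> \<eta> \<ge> ennreal (c * \<bar>ln (\<eta> / 2)\<bar> powr (- 1/2) * \<eta> powr (- 2 * \<bar>1/2 - 1/p\<bar>))"
      by (simp only: mult.assoc)
  qed
qed

end
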